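(* Let $n,k$ be integers with $2\le k<n$ and let $p\ge k$ be real. There exist constants $U_*>0$, $W_*>1$ and $C_G$, depending only on $n,k,p$, such that every $C^2$ function $u:\mathbb R^n\to\mathbb R$ satisfying $$\sigma_k(A[u])=u^p\ \text{ in }\mathbb R^n,\qquad u\ge 0,\quad |Du|<1,\quad \lambda(A[u])\in\overline{\Gamma_k}\ \text{ on }\mathbb R^n$$ satisfies, with $W=(1-|Du|^2)^{-1/2}$, $$u(x)\le U_*,\qquad W(x)\le W_*\qquad (x\in\mathbb R^n).$$ In particular, every such solution satisfies $|Du|^2\le 1-W_*^{-2}$ on $\mathbb R^n$. Moreover, every such solution satisfies the pointwise estimate $$W(x)\le C_G\,(1+u(x))^{1+p/k}\qquad (x\in\mathbb R^n).$$
   Context: $D$ and $D^2$ are the Euclidean gradient and Hessian on $\mathbb R^n$. For a $C^2$ function $u$ with $|Du|<1$ (a spacelike graph in Lorentz--Minkowski space $\mathbb R^{n,1}$) put $g_{ij}=\delta_{ij}-u_iu_j$, $W=(1-|Du|^2)^{-1/2}$, $h_{ij}=-W u_{ij}$, and $A[u]=g^{-1}h$ (the shape operator; its eigenvalues are real, being those of the symmetric matrix $g^{-1/2}hg^{-1/2}$). $\lambda(A[u])=(\lambda_1,\dots,\lambda_n)$ denotes these eigenvalues. $\sigma_j$ is the $j$th elementary symmetric polynomial and $\sigma_j(A)=\sigma_j(\lambda(A))$. The G\aa rding cone is $\Gamma_k=\{\lambda\in\mathbb R^n:\sigma_j(\lambda)>0 \text{ for }1\le j\le k\}$, and $\overline{\Gamma_k}$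 is its closure. *)

theory Defs
  imports
    "HOL-Analysis.Analysis"
    "HOL-Computational_Algebra.Polynomial"
begin

definition grad :: "(real^'n \<Rightarrow> real) \<Rightarrow> real^'n \<Rightarrow> real^'n" where
  "grad u x = (\<chi> i. frechet_derivative u (at x) (axis i 1))"

definition hess :: "(real^'n \<Rightarrow> real) \<Rightarrow> real^'n \<Rightarrow> real^'n^'n" where
  "hess u x = jacobian (grad u) (at x)"

definition C2 :: "(real^'n \<Rightarrow> real) \<Rightarrow> bool" where
  "C2 u \<longleftrightarrow> (\<forall>x. u differentiable (at x)) \<and>
            (\<forall>x. grad u differentiable (at x)) \<and>
            continuous_on UNIV (hess u)"

definition Wfun :: "(real^'n \<Rightarrow> real) \<Rightarrow> real^'n \<Rightarrow> real" where
  "Wfun u x = (1 - (norm (grad u x))\<^sup>2) powr (- (1/2))"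

definition gmat :: "(real^'n \<Rightarrow> real) \<Rightarrow> real^'n \<Rightarrow> real^'n^'n" where
  "gmat u x = (\<chi> i j. (if i = j then 1 else 0) - grad u x $ i * grad u x $ j)"

definition hmat :: "(real^'n \<Rightarrow> real) \<Rightarrow> real^'n \<Rightarrow> real^'n^'n" where
  "hmat u x = (\<chi> i j. - Wfun u x * hess u x $ i $ j)"

definition shape_operator :: "(real^'n \<Rightarrow> real) \<Rightarrow> real^'n \<Rightarrow> real^'n^'n" where
  "shape_operator u x = matrix_inv (gmat u x) ** hmat u x"

definition charpoly :: "real^'n^'n \<Rightarrow> real poly" where
  "charpoly A = det (\<chi> i j. (if i = j then [:0, 1:] else 0) - [:A $ i $ j:])"

text \<open>
  The eigenvalues of \<open>A\<close>, listed with algebraic multiplicity as a vector. This is meaningful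
  only when the characteristic polynomial splits over the reals, as it does for the shape operator
  of a spacelike \<open>C\<^sup>2\<close> graph. The order of the entries is an arbitrary choice; it is irrelevant
  below because \<open>esym\<close> and \<open>garding_cone\<close> are invariant under permutations of the entries.
\<close>

definition eigenvalues :: "real^'n^'n \<Rightarrow> real^'n" where
  "eigenvalues A = (SOME l. charpoly A = (\<Prod>i\<in>UNIV. [:- (l $ i), 1:]))"

definition esym :: "nat \<Rightarrow> real^'n \<Rightarrow> real" where
  "esym j l = (\<Sum>S\<in>{S. card S = j}. \<Prod>i\<in>S. l $ i)"

definition sigma_op :: "nat \<Rightarrow> real^'n^'n \<Rightarrow> real" where
  "sigma_op j A = esym j (eigenvalues A)"

definition garding_cone :: "nat \<Rightarrow> (real^'n) set" where
  "garding_cone k = {l. \<forall>j\<in>{1..k}. esym j l > 0}"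

end

theory Submission
  imports Defs
begin

text \<open>
  All eigenvalue conditions become statements about one symmetric matrix. With \<open>D\<close> the gradient, the
  symmetric matrix \<open>L = 1 + W\<^sup>2/(W+1) D D\<^sup>T\<close> satisfies \<open>L\<^sup>2 = g\<^sup>-\<^sup>1\<close>, so the shape operator has the same
  characteristic polynomial as \<open>S = L h L\<close>, and \<open>z \<bullet> S z = - W (D\<^sup>2u)(L z, L z)\<close>. Comparing graphs at a
  point of contact is then comparing quadratic forms. The function is only twice differentiable, so the
  equation is never differentiated: everything comes from first and second order conditions at extrema.

  \<^bold>\<open>Height.\<close> Two comparisons are combined. First, only the nonnegativity of the mean curvature and
  \<open>u \<ge> 0\<close> force a cone of slope almost one to be impossible at unit scale: if \<open>u x \<le> 2\<close> then
  \<open>u y \<ge> u x - \<rho> + c \<rho>\<^sup>q\<close> for \<open>\<rho> = |x - y| \<le> 4\<close>, because the right-hand side is a radial function of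
  negative mean curvature that cannot touch \<open>u\<close> from below (\<open>steep_cone_lower_bound\<close>). Second, for any
  \<open>x\<close> and \<open>r\<close> a hyperboloid of radius \<open>r\<close> centred above \<open>x\<close> touches the graph from below at some \<open>y\<close>,
  since \<open>u \<ge> 0\<close> makes \<open>u + sqrt (r\<^sup>2 + |\<cdot> - x|\<^sup>2)\<close> coercive (\<open>hyperboloid_touching_from_below\<close>). There
  the principal curvatures are at most \<open>1/r\<close>, so the equation bounds \<open>u y\<close>; fix \<open>r\<close> so that \<open>u y \<le> 1\<close>.
  If \<open>u x\<close> were large, \<open>|x - y|\<close> would be large too, the hyperboloid would have slope almost one near
  \<open>y\<close>, and \<open>u\<close>, which lies above it, would rise by almost \<open>1\<close> at distance \<open>1\<close> from \<open>y\<close>. This contradicts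
  the first comparison (\<open>entire_solution_bounded\<close>).

  \<^bold>\<open>Gradient.\<close> Given \<open>u \<le> U\<close>, let \<open>G t = t - \<mu>/(1+t)\<close> with small \<open>\<mu>\<close>. If \<open>G \<circ> u\<close> is \<open>1\<close>-Lipschitz, then
  \<open>|Du| \<le> 1/G'(U) < 1\<close>, which is the bound on \<open>W\<close>. Otherwise \<open>G (u x) - G (u y) - |x - y|\<close> has a positive
  supremum; after a small quadratic penalty it has a maximum at some \<open>x \<noteq> y\<close>. There \<open>G' Du\<close> equals the
  unit vector \<open>e\<close> from \<open>y\<close> to \<open>x\<close> at both points, up to a small error, and varying \<open>x\<close> and \<open>y\<close>
  by \<open>L\<^sub>x z\<close> and \<open>L\<^sub>y z\<close> gives
  \<open>S\<^sub>x \<ge> \<rho> (S\<^sub>y + \<delta> e e\<^sup>T - \<epsilon>)\<close> with \<open>\<rho> \<ge> 1\<close>,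
  where \<open>\<delta>\<close> is a positive multiple of \<open>u x - u y\<close> because \<open>1/sqrt (G'\<^sup>2 - 1)\<close>, the value prescribed for
  \<open>W/G'\<close>, is a log-concave function of height. Also \<open>e \<bullet> S\<^sub>y e \<le> - K\<close>, where both \<open>K\<close> and
  \<open>\<delta>/(u x - u y)\<close> tend to infinity as \<open>\<mu> \<rightarrow> 0\<close>.

  On the closed Garding cone \<open>\<sigma>\<^sub>k\<close> is monotone (\<open>in_cone_mono\<close>), and in a direction of negative curvature
  \<open>-K\<close> its derivative is at least \<open>K\<^sup>k\<^sup>-\<^sup>1\<close> and controls the derivatives in all other directions, which
  absorbs \<open>\<epsilon>\<close> (\<open>sigma_op_increase\<close>). Hence \<open>u x powr p \<ge> u y powr p + \<delta> K\<^sup>k\<^sup>-\<^sup>1/2\<close>, which contradicts the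
  Lipschitz continuity of \<open>t powr p\<close> on \<open>[0, U]\<close> once \<open>\<mu>\<close> is small. Finally \<open>(1 + u)\<close> to a positive power
  is at least \<open>1\<close>, so the pointwise estimate holds with the constant that bounds \<open>W\<close>.
\<close>

section \<open>Elementary symmetric polynomials and Newton's inequality\<close>

text \<open>
  The index set is explicit because differentiating such a polynomial in one entry deletes that entry.
\<close>

definition elem_sym :: "'a set \<Rightarrow> nat \<Rightarrow> ('a \<Rightarrow> real) \<Rightarrow> real" where
  "elem_sym A j l = (\<Sum>S\<in>{S. S \<subseteq> A \<and> card S = j}. \<Prod>i\<in>S. l i)"

lemma elem_sym_0 [simp]:
  assumes "finite A" shows "elem_sym A 0 l = 1"
proof -
  have "{S. S \<subseteq> A \<and> card S = 0} = {{}}"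
    using assms by (auto dest: finite_subset)
  then show ?thesis by (simp add: elem_sym_def)
qed

lemma elem_sym_eq_0:
  assumes "finite A" "card A < j" shows "elem_sym A j l = 0"
proof -
  have "{S. S \<subseteq> A \<and> card S = j} = {}"
  proof (rule ccontr)
    assume "{S. S \<subseteq> A \<and> card S = j} \<noteq> {}"
    then obtain S where "S \<subseteq> A" "card S = j" by blast
    then show False using card_mono[OF assms(1), of S] assms(2) by simp
  qed
  then show ?thesis by (simp only: elem_sym_def sum.empty)
qed

lemma elem_sym_insert:
  assumes "finite A" "i \<notin> A"
  shows "elem_sym (insert i A) (Suc j) l = elem_sym A (Suc j) l + l i * elem_sym A j l"
proof -
  let ?P = "\<lambda>A j. {S. S \<subseteq> A \<and> card S = j}"
  have fin: "finite (?P B j)" if "finite B" for B :: "'a set" and j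
    by (rule finite_subset[of _ "Pow B"]) (use that in auto)
  have split: "?P (insert i A) (Suc j) = ?P A (Suc j) \<union> insert i ` ?P A j"
  proof (rule set_eqI, rule iffI)
    fix S assume S: "S \<in> ?P (insert i A) (Suc j)"
    show "S \<in> ?P A (Suc j) \<union> insert i ` ?P A j"
    proof (cases "i \<in> S")
      case True
      have "finite S" using S assms finite_subset by fastforce
      then have "S - {i} \<in> ?P A j" using S True by auto
      moreover have "S = insert i (S - {i})" using True by auto
      ultimately show ?thesis by blast
    next
      case False
      then show ?thesis using S by auto
    qed
  next
    fix S assume S: "S \<in> ?P A (Suc j) \<union> insert i ` ?P A j"
    then show "S \<in> ?P (insert i A) (Suc j)"
    proof
      assume "S \<in> insert i ` ?P A j"
      then obtain T where T: "S = insert i T" "T \<subseteq> A" "card T = j" by auto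
      have "finite T" using T assms finite_subset by blast
      then have "card S = Suc j" using T assms by (auto simp: card_insert_if)
      then show ?thesis using T by auto
    qed auto
  qed
  have inj: "inj_on (insert i) (?P A j)"
    using assms(2) by (auto simp: inj_on_def insert_ident subset_iff)
  have "elem_sym (insert i A) (Suc j) l
      = elem_sym A (Suc j) l + (\<Sum>S\<in>insert i ` ?P A j. \<Prod>i\<in>S. l i)"
    unfolding elem_sym_def split
    by (rule sum.union_disjoint) (use fin assms in auto)
  also have "(\<Sum>S\<in>insert i ` ?P A j. \<Prod>i\<in>S. l i) = (\<Sum>S\<in>?P A j. l i * (\<Prod>i\<in>S. l i))"
    unfolding sum.reindex[OF inj] o_def
  proof (rule sum.cong[OF refl])
    fix S assume "S \<in> ?P A j"
    then have "finite S" "i \<notin> S" using assms finite_subset by auto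
    then show "(\<Prod>i\<in>insert i S. l i) = l i * (\<Prod>i\<in>S. l i)" by simp
  qed
  also have "\<dots> = l i * elem_sym A j l"
    unfolding elem_sym_def by (rule sum_distrib_left[symmetric])
  finally show ?thesis .
qed

lemma elem_sym_remove:
  assumes "finite A" "i \<in> A"
  shows "elem_sym A (Suc j) l = elem_sym (A - {i}) (Suc j) l + l i * elem_sym (A - {i}) j l"
proof -
  have "elem_sym (insert i (A - {i})) (Suc j) l
      = elem_sym (A - {i}) (Suc j) l + l i * elem_sym (A - {i}) j l"
    by (rule elem_sym_insert) (use assms in simp_all)
  then show ?thesis unfolding insert_Diff[OF assms(2)] .
qed

lemma elem_sym_1:
  assumes "finite A" shows "elem_sym A (Suc 0) l = sum l A"
  using assms
proof (induction A)
  case empty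
  then show ?case by (rule elem_sym_eq_0[THEN trans]) simp_all
next
  case (insert x F)
  then show ?case using elem_sym_insert[of F x 0 l] by simp
qed

lemma prod_eq_sum_elem_sym:
  assumes "finite A"
  shows "(\<Prod>i\<in>A. t + l i) = (\<Sum>j\<le>card A. elem_sym A j l * t ^ (card A - j))"
proof -
  have "(\<Prod>i\<in>A. l i + t) = (\<Sum>X\<in>Pow A. prod l X * t ^ card (A - X))"
    using prod_add[OF assms, of l "\<lambda>_. t"] by simp
  also have "\<dots> = (\<Sum>X\<in>Pow A. prod l X * t ^ (card A - card X))"
    by (rule sum.cong) (use assms in \<open>auto simp: card_Diff_subset finite_subset\<close>)
  also have "\<dots> = (\<Sum>j\<le>card A. \<Sum>X\<in>{X\<in>Pow A. card X = j}. prod l X * t ^ (card A - card X))"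
    by (rule sum.group[symmetric]) (use assms in \<open>auto intro: card_mono\<close>)
  also have "\<dots> = (\<Sum>j\<le>card A. elem_sym A j l * t ^ (card A - j))"
  proof (rule sum.cong[OF refl])
    fix j
    have "{X \<in> Pow A. card X = j} = {S. S \<subseteq> A \<and> card S = j}" by auto
    then show "(\<Sum>X\<in>{X\<in>Pow A. card X = j}. prod l X * t ^ (card A - card X))
      = elem_sym A j l * t ^ (card A - j)"
      by (simp add: elem_sym_def sum_distrib_right)
  qed
  finally show ?thesis by (simp only: add.commute[of t])
qed

lemma coeff_prod_linear:
  assumes "finite A" "j \<le> card A"
  shows "coeff (\<Prod>i\<in>A. [:l i, 1:]) (card A - j) = elem_sym A j l"
proof -
  let ?q = "(\<Sum>j\<le>card A. monom (elem_sym A j l) (card A - j))"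
  have "poly (\<Prod>i\<in>A. [:l i, 1:]) t = poly ?q t" for t
    using prod_eq_sum_elem_sym[OF assms(1), of t l]
    by (simp add: poly_prod poly_sum poly_monom add.commute)
  then have "(\<Prod>i\<in>A. [:l i, 1:]) = ?q" by (simp add: poly_eq_poly_eq_iff[symmetric] fun_eq_iff)
  then have "coeff (\<Prod>i\<in>A. [:l i, 1:]) (card A - j)
      = (\<Sum>i\<le>card A. if card A - i = card A - j then elem_sym A i l else 0)"
    by (simp add: coeff_sum)
  also have "\<dots> = (\<Sum>i\<le>card A. if i = j then elem_sym A i l else 0)"
    by (rule sum.cong) (use assms in auto)
  also have "\<dots> = elem_sym A j l" using assms by simp
  finally show ?thesis .
qed

lemma elem_sym_le_pow:
  assumes "finite A" "\<And>i. i \<in> A \<Longrightarrow> \<bar>l i\<bar> \<le> b"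
  shows "elem_sym A j l \<le> real (card A choose j) * b ^ j"
proof -
  have "elem_sym A j l \<le> (\<Sum>S\<in>{S. S \<subseteq> A \<and> card S = j}. b ^ j)"
    unfolding elem_sym_def
  proof (rule sum_mono)
    fix S assume S: "S \<in> {S. S \<subseteq> A \<and> card S = j}"
    have "(\<Prod>i\<in>S. l i) \<le> \<bar>\<Prod>i\<in>S. l i\<bar>" by simp
    also have "\<dots> = (\<Prod>i\<in>S. \<bar>l i\<bar>)" by (simp add: abs_prod)
    also have "\<dots> \<le> (\<Prod>i\<in>S. b)" by (rule prod_mono) (use S assms in auto)
    also have "\<dots> = b ^ j" using S by simp
    finally show "(\<Prod>i\<in>S. l i) \<le> b ^ j" .
  qed
  also have "\<dots> = real (card A choose j) * b ^ j"
    using n_subsets[OF assms(1), of j] by simp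
  finally show ?thesis .
qed

definition simple_real_rooted :: "real poly \<Rightarrow> bool" where
  "simple_real_rooted p \<longleftrightarrow> p \<noteq> 0 \<and> card {x. poly p x = 0} = degree p"

text \<open>
  Rolle's theorem puts a root of the derivative strictly between any two consecutive roots.
\<close>

lemma simple_real_rooted_pderiv:
  assumes "simple_real_rooted p" "degree p \<ge> 1"
  shows "simple_real_rooted (pderiv p)"
proof -
  let ?R = "{x. poly p x = 0}"
  have p0: "p \<noteq> 0" and card: "card ?R = degree p"
    using assms(1) by (auto simp: simple_real_rooted_def)
  have finR: "finite ?R" by (rule poly_roots_finite[OF p0])
  define xs where "xs = sorted_list_of_set ?R"
  define m where "m = degree p - 1"
  have len: "length xs = Suc m" using card assms(2) by (simp add: xs_def m_def)
  have inc: "xs ! i < xs ! j" if "i < j" "j < length xs" for i j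
    using that strict_sorted_list_of_set[of ?R] sorted_wrt_nth_less
    unfolding xs_def by blast
  have root: "poly p (xs ! i) = 0" if "i < length xs" for i
    using that nth_mem[of i xs] finR by (simp add: xs_def)
  have "\<exists>z. xs ! i < z \<and> z < xs ! Suc i \<and> poly (pderiv p) z = 0" if "i < m" for i
  proof -
    have "xs ! i < xs ! Suc i" using inc[of i "Suc i"] that len by simp
    then obtain z where "xs ! i < z" "z < xs ! Suc i"
       "poly p (xs ! Suc i) - poly p (xs ! i) = (xs ! Suc i - xs ! i) * poly (pderiv p) z"
      using poly_MVT by blast
    moreover have "poly p (xs ! Suc i) = 0" "poly p (xs ! i) = 0"
      using root[of i] root[of "Suc i"] that len by auto
    ultimately show ?thesis by auto
  qed
  then obtain z where z: "\<And>i. i < m \<Longrightarrow> xs ! i < z i \<and> z i < xs ! Suc i \<and> poly (pderiv p) (z i) = 0"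
    by metis
  have zinc: "z i < z j" if "i < j" "j < m" for i j
  proof -
    have "z i < xs ! Suc i" using z that by simp
    also have "xs ! Suc i \<le> xs ! j"
      using inc[of "Suc i" j] that len by (cases "Suc i = j") auto
    also have "xs ! j < z j" using z that by simp
    finally show ?thesis .
  qed
  have inj: "inj_on z {..<m}"
    by (rule linorder_inj_onI) (use zinc in \<open>auto simp: less_imp_neq\<close>)
  have d0: "pderiv p \<noteq> 0" using assms(2) by (simp add: pderiv_eq_0_iff)
  have deg: "degree (pderiv p) = m" by (simp add: degree_pderiv m_def)
  have "m = card (z ` {..<m})" using inj by (simp add: card_image)
  also have "\<dots> \<le> card {x. poly (pderiv p) x = 0}"
    by (rule card_mono) (use poly_roots_finite[OF d0] z in auto)
  finally have "m \<le> card {x. poly (pderiv p) x = 0}" .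
  moreover have "card {x. poly (pderiv p) x = 0} \<le> degree (pderiv p)"
    by (rule card_poly_roots_bound[OF d0])
  ultimately show ?thesis using deg d0 by (simp add: simple_real_rooted_def)
qed

lemma simple_real_rooted_higher_pderiv:
  assumes "simple_real_rooted p" "q \<le> degree p"
  shows "simple_real_rooted ((pderiv ^^ q) p) \<and> degree ((pderiv ^^ q) p) = degree p - q"
  using assms(2)
proof (induction q)
  case 0
  then show ?case using assms by simp
next
  case (Suc q)
  then show ?case using simple_real_rooted_pderiv[of "(pderiv ^^ q) p"]
    by (auto simp: degree_pderiv)
qed

text \<open>
  Multiplying by one more linear factor changes \<open>Q'\<^sup>2 - Q Q''\<close> into \<open>Q\<^sup>2 + (x - a)\<^sup>2 (Q'\<^sup>2 - Q Q'')\<close>.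
\<close>

lemma laguerre_linear_factors:
  fixes x :: real
  assumes "finite R"
  defines "Q \<equiv> \<lambda>R. (\<Prod>a\<in>R. [:- a, 1:])"
  shows "poly (Q R) x * poly (pderiv (pderiv (Q R))) x \<le> (poly (pderiv (Q R)) x)^2"
  using assms(1)
proof (induction R)
  case empty
  then show ?case by (simp add: Q_def pderiv_1)
next
  case (insert a R)
  let ?P = "poly (Q R) x" and ?P1 = "poly (pderiv (Q R)) x" and ?P2 = "poly (pderiv (pderiv (Q R))) x"
  have QE: "Q (insert a R) = [:- a, 1:] * Q R"
    using insert by (simp add: Q_def)
  have e: "poly (Q (insert a R)) x = (x - a) * ?P"
     "poly (pderiv (Q (insert a R))) x = ?P + (x - a) * ?P1"
     "poly (pderiv (pderiv (Q (insert a R)))) x = 2 * ?P1 + (x - a) * ?P2"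
    unfolding QE by (simp_all add: pderiv_mult pderiv_pCons algebra_simps pderiv_add pderiv_diff pderiv_smult)
  have "(x - a)^2 * (?P * ?P2) \<le> (x - a)^2 * ?P1^2"
    by (rule mult_left_mono[OF insert.IH]) simp
  moreover have "(?P + (x - a) * ?P1)^2 - ((x - a) * ?P) * (2 * ?P1 + (x - a) * ?P2)
      = ?P^2 + ((x - a)^2 * ?P1^2 - (x - a)\<^sup>2 * (?P * ?P2))"
    by (simp add: power2_eq_square algebra_simps)
  ultimately show ?case unfolding e using zero_le_power2[of ?P] by linarith
qed

lemma laguerre_simple_real_rooted:
  assumes "simple_real_rooted p"
  shows "poly p x * poly (pderiv (pderiv p)) x \<le> (poly (pderiv p) x)^2"
proof -
  let ?R = "{x. poly p x = 0}"
  have p0: "p \<noteq> 0" and card: "card ?R = degree p"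
    using assms by (auto simp: simple_real_rooted_def)
  have finR: "finite ?R" by (rule poly_roots_finite[OF p0])
  let ?Q = "\<Prod>a\<in>?R. [:- a, 1:]" and ?c = "lead_coeff p"
  have degQ: "degree ?Q = card ?R"
    by (subst degree_prod_sum_eq) auto
  have lcQ: "lead_coeff ?Q = 1" by (simp add: lead_coeff_prod)
  have "p = smult ?c ?Q"
  proof (rule ccontr)
    assume ne: "p \<noteq> smult ?c ?Q"
    let ?r = "p - smult ?c ?Q"
    have r0: "?r \<noteq> 0" using ne by simp
    have "coeff ?r (degree p) = 0" using lcQ degQ card by simp
    moreover have "degree ?r \<le> degree p"
      by (rule degree_diff_le) (use degQ card p0 in auto)
    ultimately have "degree ?r < degree p"
      using r0 by (metis leading_coeff_0_iff order_le_less)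
    moreover have "?R \<subseteq> {x. poly ?r x = 0}"
      using finR by (auto simp: poly_prod)
    then have "card ?R \<le> card {x. poly ?r x = 0}"
      using card_mono[OF poly_roots_finite[OF r0]] by blast
    then have "degree p \<le> degree ?r"
      using card_poly_roots_bound[OF r0] card by simp
    ultimately show False by simp
  qed
  then obtain c where c: "p = smult c ?Q" by blast
  have "c^2 * (poly ?Q x * poly (pderiv (pderiv ?Q)) x) \<le> c^2 * (poly (pderiv ?Q) x)^2"
    by (rule mult_left_mono[OF laguerre_linear_factors[OF finR]]) simp
  moreover have "poly p x = c * poly ?Q x" "poly (pderiv p) x = c * poly (pderiv ?Q) x"
    "poly (pderiv (pderiv p)) x = c * poly (pderiv (pderiv ?Q)) x"
    using c by (metis poly_smult pderiv_smult)+
  ultimately show ?thesis by (simp add: power2_eq_square algebra_simps)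
qed

text \<open>
  Laguerre's inequality at \<open>0\<close> for the \<open>q\<close>-th derivative of \<open>\<Prod>i. (t + l i)\<close>: its three lowest
  coefficients are \<open>q!\<close>, \<open>(q+1)!\<close> and \<open>(q+2)!/2\<close> times three consecutive elementary symmetric
  polynomials. Distinct entries make the polynomial simply real-rooted, which Rolle's theorem preserves.
\<close>

lemma newton_inequality_inj:
  assumes fin: "finite A" and inj: "inj_on l A" and j: "card A = q + j + 2"
  shows "real (q + 2) * (elem_sym A j l * elem_sym A (j + 2) l) \<le> real (q + 1) * (elem_sym A (j + 1) l)^2"
proof -
  define p where "p = (\<Prod>i\<in>A. [:l i, 1:])"
  have degp: "degree p = card A" unfolding p_def
    by (subst degree_prod_sum_eq) auto
  have p0: "p \<noteq> 0" unfolding p_def using fin by simp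
  have "{x. poly p x = 0} = (\<lambda>i. - l i) ` A"
    using fin by (auto simp: p_def poly_prod image_iff add_eq_0_iff)
  moreover have "inj_on (\<lambda>i. - l i) A" using inj by (auto simp: inj_on_def)
  ultimately have srr: "simple_real_rooted p"
    by (simp add: simple_real_rooted_def p0 degp card_image)
  define g where "g = (pderiv ^^ q) p"
  have "simple_real_rooted g"
    unfolding g_def using simple_real_rooted_higher_pderiv[OF srr, of q] degp j by simp
  from laguerre_simple_real_rooted[OF this, of 0]
  have "coeff g 0 * (2 * coeff g 2) \<le> (coeff g 1)^2"
    by (simp add: poly_0_coeff_0 coeff_pderiv numeral_2_eq_2)
  moreover have "coeff g 0 = fact q * elem_sym A (j + 2) l"
    using coeff_prod_linear[OF fin, of "j+2" l] j
    by (simp add: g_def coeff_higher_pderiv p_def[symmetric] pochhammer_fact[symmetric])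
  moreover have "coeff g 1 = fact (q + 1) * elem_sym A (j + 1) l"
    using coeff_prod_linear[OF fin, of "j+1" l] j
    by (simp add: g_def coeff_higher_pderiv p_def[symmetric] pochhammer_fact pochhammer_rec)
  moreover have "2 * coeff g 2 = fact (q + 2) * elem_sym A j l"
    using coeff_prod_linear[OF fin, of "j" l] j
    by (simp add: g_def coeff_higher_pderiv p_def[symmetric] pochhammer_fact pochhammer_rec numeral_2_eq_2)
  ultimately have "(fact q * elem_sym A (j + 2) l) * (fact (q + 2) * elem_sym A j l)
       \<le> (fact (q + 1) * elem_sym A (j + 1) l)^2" by simp
  then have "(fact q * fact (q+1)) * (real (q + 2) * (elem_sym A j l * elem_sym A (j + 2) l))
    \<le> (fact q * fact (q+1)) * (real (q + 1) * (elem_sym A (j + 1) l)^2)"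
    by (simp add: power2_eq_square algebra_simps)
  then show ?thesis by (subst (asm) mult_le_cancel_left_pos) auto
qed

text \<open>
  The general case is the limit of distinct entries \<open>l i + s v i\<close> with \<open>v\<close> injective. The factors \<open>q + 2\<close> and
  \<open>q + 1\<close> are kept since their strict inequality is what excludes equality in the closed cone.
\<close>

lemma newton_inequality:
  assumes fin: "finite A" and j: "card A = q + j + 2"
  shows "real (q + 2) * (elem_sym A j l * elem_sym A (j + 2) l) \<le> real (q + 1) * (elem_sym A (j + 1) l)^2"
proof -
  obtain v :: "_ \<Rightarrow> nat" where v: "inj_on v A" using finite_imp_inj_to_nat_seg[OF fin] by blast
  define m where "m = (\<lambda>s i. l i + s * real (v i))"
  have "\<forall>\<^sub>F s in at 0. \<forall>i\<in>A. \<forall>k\<in>A. i \<noteq> k \<longrightarrow> m s i \<noteq> m s k"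
  proof (intro eventually_ball_finite fin ballI)
    fix i k assume ik: "i \<in> A" "k \<in> A"
    let ?s = "(l k - l i) / (real (v i) - real (v k))"
    have "\<forall>\<^sub>F s in at 0. s \<noteq> ?s" by (rule eventually_neq_at_within)
    then show "\<forall>\<^sub>F s in at 0. i \<noteq> k \<longrightarrow> m s i \<noteq> m s k"
    proof (rule eventually_mono)
      fix s assume s: "s \<noteq> ?s"
      show "i \<noteq> k \<longrightarrow> m s i \<noteq> m s k"
      proof
        assume "i \<noteq> k"
        then have "real (v i) - real (v k) \<noteq> 0" using v ik by (auto simp: inj_on_def)
        then show "m s i \<noteq> m s k" using s by (auto simp: m_def field_simps)
      qed
    qed
  qed
  then have ev: "\<forall>\<^sub>F s in at 0. real (q + 2) * (elem_sym A j (m s) * elem_sym A (j + 2) (m s))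
       \<le> real (q + 1) * (elem_sym A (j + 1) (m s))^2"
    by (rule eventually_mono) (rule newton_inequality_inj[OF fin _ j], auto simp: inj_on_def)
  have lim: "((\<lambda>s. elem_sym A i (m s)) \<longlongrightarrow> elem_sym A i l) (at 0)" for i
  proof -
    have "((\<lambda>s. elem_sym A i (m s)) \<longlongrightarrow> elem_sym A i (\<lambda>i. l i + 0 * real (v i))) (at 0)"
      unfolding elem_sym_def m_def by (intro tendsto_intros)
    then show ?thesis by simp
  qed
  show ?thesis
    by (rule tendsto_le[OF _ _ _ ev]) (auto intro!: tendsto_intros lim)
qed

text \<open>
  At the first negative value \<open>a (h+1)\<close> of the symmetric polynomials of the shorter vector, the recursions for orders \<open>h + 1\<close> and \<open>h + 2\<close> force
  \<open>l i > 0\<close> and \<open>a h * a (h+2) \<ge> (a (h+1))\<^sup>2 > 0\<close>, against Newton's inequality.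
\<close>

lemma elem_sym_remove_nonneg:
  assumes fin: "finite A" and i: "i \<in> A" and nn: "\<And>j. j \<le> k \<Longrightarrow> elem_sym A j l \<ge> 0"
  shows "j < k \<Longrightarrow> elem_sym (A - {i}) j l \<ge> 0"
proof (induction j rule: less_induct)
  case (less j)
  let ?a = "\<lambda>j. elem_sym (A - {i}) j l"
  have finB: "finite (A - {i})" using fin by simp
  show ?case
  proof (rule ccontr)
    assume neg: "\<not> ?a j \<ge> 0"
    then obtain h where h: "j = Suc h" using finB by (cases j) auto
    have ah: "?a h \<ge> 0" using less.IH[of h] less.prems h by simp
    have 1: "0 \<le> ?a (Suc h) + l i * ?a h"
      using nn[of "Suc h"] less.prems h elem_sym_remove[OF fin i] by simp
    have 2: "0 \<le> ?a (Suc (Suc h)) + l i * ?a (Suc h)"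
      using nn[of "Suc (Suc h)"] less.prems h elem_sym_remove[OF fin i] by simp
    have pos: "l i * ?a h > 0" using 1 neg unfolding h by linarith
    then have lpos: "l i > 0" and hpos: "?a h > 0" using ah
      by (auto simp: zero_less_mult_iff)
    have "l i * ?a (Suc h) < 0" using lpos neg h by (simp add: mult_less_0_iff)
    then have a2: "?a (Suc (Suc h)) > 0" using 2 by linarith
    have "card (A - {i}) \<ge> h + 2"
      using a2 elem_sym_eq_0[OF finB, of "Suc (Suc h)" l] by (cases "card (A - {i}) < Suc (Suc h)") auto
    then obtain q where q: "card (A - {i}) = q + h + 2"
      by (metis add.commute add.left_commute le_Suc_ex)
    have newton: "real (q + 2) * (?a h * ?a (h + 2)) \<le> real (q + 1) * (?a (h + 1))^2"
      by (rule newton_inequality[OF finB q])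
    have "(?a (h+1))^2 = (- ?a (h+1)) * (- ?a (h+1))" by (simp add: power2_eq_square)
    also have "\<dots> \<le> (l i * ?a h) * (- ?a (h+1))"
      by (rule mult_right_mono) (use 1 neg h in auto)
    also have "\<dots> = ?a h * (- (l i * ?a (h+1)))" by simp
    also have "\<dots> \<le> ?a h * ?a (h+2)"
      by (rule mult_left_mono) (use 2 hpos in auto)
    finally have le: "(?a (h+1))^2 \<le> ?a h * ?a (h+2)" .
    have "real (q + 2) * (?a (h+1))^2 \<le> real (q + 2) * (?a h * ?a (h + 2))"
      by (rule mult_left_mono[OF le]) simp
    with newton have "real (q + 2) * (?a (h+1))^2 \<le> real (q + 1) * (?a (h+1))^2" by linarith
    moreover have "(?a (h+1))^2 > 0" using neg h by simp
    ultimately show False by simp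
  qed
qed

section \<open>Eigenvalues of symmetric matrices\<close>

lemma esym_eq_elem_sym: "esym j l = elem_sym UNIV j (($) l)"
  by (simp add: esym_def elem_sym_def)

lemma poly_charpoly:
  fixes A :: "real^'n^'n"
  shows "poly (charpoly A) t = det (mat t - A)"
proof -
  have poly_det: "poly (det M) t = det (\<chi> i j. poly (M $ i $ j) t)" for M :: "real poly^'n^'n"
    by (simp add: det_def poly_sum poly_prod)
  show ?thesis unfolding charpoly_def poly_det
    by (rule arg_cong[of _ _ det]) (simp add: vec_eq_iff mat_def)
qed

text \<open>
  The choice made by \<open>eigenvalues\<close> is harmless: the product of the linear factors determines every
  elementary symmetric polynomial of the roots.
\<close>

lemma sigma_op_split:
  fixes A :: "real^'n^'n" and l :: "real^'n"
  assumes "\<And>t. det (mat t - A) = (\<Prod>i\<in>UNIV. t - l $ i)"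
  shows "sigma_op j A = esym j l"
proof -
  have "charpoly A = (\<Prod>i\<in>UNIV. [:- (l $ i), 1:])"
    using assms by (simp add: poly_eq_poly_eq_iff[symmetric] fun_eq_iff poly_charpoly poly_prod)
  then have "charpoly A = (\<Prod>i\<in>UNIV. [:- (eigenvalues A $ i), 1:])"
    unfolding eigenvalues_def
    by (rule someI[where P = "\<lambda>l. charpoly A = (\<Prod>i\<in>UNIV. [:- (l $ i), 1:])"])
  then have e: "(\<Prod>i\<in>UNIV. t - eigenvalues A $ i) = (\<Prod>i\<in>UNIV. t - l $ i)" for t
    using assms poly_charpoly[of A t] by (simp add: poly_prod)
  have "(\<Prod>i\<in>UNIV. t + m $ i) = (-1) ^ CARD('n) * (\<Prod>i\<in>UNIV. - t - m $ i)" for t and m :: "real^'n"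
  proof -
    have "(\<Prod>i\<in>UNIV. t + m $ i) = (\<Prod>i\<in>UNIV. (-1) * (- t - m $ i))"
      by (rule prod.cong) auto
    then show ?thesis by (simp only: prod.distrib prod_constant)
  qed
  then have "(\<Prod>i\<in>UNIV. [:eigenvalues A $ i, 1:]) = (\<Prod>i\<in>UNIV. [:l $ i, 1:])"
    using e by (simp add: poly_eq_poly_eq_iff[symmetric] fun_eq_iff poly_prod add.commute)
  then have "elem_sym UNIV j (($) (eigenvalues A)) = elem_sym UNIV j (($) l)"
    using coeff_prod_linear[of UNIV j "($) (eigenvalues A)"] coeff_prod_linear[of UNIV j "($) l"]
      elem_sym_eq_0[of UNIV j "($) l"] elem_sym_eq_0[of UNIV j "($) (eigenvalues A)"]
    by (cases "j \<le> CARD('n)") auto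
  then show ?thesis by (simp add: sigma_op_def esym_eq_elem_sym)
qed

definition diag :: "real^'n \<Rightarrow> real^'n^'n" where
  "diag l = (\<chi> i j. if i = j then l $ i else 0)"

lemma quadratic_nonpos_imp_zero:
  fixes a b :: real
  assumes "\<And>t. 2 * t * a + t^2 * b \<le> 0"
  shows "a = 0"
proof (rule ccontr)
  assume "a \<noteq> 0"
  define c where "c = \<bar>b\<bar> + 1"
  have c: "c > 0" "2 * c + b > 0" by (auto simp: c_def)
  have "2 * (a / c) * a + (a / c)^2 * b = (a^2 / c^2) * (2 * c + b)"
    using c by (simp add: power2_eq_square field_simps)
  moreover have "\<dots> > 0" using c \<open>a \<noteq> 0\<close> by simp
  ultimately show False using assms[of "a / c"] by simp
qed

lemma symmetric_dot:
  fixes S :: "real^'n^'n"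
  assumes "transpose S = S"
  shows "x \<bullet> (S *v y) = (S *v x) \<bullet> y"
  by (metis assms dot_lmul_matrix vector_transpose_matrix)

text \<open>
  The orthogonal complement \<open>V\<close> of a set of eigenvectors is invariant, and a maximum of the quadratic
  form on the unit sphere of \<open>V\<close> is an eigenvector: its first variation in directions of \<open>V\<close> vanishes.
\<close>

lemma symmetric_eigenvector_orthogonal_to:
  fixes S :: "real^'n^'n"
  assumes sym: "transpose S = S"
    and eig: "\<And>b. b \<in> B \<Longrightarrow> \<exists>c. S *v b = c *\<^sub>R b"
    and B: "finite B" "card B < CARD('n)"
  shows "\<exists>v c. norm v = 1 \<and> (\<forall>b\<in>B. b \<bullet> v = 0) \<and> S *v v = c *\<^sub>R v"
proof -
  define V where "V = {v. \<forall>b\<in>B. b \<bullet> v = 0}"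
  have "dim B < DIM(real^'n)"
    using dim_le_card'[OF B(1)] B(2) by simp
  then obtain x where x: "x \<noteq> 0" "\<And>y. y \<in> span B \<Longrightarrow> orthogonal x y"
    using orthogonal_to_subspace_exists by blast
  then have xV: "x \<in> V" by (auto simp: V_def orthogonal_def inner_commute span_base)
  have scaleV: "c *\<^sub>R v \<in> V" if "v \<in> V" for c v using that by (simp add: V_def)
  have addV: "v + w \<in> V" if "v \<in> V" "w \<in> V" for v w using that by (simp add: V_def inner_add_right)
  have SV: "S *v v \<in> V" if "v \<in> V" for v
  proof -
    have "b \<bullet> (S *v v) = 0" if b: "b \<in> B" for b
    proof -
      obtain c where "S *v b = c *\<^sub>R b" using eig b by blast
      then have "b \<bullet> (S *v v) = c * (b \<bullet> v)"
        using symmetric_dot[OF sym, of b v] by simp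
      then show ?thesis using \<open>v \<in> V\<close> b by (simp add: V_def)
    qed
    then show ?thesis by (simp add: V_def)
  qed
  let ?K = "V \<inter> sphere 0 1"
  let ?f = "\<lambda>v. v \<bullet> (S *v v)"
  have V_eq: "V = (\<Inter>b\<in>B. {v. b \<bullet> v = 0})" by (auto simp: V_def)
  have "closed V" unfolding V_eq by (intro closed_INT ballI closed_hyperplane)
  then have "compact ?K" by (intro closed_Int_compact) auto
  moreover have "(1 / norm x) *\<^sub>R x \<in> ?K" using scaleV[OF xV] x(1) by auto
  then have "?K \<noteq> {}" by blast
  moreover have "continuous_on ?K ?f"
    by (intro continuous_intros matrix_vector_mult_linear_continuous_on)
  ultimately obtain v where v: "v \<in> ?K" "\<And>w. w \<in> ?K \<Longrightarrow> ?f w \<le> ?f v"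
    using continuous_attains_sup[of ?K ?f] by blast
  define c where "c = ?f v"
  have vV: "v \<in> V" and nv: "norm v = 1" using v by auto
  have le: "?f w \<le> c * (norm w)^2" if "w \<in> V" for w
  proof (cases "w = 0")
    case False
    then have "(1 / norm w) *\<^sub>R w \<in> ?K" using scaleV[OF that] by auto
    from v(2)[OF this] have "?f w / (norm w)^2 \<le> c"
      by (simp add: c_def matrix_vector_mult_scaleR power2_eq_square)
    then show ?thesis using False by (simp add: field_simps)
  qed simp
  have orth: "w \<bullet> (S *v v - c *\<^sub>R v) = 0" if "w \<in> V" for w
  proof (rule quadratic_nonpos_imp_zero)
    fix t :: real
    have wv: "w \<bullet> (S *v v) = v \<bullet> (S *v w)"
      using symmetric_dot[OF sym, of w v] by (simp add: inner_commute)
    have "?f (v + t *\<^sub>R w) \<le> c * (norm (v + t *\<^sub>R w))^2"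
      by (intro le addV scaleV vV that)
    moreover have "?f (v + t *\<^sub>R w) = c + 2 * t * (w \<bullet> (S *v v)) + t^2 * ?f w"
      by (simp add: matrix_vector_right_distrib matrix_vector_mult_scaleR inner_add_left inner_add_right
          c_def wv power2_eq_square algebra_simps)
    moreover have "(norm (v + t *\<^sub>R w))^2 = 1 + 2 * t * (w \<bullet> v) + t^2 * (norm w)^2"
      using nv unfolding power2_norm_eq_inner norm_eq_1
      by (simp add: inner_add_left inner_add_right inner_commute power2_eq_square algebra_simps)
    ultimately show "2 * t * (w \<bullet> (S *v v - c *\<^sub>R v)) + t^2 * (?f w - c * (norm w)^2) \<le> 0"
      by (simp add: inner_diff_right algebra_simps)
  qed
  have "S *v v - c *\<^sub>R v = S *v v + (- c) *\<^sub>R v" by simp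
  also have "\<dots> \<in> V" by (intro addV scaleV SV vV)
  finally have "S *v v - c *\<^sub>R v = 0" using orth by (metis inner_eq_zero_iff)
  then have "S *v v = c *\<^sub>R v" by simp
  then show ?thesis using vV nv by (auto simp: V_def)
qed

lemma symmetric_orthonormal_eigenvectors:
  fixes S :: "real^'n^'n"
  assumes sym: "transpose S = S"
  shows "m \<le> CARD('n) \<Longrightarrow> \<exists>B. finite B \<and> card B = m \<and> (\<forall>b\<in>B. norm b = 1 \<and> (\<exists>c. S *v b = c *\<^sub>R b))
     \<and> (\<forall>a\<in>B. \<forall>b\<in>B. a \<noteq> b \<longrightarrow> a \<bullet> b = 0)"
proof (induction m)
  case 0
  show ?case by (rule exI[of _ "{}"]) auto
next
  case (Suc m)
  then obtain B where B: "finite B" "card B = m" "\<And>b. b \<in> B \<Longrightarrow> norm b = 1 \<and> (\<exists>c. S *v b = c *\<^sub>R b)"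
     "\<And>a b. a \<in> B \<Longrightarrow> b \<in> B \<Longrightarrow> a \<noteq> b \<Longrightarrow> a \<bullet> b = 0"
    by (metis Suc_leD)
  obtain v c where v: "norm v = 1" "\<forall>b\<in>B. b \<bullet> v = 0" "S *v v = c *\<^sub>R v"
    using symmetric_eigenvector_orthogonal_to[OF sym, of B] B Suc.prems by auto
  have "v \<notin> B" using v by (metis inner_eq_zero_iff norm_zero zero_neq_one)
  then show ?case
    using B v by (intro exI[of _ "insert v B"]) (auto simp: inner_commute)
qed

text \<open>
  The spectral theorem, obtained by collecting unit eigenvectors orthogonal to the previous ones.
\<close>

theorem symmetric_diagonalization:
  fixes S :: "real^'n^'n"
  assumes sym: "transpose S = S"
  obtains P l where "orthogonal_matrix P" "S = P ** diag l ** transpose P"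
proof -
  obtain B where B: "finite B" "card B = CARD('n)"
     and eig: "\<And>b. b \<in> B \<Longrightarrow> norm b = 1 \<and> (\<exists>c. S *v b = c *\<^sub>R b)"
     and orth: "\<And>a b. a \<in> B \<Longrightarrow> b \<in> B \<Longrightarrow> a \<noteq> b \<Longrightarrow> a \<bullet> b = 0"
    using symmetric_orthonormal_eigenvectors[OF sym order_refl] by blast
  obtain f where f: "bij_betw f (UNIV::'n set) B"
    using finite_same_card_bij[of "UNIV::'n set" B] B by auto
  then have fB: "f i \<in> B" and finj: "f i = f j \<longleftrightarrow> i = j" for i j
    by (auto simp: bij_betw_def inj_on_def)
  obtain c where c: "\<And>b. b \<in> B \<Longrightarrow> S *v b = c b *\<^sub>R b" using eig by metis
  define P :: "real^'n^'n" where "P = (\<chi> i j. f j $ i)"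
  define l :: "real^'n" where "l = (\<chi> i. c (f i))"
  have "(transpose P ** P) $ i $ j = (mat 1 :: real^'n^'n) $ i $ j" for i j
  proof -
    have "(transpose P ** P) $ i $ j = f i \<bullet> f j"
      by (simp add: matrix_matrix_mult_def transpose_def P_def inner_vec_def)
    also have "\<dots> = (if i = j then 1 else 0)"
      using eig[OF fB, of i] orth[OF fB fB, of i j] finj by (auto simp: norm_eq_1)
    finally show ?thesis by (simp add: mat_def)
  qed
  then have o: "orthogonal_matrix P" by (simp add: orthogonal_matrix vec_eq_iff)
  then have PP: "P ** transpose P = mat 1" by (simp add: orthogonal_matrix_def)
  have "(S ** P) $ i $ j = (P ** diag l) $ i $ j" for i j
  proof -
    have "(S ** P) $ i $ j = (S *v f j) $ i"
      by (simp add: matrix_matrix_mult_def matrix_vector_mult_def P_def)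
    also have "\<dots> = l $ j * f j $ i" using c[OF fB] by (simp add: l_def)
    also have "\<dots> = (P ** diag l) $ i $ j"
      by (simp add: matrix_matrix_mult_def diag_def P_def if_distrib cong: if_cong)
    finally show ?thesis .
  qed
  then have "S ** P = P ** diag l" by (simp add: vec_eq_iff)
  then have "S ** (P ** transpose P) = P ** diag l ** transpose P" by (simp add: matrix_mul_assoc)
  then show ?thesis using that o PP by simp
qed

section \<open>Elementary symmetric functions of a symmetric matrix\<close>

lemma matrix_mult_scaleR:
  fixes A B :: "real^'n^'n"
  shows "(c *\<^sub>R A) ** B = c *\<^sub>R (A ** B)" "A ** (c *\<^sub>R B) = c *\<^sub>R (A ** B)"
  by (simp_all add: vec_eq_iff matrix_matrix_mult_def sum_distrib_left algebra_simps)

lemma matrix_mult_add_left: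
  fixes A B :: "real^'n^'n"
  shows "(A + B) ** C = A ** C + B ** C"
  by (simp add: vec_eq_iff matrix_matrix_mult_def sum.distrib algebra_simps)

lemma transpose_conj:
  fixes P :: "real^'n^'n"
  shows "transpose (P ** D ** transpose P) = P ** transpose D ** transpose P"
  by (simp add: matrix_transpose_mul matrix_mul_assoc)

lemma transpose_diag [simp]: "transpose (diag l) = diag l"
  by (auto simp: vec_eq_iff transpose_def diag_def)

lemma mat_add_conj:
  fixes P :: "real^'n^'n"
  assumes "orthogonal_matrix P"
  shows "mat t + P ** D ** transpose P = P ** (mat t + D) ** transpose P"
proof -
  have "P ** mat t = t *\<^sub>R P"
    by (simp add: vec_eq_iff matrix_matrix_mult_def mat_def if_distrib cong: if_cong)
  moreover have "t *\<^sub>R mat 1 = (mat t :: real^'n^'n)" by (simp add: vec_eq_iff mat_def)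
  ultimately have "P ** mat t ** transpose P = mat t"
    using assms by (simp add: matrix_mult_scaleR orthogonal_matrix_def)
  then show ?thesis by (simp add: matrix_add_ldistrib matrix_mult_add_left)
qed

lemma det_conj_orthogonal:
  fixes P :: "real^'n^'n"
  assumes "orthogonal_matrix P"
  shows "det (P ** D ** transpose P) = det D"
proof -
  have "det P * det (transpose P) = 1"
    using assms by (metis det_I det_mul orthogonal_matrix_def)
  then show ?thesis by (simp add: det_mul)
qed

lemma det_diag: "det (mat t + diag l) = (\<Prod>i\<in>UNIV. t + l $ i)"
  by (subst det_diagonal) (auto simp: mat_def diag_def)

lemma sigma_op_diagonalized:
  fixes P :: "real^'n^'n"
  assumes "orthogonal_matrix P" "S = P ** diag l ** transpose P"
  shows "sigma_op j S = elem_sym UNIV j (($) l)"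
proof -
  have "det (mat t - S) = (\<Prod>i\<in>UNIV. t - l $ i)" for t
  proof -
    have "diag (- l) = - diag l" by (simp add: vec_eq_iff diag_def)
    then have "mat t - S = mat t + P ** diag (- l) ** transpose P"
      unfolding assms(2) by (simp add: vec_eq_iff matrix_matrix_mult_def sum_negf)
    then show ?thesis
      using det_diag[of t "- l"] by (simp add: mat_add_conj[OF assms(1)] det_conj_orthogonal[OF assms(1)])
  qed
  then show ?thesis by (simp add: sigma_op_split esym_eq_elem_sym)
qed

text \<open>
  This generating function identifies the curvature functions of any symmetric matrix from a determinant,
  without diagonalizing that matrix.
\<close>

lemma sigma_op_generating:
  fixes S :: "real^'n^'n"
  assumes "transpose S = S"
  shows "det (mat t + S) = (\<Sum>j\<le>CARD('n). sigma_op j S * t ^ (CARD('n) - j))"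
proof -
  obtain P l where Pl: "orthogonal_matrix P" "S = P ** diag l ** transpose P"
    using symmetric_diagonalization[OF assms] .
  have "det (mat t + S) = (\<Prod>i\<in>UNIV. t + l $ i)"
    unfolding Pl(2) mat_add_conj[OF Pl(1)] det_conj_orthogonal[OF Pl(1)] by (rule det_diag)
  then show ?thesis
    by (simp add: prod_eq_sum_elem_sym sigma_op_diagonalized[OF Pl])
qed

lemma reversed_polyfun_eq_coeffs:
  fixes a b :: "nat \<Rightarrow> real"
  assumes "\<And>t. (\<Sum>j\<le>n. a j * t ^ (n - j)) = (\<Sum>j\<le>n. b j * t ^ (n - j))" and "j \<le> n"
  shows "a j = b j"
proof -
  have "(\<Sum>j\<le>n. c j * t ^ (n - j)) = (\<Sum>i\<le>n. c (n - i) * t ^ i)" for c :: "nat \<Rightarrow> real" and t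
    by (rule sum.reindex_bij_witness[of _ "\<lambda>i. n - i" "\<lambda>i. n - i"]) auto
  then have "\<forall>i\<le>n. a (n - i) = b (n - i)"
    using assms(1) polyfun_eq_coeffs[of "\<lambda>i. a (n - i)" n "\<lambda>i. b (n - i)"] by simp
  then show ?thesis using assms(2) by (metis diff_diff_cancel diff_le_self)
qed

lemma sigma_op_0 [simp]: "transpose S = S \<Longrightarrow> sigma_op 0 S = 1"
  by (metis sigma_op_diagonalized symmetric_diagonalization elem_sym_0 finite_class.finite_UNIV)

lemma sigma_op_scaleR:
  fixes S :: "real^'n^'n"
  assumes "transpose S = S"
  shows "sigma_op j (c *\<^sub>R S) = c ^ j * sigma_op j S"
proof -
  obtain P l where Pl: "orthogonal_matrix P" "S = P ** diag l ** transpose P"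
    using symmetric_diagonalization[OF assms] .
  have "diag (c *\<^sub>R l) = c *\<^sub>R diag l" by (simp add: vec_eq_iff diag_def)
  then have "c *\<^sub>R S = P ** diag (c *\<^sub>R l) ** transpose P"
    unfolding Pl(2) by (simp add: matrix_mult_scaleR)
  note sigma_op_diagonalized[OF Pl(1) this, of j]
  also have "elem_sym UNIV j (($) (c *\<^sub>R l)) = c ^ j * elem_sym UNIV j (($) l)"
    unfolding elem_sym_def sum_distrib_left
    by (rule sum.cong) (auto simp: prod.distrib)
  finally show ?thesis by (simp add: sigma_op_diagonalized[OF Pl])
qed

text \<open>
  Compare the coefficients of \<open>t\<close> in \<open>det ((t + s) + S)\<close>, expanding each \<open>(t + s)\<^sup>n\<^sup>-\<^sup>i\<close> by the binomial theorem.
\<close>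

lemma sigma_op_shift:
  fixes S :: "real^'n^'n"
  assumes "transpose S = S" and j: "j \<le> CARD('n)"
  shows "sigma_op j (S + mat s)
     = (\<Sum>i\<le>j. sigma_op i S * (real ((CARD('n) - i) choose (j - i)) * s ^ (j - i)))"
proof -
  let ?n = "CARD('n)"
  let ?c = "\<lambda>i r. sigma_op i S * (real ((?n - i) choose r) * s ^ r)"
  have sym: "transpose (S + mat s) = S + mat s"
    using assms(1) by (simp add: vec_eq_iff transpose_def mat_def)
  have "(\<Sum>j\<le>?n. sigma_op j (S + mat s) * t ^ (?n - j))
      = (\<Sum>j\<le>?n. (\<Sum>i\<le>j. ?c i (j - i)) * t ^ (?n - j))" for t
  proof -
    have "(\<Sum>j\<le>?n. sigma_op j (S + mat s) * t ^ (?n - j)) = det (mat t + (S + mat s))"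
      using sigma_op_generating[OF sym] by simp
    also have "mat t + (S + mat s) = mat (t + s) + S"
      by (simp add: vec_eq_iff mat_def)
    also have "det \<dots> = (\<Sum>i\<le>?n. sigma_op i S * (s + t) ^ (?n - i))"
      using sigma_op_generating[OF assms(1), of "t + s"] by (simp add: add.commute)
    also have "\<dots> = (\<Sum>i\<le>?n. \<Sum>r\<le>?n - i. ?c i r * t ^ (?n - (i + r)))"
      by (rule sum.cong) (auto simp: binomial_ring sum_distrib_left algebra_simps intro!: sum.cong)
    also have "\<dots> = (\<Sum>(i, r)\<in>(SIGMA i:{..?n}. {..?n - i}). ?c i r * t ^ (?n - (i + r)))"
      by (rule sum.Sigma) auto
    also have "(SIGMA i:{..?n}. {..?n - i}) = {(i, r). i + r \<le> ?n}" by auto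
    also have "(\<Sum>(i, r)\<in>{(i, r). i + r \<le> ?n}. ?c i r * t ^ (?n - (i + r)))
        = (\<Sum>j\<le>?n. \<Sum>i\<le>j. ?c i (j - i) * t ^ (?n - (i + (j - i))))"
      by (rule sum.triangle_reindex_eq)
    also have "\<dots> = (\<Sum>j\<le>?n. (\<Sum>i\<le>j. ?c i (j - i)) * t ^ (?n - j))"
      by (auto simp: sum_distrib_right intro!: sum.cong)
    finally show ?thesis .
  qed
  from reversed_polyfun_eq_coeffs[OF this j] show ?thesis .
qed

definition outer :: "real^'n \<Rightarrow> real^'n^'n" where
  "outer v = (\<chi> i j. v $ i * v $ j)"

lemma outer_mult_vec: "outer v *v z = (v \<bullet> z) *\<^sub>R v"
  by (simp add: outer_def matrix_vector_mult_def vec_eq_iff inner_vec_def sum_distrib_right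
      sum_distrib_left algebra_simps)

lemma outer_conj:
  fixes P :: "real^'n^'n"
  assumes "orthogonal_matrix P"
  shows "outer v = P ** outer (transpose P *v v) ** transpose P"
proof -
  have "P *v (transpose P *v v) = v"
    unfolding matrix_vector_mul_assoc using assms by (simp only: orthogonal_matrix_def matrix_vector_mul_lid)
  moreover have "P ** outer w ** transpose P = outer (P *v w)" for w
    by (simp add: vec_eq_iff outer_def matrix_matrix_mult_def matrix_vector_mult_def transpose_def
        sum_distrib_left sum_distrib_right algebra_simps)
  ultimately show ?thesis by simp
qed

text \<open>
  Expand the row \<open>w\<close> along the coordinate vectors; all but the \<open>k\<close>-th give two parallel rows.
\<close>

lemma det_diag_row_replaced:
  fixes l w :: "real^'n"
  shows "det (\<chi> i. if i = k then w else l $ i *\<^sub>R axis i 1) = w $ k * (\<Prod>i\<in>UNIV - {k}. l $ i)"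
proof -
  let ?M = "\<lambda>x. (\<chi> i. if i = k then x else l $ i *\<^sub>R axis i 1) :: real^'n^'n"
  have ax: "det (?M (axis m 1)) = (if m = k then \<Prod>i\<in>UNIV - {k}. l $ i else 0)" for m
  proof (cases "m = k")
    case True
    have "det (?M (axis m 1)) = (\<Prod>i\<in>UNIV. ?M (axis m 1) $ i $ i)"
      by (rule det_diagonal) (auto simp: True axis_def)
    also have "\<dots> = (\<Prod>i\<in>UNIV - {k}. l $ i)"
      by (subst prod.remove[of UNIV k]) (auto simp: True intro!: prod.cong)
    finally show ?thesis using True by simp
  next
    case False
    have "det (?M (axis m 1)) = det (\<chi> i. if i = m then l $ m *s axis m 1 else ?M (axis m 1) $ i)"
      by (rule arg_cong[of _ _ det]) (use False in \<open>auto simp: vec_eq_iff\<close>)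
    also have "\<dots> = l $ m * det (\<chi> i. if i = m then axis m 1 else ?M (axis m 1) $ i)"
      by (rule det_row_mul)
    also have "det (\<chi> i. if i = m then axis m 1 else ?M (axis m 1) $ i) = 0"
      by (rule det_identical_rows[of m k]) (use False in \<open>auto simp: row_def\<close>)
    finally show ?thesis using False by simp
  qed
  have "w = (\<Sum>m\<in>UNIV. w $ m *s axis m 1)"
    by (simp add: basis_expansion)
  then have "det (?M w) = det (?M (\<Sum>m\<in>UNIV. w $ m *s axis m 1))"
    by (rule arg_cong[where f = "\<lambda>x. det (?M x)"])
  also have "\<dots> = (\<Sum>m\<in>UNIV. det (?M (w $ m *s axis m 1)))"
    by (rule det_linear_row_sum) simp
  also have "\<dots> = (\<Sum>m\<in>UNIV. w $ m * det (?M (axis m 1)))"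
    by (simp only: det_row_mul)
  also have "\<dots> = w $ k * (\<Prod>i\<in>UNIV - {k}. l $ i)"
    by (simp add: ax if_distrib cong: if_cong)
  finally show ?thesis .
qed

lemma det_row_replaced_reduce:
  fixes l w :: "real^'n" and d :: real
  assumes "finite F" "k \<notin> F"
  shows "det (\<chi> i. if i = k then w else l $ i *\<^sub>R axis i 1 + (if i \<in> F then (d * w $ i) *\<^sub>R w else 0))
       = det (\<chi> i. if i = k then w else l $ i *\<^sub>R axis i 1)"
  using assms
proof (induction F)
  case empty
  then show ?case by (simp cong: if_cong)
next
  case (insert m F)
  let ?A = "(\<chi> i. if i = k then w else l $ i *\<^sub>R axis i 1 + (if i \<in> F then (d * w $ i) *\<^sub>R w else 0)) :: real^'n^'n"
  have mk: "m \<noteq> k" "m \<notin> F" using insert by auto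
  have "det (\<chi> r. if r = m then row m ?A + (d * w $ m) *s row k ?A else row r ?A) = det ?A"
    by (rule det_row_operation[OF mk(1)])
  moreover have "(\<chi> r. if r = m then row m ?A + (d * w $ m) *s row k ?A else row r ?A)
     = (\<chi> i. if i = k then w else l $ i *\<^sub>R axis i 1 + (if i \<in> insert m F then (d * w $ i) *\<^sub>R w else 0))"
    using mk by (auto simp: vec_eq_iff row_def)
  ultimately show ?case using insert by simp
qed

text \<open>
  The determinant is expanded one row at a time. A row is the sum of its diagonal part and a multiple of
  \<open>w\<close>; once one row is \<open>w\<close>, the multiples of \<open>w\<close> in all other rows can be cleared by row operations, so
  only terms of first order in \<open>d\<close> survive.
\<close>

lemma det_diag_plus_outer:
  fixes l w :: "real^'n"
  shows "det (diag l + d *\<^sub>R outer w)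
    = (\<Prod>i\<in>UNIV. l $ i) + d * (\<Sum>k\<in>UNIV. (w $ k)\<^sup>2 * (\<Prod>i\<in>UNIV - {k}. l $ i))"
proof -
  let ?B = "\<lambda>F i. l $ i *\<^sub>R axis i 1 + (if i \<in> F then (d * w $ i) *\<^sub>R w else 0)"
  have "det ((\<chi> i. ?B F i) :: real^'n^'n)
     = (\<Prod>i\<in>UNIV. l $ i) + d * (\<Sum>k\<in>F. (w $ k)\<^sup>2 * (\<Prod>i\<in>UNIV - {k}. l $ i))" if "finite F" for F
    using that
  proof (induction F)
    case empty
    have "det ((\<chi> i. ?B {} i) :: real^'n^'n) = (\<Prod>i\<in>UNIV. ((\<chi> i. ?B {} i) :: real^'n^'n) $ i $ i)"
      by (rule det_diagonal) (auto simp: axis_def)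
    then show ?case by simp
  next
    case (insert k F)
    let ?R = "\<lambda>x. (\<chi> i. if i = k then x else ?B F i) :: real^'n^'n"
    have 1: "((\<chi> i. ?B (insert k F) i) :: real^'n^'n) = ?R (l $ k *\<^sub>R axis k 1 + (d * w $ k) *s w)"
      using insert by (auto simp: vec_eq_iff)
    have 2: "?R (l $ k *\<^sub>R axis k 1) = (\<chi> i. ?B F i)"
      using insert by (auto simp: vec_eq_iff)
    have 3: "det (?R (l $ k *\<^sub>R axis k 1 + (d * w $ k) *s w))
        = det (?R (l $ k *\<^sub>R axis k 1)) + det (?R ((d * w $ k) *s w))"
      by (rule det_row_add)
    have 4: "det (?R ((d * w $ k) *s w)) = (d * w $ k) * det (?R w)"
      by (rule det_row_mul)
    have 5: "det (?R w) = w $ k * (\<Prod>i\<in>UNIV - {k}. l $ i)"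
      using det_row_replaced_reduce[of F k w l d] insert det_diag_row_replaced[of k w l] by simp
    show ?case unfolding 1 3 2 4 5 insert.IH
      using insert by (simp add: power2_eq_square algebra_simps)
  qed
  moreover have "diag l + d *\<^sub>R outer w = (\<chi> i. ?B UNIV i)"
    by (auto simp: diag_def outer_def vec_eq_iff axis_def)
  ultimately show ?thesis by (simp only: finite_class.finite_UNIV)
qed

text \<open>
  Curvature functions are affine along rank-one changes, with slope the average of the
  reduced symmetric polynomials weighted by the squared coordinates of \<open>v\<close> in an eigenbasis.
\<close>

lemma sigma_op_rank_one:
  fixes S :: "real^'n^'n"
  assumes P: "orthogonal_matrix P" and S: "S = P ** diag l ** transpose P"
    and j: "Suc j \<le> CARD('n)" and w: "w = transpose P *v v"
  shows "sigma_op (Suc j) (S + d *\<^sub>R outer v)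
    = sigma_op (Suc j) S + d * (\<Sum>i\<in>UNIV. (w $ i)\<^sup>2 * elem_sym (UNIV - {i}) j (($) l))"
proof -
  let ?n = "CARD('n)"
  let ?M = "S + d *\<^sub>R outer v"
  let ?E = "\<lambda>j. \<Sum>i\<in>UNIV. (w $ i)\<^sup>2 * elem_sym (UNIV - {i}) j (($) l)"
  have n0: "?n = Suc (?n - 1)" using j by simp
  have symS: "transpose S = S"
    unfolding S transpose_conj by simp
  have symM: "transpose ?M = ?M"
    using symS by (simp add: vec_eq_iff transpose_def outer_def algebra_simps)
  have o: "outer v = P ** outer w ** transpose P" unfolding w by (rule outer_conj[OF P])
  have M: "?M = P ** (diag l + d *\<^sub>R outer w) ** transpose P"
    unfolding o S by (simp only: matrix_add_ldistrib matrix_mult_add_left matrix_mult_scaleR)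
  have "(\<Sum>j\<le>?n. sigma_op j ?M * t ^ (?n - j))
     = (\<Sum>j\<le>?n. (sigma_op j S + d * (if j = 0 then 0 else ?E (j - 1))) * t ^ (?n - j))" for t
  proof -
    have "(\<Sum>j\<le>?n. sigma_op j ?M * t ^ (?n - j)) = det (mat t + ?M)"
      using sigma_op_generating[OF symM] by simp
    also have "\<dots> = det (mat t + (diag l + d *\<^sub>R outer w))"
      unfolding M mat_add_conj[OF P] det_conj_orthogonal[OF P] ..
    also have "mat t + (diag l + d *\<^sub>R outer w) = diag (\<chi> i. t + l $ i) + d *\<^sub>R outer w"
      by (simp add: vec_eq_iff mat_def diag_def)
    also have "det \<dots> = (\<Prod>i\<in>UNIV. t + l $ i) + d * (\<Sum>k\<in>UNIV. (w $ k)\<^sup>2 * (\<Prod>i\<in>UNIV - {k}. t + l $ i))"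
      by (simp add: det_diag_plus_outer)
    also have "(\<Prod>i\<in>UNIV. t + l $ i) = (\<Sum>j\<le>?n. sigma_op j S * t ^ (?n - j))"
      by (simp add: prod_eq_sum_elem_sym sigma_op_diagonalized[OF P S])
    also have "(\<Sum>k\<in>UNIV. (w $ k)\<^sup>2 * (\<Prod>i\<in>UNIV - {k}. t + l $ i)) = (\<Sum>j\<le>?n - 1. ?E j * t ^ (?n - 1 - j))"
    proof -
      have "(\<Prod>i\<in>UNIV - {k}. t + l $ i)
          = (\<Sum>j\<le>?n - 1. elem_sym (UNIV - {k}) j (($) l) * t ^ (?n - 1 - j))" for k
        using prod_eq_sum_elem_sym[of "UNIV - {k}" t "($) l"] by (simp add: card_Diff_singleton)
      then show ?thesis
        by (simp add: sum_distrib_left sum_distrib_right algebra_simps) (rule sum.swap)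
    qed
    also have "(\<Sum>j\<le>?n - 1. ?E j * t ^ (?n - 1 - j))
        = (\<Sum>j\<le>?n. (if j = 0 then 0 else ?E (j - 1)) * t ^ (?n - j))"
      by (subst (3) n0, subst sum.atMost_Suc_shift) simp
    finally show ?thesis by (simp add: sum_distrib_left sum.distrib algebra_simps)
  qed
  from reversed_polyfun_eq_coeffs[OF this j] show ?thesis by simp
qed

section \<open>Monotonicity on the closed Garding cone\<close>

text \<open>
  The closed Garding cone on the level of matrices. It is given by the inequalities themselves rather than as a
  closure, so that membership can be checked order by order.
\<close>

definition in_cone :: "nat \<Rightarrow> real^'n^'n \<Rightarrow> bool" where
  "in_cone k S \<longleftrightarrow> transpose S = S \<and> (\<forall>j\<le>k. 0 \<le> sigma_op j S)"

lemma quadratic_form_diagonalized: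
  fixes P :: "real^'n^'n"
  assumes "S = P ** diag l ** transpose P" "w = transpose P *v v"
  shows "v \<bullet> (S *v v) = (\<Sum>i\<in>UNIV. (w $ i)\<^sup>2 * l $ i)"
proof -
  have "v \<bullet> (S *v v) = v \<bullet> (P *v (diag l *v w))"
    unfolding assms by (simp only: matrix_vector_mul_assoc matrix_mul_assoc)
  also have "\<dots> = w \<bullet> (diag l *v w)"
    unfolding assms(2) by (metis dot_lmul_matrix vector_transpose_matrix transpose_matrix_vector)
  also have "\<dots> = (\<Sum>i\<in>UNIV. (w $ i)\<^sup>2 * l $ i)"
    by (simp add: inner_vec_def matrix_vector_mult_def diag_def if_distrib if_distribR power2_eq_square
        algebra_simps cong: if_cong)
  finally show ?thesis .
qed

lemma norm_transpose_orthogonal: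
  fixes P :: "real^'n^'n"
  assumes "orthogonal_matrix P"
  shows "norm (transpose P *v v) = norm v"
proof -
  have "(norm (transpose P *v v))^2 = v \<bullet> (P *v (transpose P *v v))"
    unfolding power2_norm_eq_inner
    by (metis dot_lmul_matrix vector_transpose_matrix transpose_matrix_vector)
  also have "P *v (transpose P *v v) = v"
    unfolding matrix_vector_mul_assoc using assms
    by (simp only: orthogonal_matrix_def matrix_vector_mul_lid)
  finally show ?thesis by (simp add: power2_norm_eq_inner[symmetric])
qed

lemma sum_squares_eq_norm: "(\<Sum>i\<in>UNIV. ((w::real^'n) $ i)\<^sup>2) = (norm w)^2"
  unfolding power2_norm_eq_inner by (simp add: inner_vec_def power2_eq_square)

lemma eigenvalue_eq_quadratic_form:
  fixes P :: "real^'n^'n"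
  assumes "orthogonal_matrix P" "S = P ** diag l ** transpose P"
  shows "norm (column i P) = 1" "column i P \<bullet> (S *v column i P) = l $ i"
proof -
  have "transpose P *v column i P = transpose P *v (P *v axis i 1)"
    by (simp add: matrix_vector_mul_component column_def matrix_vector_mult_def axis_def vec_eq_iff
        if_distrib cong: if_cong)
  also have "\<dots> = axis i 1"
    unfolding matrix_vector_mul_assoc using assms(1)
    by (simp only: orthogonal_matrix_def matrix_vector_mul_lid)
  finally have w: "axis i 1 = transpose P *v column i P" by simp
  show "norm (column i P) = 1"
    using norm_transpose_orthogonal[OF assms(1), of "column i P"] unfolding w[symmetric] by simp
  show "column i P \<bullet> (S *v column i P) = l $ i"
    unfolding quadratic_form_diagonalized[OF assms(2) w]
    by (simp add: axis_def if_distrib if_distribR cong: if_cong)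
qed

text \<open>
  The slopes along a rank-one change are averages of reduced symmetric polynomials, which are nonnegative
  by \<open>elem_sym_remove_nonneg\<close>.
\<close>

lemma in_cone_rank_one:
  fixes S :: "real^'n^'n"
  assumes S: "in_cone k S" and k: "k \<le> CARD('n)" and d: "d \<ge> 0"
  shows "in_cone k (S + d *\<^sub>R outer v)"
    and "j \<le> k \<Longrightarrow> sigma_op j S \<le> sigma_op j (S + d *\<^sub>R outer v)"
proof -
  have sym: "transpose S = S" using S by (simp add: in_cone_def)
  obtain P l where Pl: "orthogonal_matrix P" "S = P ** diag l ** transpose P"
    using symmetric_diagonalization[OF sym] .
  have symM: "transpose (S + d *\<^sub>R outer v) = S + d *\<^sub>R outer v"
    using sym by (simp add: vec_eq_iff transpose_def outer_def algebra_simps)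
  have le: "sigma_op j S \<le> sigma_op j (S + d *\<^sub>R outer v)" if "j \<le> k" for j
  proof (cases j)
    case 0
    then show ?thesis using sym symM by simp
  next
    case (Suc h)
    have "0 \<le> elem_sym (UNIV - {i}) h (($) l)" for i
      using S Suc that by (intro elem_sym_remove_nonneg[of UNIV i k])
        (auto simp: in_cone_def sigma_op_diagonalized[OF Pl])
    then have "0 \<le> d * (\<Sum>i\<in>UNIV. ((transpose P *v v) $ i)\<^sup>2 * elem_sym (UNIV - {i}) h (($) l))"
      using d by (intro mult_nonneg_nonneg sum_nonneg) auto
    then show ?thesis
      using sigma_op_rank_one[OF Pl _ refl, where j = h and v = v and d = d] Suc that k by simp
  qed
  then show "j \<le> k \<Longrightarrow> sigma_op j S \<le> sigma_op j (S + d *\<^sub>R outer v)" by blast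
  show "in_cone k (S + d *\<^sub>R outer v)"
    using symM S le by (auto simp: in_cone_def intro: order_trans)
qed

text \<open>
  A positive semidefinite difference is a sum of nonnegative rank-one matrices, which are added in turn.
\<close>

theorem in_cone_mono:
  fixes S T :: "real^'n^'n"
  assumes S: "in_cone k S" and k: "k \<le> CARD('n)" and T: "transpose T = T"
    and le: "\<And>z. z \<bullet> (S *v z) \<le> z \<bullet> (T *v z)"
  shows "in_cone k T" and "j \<le> k \<Longrightarrow> sigma_op j S \<le> sigma_op j T"
proof -
  have symS: "transpose S = S" using S by (simp add: in_cone_def)
  have "transpose (T - S) = T - S" using T symS by (simp add: vec_eq_iff transpose_def)
  from symmetric_diagonalization[OF this]
  obtain P m where Pm: "orthogonal_matrix P" "T - S = P ** diag m ** transpose P" .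
  have m: "0 \<le> m $ i" for i
    using eigenvalue_eq_quadratic_form(2)[OF Pm, of i] le[of "column i P"]
    by (simp add: matrix_vector_mult_diff_rdistrib inner_diff_right)
  have step: "in_cone k (S + (\<Sum>i\<in>F. m $ i *\<^sub>R outer (column i P)))
      \<and> (\<forall>j\<le>k. sigma_op j S \<le> sigma_op j (S + (\<Sum>i\<in>F. m $ i *\<^sub>R outer (column i P))))"
    if "finite F" for F
    using that
  proof (induction F)
    case empty
    then show ?case using S by simp
  next
    case (insert i F)
    let ?M = "S + (\<Sum>i\<in>F. m $ i *\<^sub>R outer (column i P))"
    have e: "S + (\<Sum>i\<in>insert i F. m $ i *\<^sub>R outer (column i P)) = ?M + m $ i *\<^sub>R outer (column i P)"
      using insert by (simp add: add.commute add.left_commute)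
    have M: "in_cone k ?M" using insert.IH by blast
    show ?case unfolding e
      using in_cone_rank_one[OF M k m[of i], where v = "column i P"] insert.IH by (meson order_trans)
  qed
  have "T = S + (\<Sum>i\<in>UNIV. m $ i *\<^sub>R outer (column i P))"
  proof -
    have "P ** diag m ** transpose P = (\<Sum>i\<in>UNIV. m $ i *\<^sub>R outer (column i P))"
      by (simp add: vec_eq_iff matrix_matrix_mult_def diag_def transpose_def outer_def column_def
          if_distrib sum_distrib_right mult.commute mult.left_commute cong: if_cong)
    then show ?thesis using Pm(2) by (metis add.commute diff_add_cancel)
  qed
  then show "in_cone k T" and "j \<le> k \<Longrightarrow> sigma_op j S \<le> sigma_op j T"
    using step[of UNIV] by auto
qed

lemma sigma_op_1_eq_trace:
  fixes S :: "real^'n^'n"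
  assumes "transpose S = S"
  shows "sigma_op (Suc 0) S = (\<Sum>i\<in>UNIV. axis i 1 \<bullet> (S *v axis i 1))"
proof -
  obtain P l where Pl: "orthogonal_matrix P" "S = P ** diag l ** transpose P"
    using symmetric_diagonalization[OF assms] .
  have "(\<Sum>i\<in>UNIV. axis i 1 \<bullet> (S *v axis i 1)) = trace S"
    by (simp add: trace_def inner_axis' matrix_vector_mult_basis column_def)
  also have "\<dots> = trace (transpose P ** (P ** diag l))"
    unfolding Pl(2) by (rule trace_mul_sym)
  also have "transpose P ** (P ** diag l) = diag l"
    using Pl(1) by (simp add: matrix_mul_assoc orthogonal_matrix_def)
  also have "trace (diag l) = (\<Sum>i\<in>UNIV. l $ i)" by (simp add: trace_def diag_def)
  finally show ?thesis by (simp add: sigma_op_diagonalized[OF Pl] elem_sym_1)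
qed

text \<open>
  Eigenvalues at most \<open>b\<close> with nonnegative sum are at least \<open>- n b\<close>, so a crude count of the terms suffices.
\<close>

lemma sigma_op_le_of_quadratic_form_le:
  fixes S :: "real^'n^'n"
  assumes sym: "transpose S = S" and tr: "sigma_op (Suc 0) S \<ge> 0" and b: "b \<ge> 0"
    and le: "\<And>z. z \<bullet> (S *v z) \<le> b * (norm z)^2"
  shows "sigma_op k S \<le> real (CARD('n) choose k) * (real CARD('n) * b) ^ k"
proof -
  obtain P l where Pl: "orthogonal_matrix P" "S = P ** diag l ** transpose P"
    using symmetric_diagonalization[OF sym] .
  have lb: "l $ i \<le> b" for i
    using le[of "column i P"] eigenvalue_eq_quadratic_form[OF Pl, of i] by simp
  have "0 \<le> (\<Sum>i\<in>UNIV. l $ i)"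
    using tr by (simp add: sigma_op_diagonalized[OF Pl] elem_sym_1)
  have "\<bar>l $ i\<bar> \<le> real CARD('n) * b" for i
  proof -
    have "0 \<le> l $ i + (\<Sum>m\<in>UNIV - {i}. l $ m)"
      using \<open>0 \<le> (\<Sum>i\<in>UNIV. l $ i)\<close> by (simp add: sum.remove[of UNIV i])
    moreover have "(\<Sum>m\<in>UNIV - {i}. l $ m) \<le> (\<Sum>m\<in>UNIV - {i}. b)"
      by (rule sum_mono) (rule lb)
    moreover have "(\<Sum>m\<in>UNIV - {i}. b) \<le> real CARD('n) * b"
      using b by (auto intro!: mult_right_mono)
    moreover have "b \<le> real CARD('n) * b"
      using b zero_less_card_finite[where 'a = 'n] by (simp add: mult_le_cancel_right1)
    ultimately show ?thesis using lb[of i] by linarith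
  qed
  then show ?thesis
    unfolding sigma_op_diagonalized[OF Pl] by (intro elem_sym_le_pow) auto
qed

text \<open>
  Chebyshev's sum inequality for oppositely ordered sequences with probability weights \<open>p\<close>.
\<close>

lemma chebyshev_sum_nonpos:
  fixes p a b :: "'a \<Rightarrow> real"
  assumes "finite A" "(\<Sum>i\<in>A. p i) = 1" "\<And>i. i \<in> A \<Longrightarrow> p i \<ge> 0"
    and anti: "\<And>i j. i \<in> A \<Longrightarrow> j \<in> A \<Longrightarrow> (a i - a j) * (b i - b j) \<le> 0"
  shows "(\<Sum>i\<in>A. p i * (a i * b i)) \<le> (\<Sum>i\<in>A. p i * a i) * (\<Sum>i\<in>A. p i * b i)"
proof -
  have "(\<Sum>i\<in>A. \<Sum>j\<in>A. p i * p j * ((a i - a j) * (b i - b j))) \<le> 0"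
    by (intro sum_nonpos mult_nonneg_nonpos[OF mult_nonneg_nonneg] assms)
  also have "(\<Sum>i\<in>A. \<Sum>j\<in>A. p i * p j * ((a i - a j) * (b i - b j)))
     = (\<Sum>i\<in>A. \<Sum>j\<in>A. (p i * (a i * b i)) * p j) + (\<Sum>i\<in>A. \<Sum>j\<in>A. p i * (p j * (a j * b j)))
       - (\<Sum>i\<in>A. \<Sum>j\<in>A. (p i * a i) * (p j * b j)) - (\<Sum>i\<in>A. \<Sum>j\<in>A. (p i * b i) * (p j * a j))"
    by (simp add: algebra_simps flip: sum.distrib sum_subtractf)
  also have "\<dots> = 2 * (\<Sum>i\<in>A. p i * (a i * b i)) - 2 * ((\<Sum>i\<in>A. p i * a i) * (\<Sum>i\<in>A. p i * b i))"
    unfolding sum_product[symmetric] assms(2) by simp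
  finally show ?thesis by simp
qed

text \<open>
  Let \<open>f j\<close> be the derivative of \<open>\<sigma>\<^sub>j\<^sub>+\<^sub>1\<close> at \<open>S\<close> in the direction \<open>e e\<^sup>T\<close>. An eigenvalue and the symmetric
  polynomial of the other eigenvalues are oppositely ordered, so Chebyshev's inequality and
  \<open>e \<bullet> S e \<le> - K\<close> yield \<open>\<sigma>\<^sub>j\<^sub>+\<^sub>1 + K f j \<le> f (j+1)\<close>. Since the \<open>\<sigma>\<^sub>j\<close> are nonnegative, \<open>f\<close> grows at least
  geometrically with ratio \<open>K\<close> from \<open>f 0 = 1\<close>, and it dominates every \<open>\<sigma>\<^sub>j\<close>. Therefore the gain \<open>d f h\<close>
  both exceeds \<open>d K\<^sup>h\<close> and controls all terms created by subtracting \<open>eps\<close> times the identity, which involve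
  only lower orders.
\<close>

theorem sigma_op_increase:
  fixes S :: "real^'n^'n"
  assumes S: "in_cone k S" and k: "k \<le> CARD('n)" and e: "norm e = 1"
    and K: "K > 0" "e \<bullet> (S *v e) \<le> - K" and d: "d > 0"
    and eps: "0 \<le> eps" "eps \<le> K" "real CARD('n) * 2 ^ CARD('n) * eps * (1 + d / K) \<le> d / 2"
    and j: "Suc h \<le> k"
  shows "sigma_op (Suc h) S + d / 2 * K ^ h \<le> sigma_op (Suc h) (S + d *\<^sub>R outer e + mat (- eps))"
proof -
  let ?n = "CARD('n)"
  have sym: "transpose S = S" and nn: "\<And>j. j \<le> k \<Longrightarrow> 0 \<le> sigma_op j S"
    using S by (auto simp: in_cone_def)
  obtain P l where Pl: "orthogonal_matrix P" "S = P ** diag l ** transpose P"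
    using symmetric_diagonalization[OF sym] .
  define w where "w = transpose P *v e"
  let ?E = "\<lambda>i j. elem_sym (UNIV - {i}) j (($) l)"
  define f where "f = (\<lambda>j. \<Sum>i\<in>UNIV. (w $ i)\<^sup>2 * ?E i j)"
  let ?M = "S + d *\<^sub>R outer e"
  have symM: "transpose ?M = ?M"
    using sym by (simp add: vec_eq_iff transpose_def outer_def algebra_simps)
  have sumw: "(\<Sum>i\<in>UNIV. (w $ i)\<^sup>2) = 1"
    using norm_transpose_orthogonal[OF Pl(1), of e] e by (simp add: sum_squares_eq_norm w_def)
  have See: "(\<Sum>i\<in>UNIV. (w $ i)\<^sup>2 * l $ i) \<le> - K"
    using K(2) quadratic_form_diagonalized[OF Pl(2) w_def] by simp
  have sE: "\<And>j. sigma_op j S = elem_sym UNIV j (($) l)" by (rule sigma_op_diagonalized[OF Pl])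
  have E1: "0 \<le> ?E i j" if "j < k" for i j
    using nn that by (intro elem_sym_remove_nonneg[of UNIV i k]) (auto simp: sE)
  have E2: "0 \<le> elem_sym (UNIV - {i} - {m}) j (($) l)" if "j < k - 1" "m \<noteq> i" for i m j
    using that E1 by (intro elem_sym_remove_nonneg[of "UNIV - {i}" m "k - 1"]) auto
  have f0: "f 0 = 1" by (simp add: f_def sumw)
  have fnn: "0 \<le> f j" if "j < k" for j
    unfolding f_def using E1 that by (intro sum_nonneg mult_nonneg_nonneg) auto
  have rec: "sigma_op (Suc j) S + K * f j \<le> f (Suc j)" if "Suc j \<le> k" for j
  proof -
    have anti: "(l $ i - l $ m) * (?E i j - ?E m j) \<le> 0" for i m
    proof (cases "j = 0 \<or> i = m")
      case False
      then obtain g where g: "j = Suc g" by (cases j) auto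
      have "?E i j = elem_sym (UNIV - {i} - {m}) j (($) l) + l $ m * elem_sym (UNIV - {i} - {m}) g (($) l)"
        unfolding g using False by (intro elem_sym_remove) auto
      moreover have "?E m j = elem_sym (UNIV - {i} - {m}) j (($) l) + l $ i * elem_sym (UNIV - {i} - {m}) g (($) l)"
        unfolding g using False elem_sym_remove[of "UNIV - {m}" i g "($) l"]
        by (simp add: Diff_insert2[symmetric] insert_commute)
      ultimately have "(l $ i - l $ m) * (?E i j - ?E m j)
          = - ((l $ i - l $ m)^2 * elem_sym (UNIV - {i} - {m}) g (($) l))"
        by (simp add: power2_eq_square algebra_simps)
      moreover have "0 \<le> elem_sym (UNIV - {i} - {m}) g (($) l)"
        using E2[of g m i] g that False by auto
      ultimately show ?thesis by simp
    qed auto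
    have "sigma_op (Suc j) S = (\<Sum>i\<in>UNIV. (w $ i)\<^sup>2 * sigma_op (Suc j) S)"
      using sumw by (simp flip: sum_distrib_right)
    also have "\<dots> = (\<Sum>i\<in>UNIV. (w $ i)\<^sup>2 * (?E i (Suc j) + l $ i * ?E i j))"
      unfolding sE by (intro sum.cong refl arg_cong2[of _ _ _ _ "(*)"] elem_sym_remove) auto
    also have "\<dots> = f (Suc j) + (\<Sum>i\<in>UNIV. (w $ i)\<^sup>2 * (l $ i * ?E i j))"
      by (simp add: f_def sum.distrib algebra_simps)
    also have "(\<Sum>i\<in>UNIV. (w $ i)\<^sup>2 * (l $ i * ?E i j)) \<le> (\<Sum>i\<in>UNIV. (w $ i)\<^sup>2 * l $ i) * f j"
      unfolding f_def by (rule chebyshev_sum_nonpos) (use sumw anti in auto)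
    also have "\<dots> \<le> - K * f j"
      by (rule mult_right_mono[OF See]) (use fnn that in auto)
    finally show ?thesis by simp
  qed
  have fstep: "K * f j \<le> f (Suc j)" if "Suc j \<le> k" for j
    using rec[OF that] nn[OF that] by linarith
  have fpow: "K ^ r * f i \<le> f (i + r)" if "i + r \<le> k" for i r
    using that
  proof (induction r)
    case (Suc r)
    have "K ^ Suc r * f i = K * (K ^ r * f i)" by simp
    also have "\<dots> \<le> K * f (i + r)"
      by (rule mult_left_mono) (use Suc K in auto)
    also have "\<dots> \<le> f (i + Suc r)" using fstep[of "i + r"] Suc.prems by simp
    finally show ?case .
  qed simp
  have sM: "sigma_op (Suc j) ?M = sigma_op (Suc j) S + d * f j" if "Suc j \<le> k" for j
    using sigma_op_rank_one[OF Pl _ w_def, where j = j and d = d] that k by (simp add: f_def)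
  have coneM: "in_cone k ?M" by (rule in_cone_rank_one(1)[OF S k]) (use d in simp)
  have sM_le: "sigma_op i ?M \<le> (1 + d / K) * f i" if "i \<le> h" for i
  proof (cases i)
    case 0
    then show ?thesis using symM f0 d K by simp
  next
    case (Suc g)
    have "K * f g \<le> f i" using fstep[of g] Suc that j by simp
    then have "d / K * (K * f g) \<le> d / K * f i"
      by (rule mult_left_mono) (use d K in auto)
    then have "d * f g \<le> d / K * f i" using K by simp
    moreover have "0 \<le> K * f g" using fnn[of g] K Suc that j by simp
    moreover have "sigma_op i S + K * f g \<le> f i" using rec[of g] Suc that j by simp
    moreover have "sigma_op i ?M = sigma_op i S + d * f g" using sM[of g] Suc that j by simp
    ultimately show ?thesis by (simp add: algebra_simps)
  qed
  have err: "eps ^ (Suc h - i) * sigma_op i ?M \<le> eps * (1 + d / K) * f h" if i: "i \<le> h" for i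
  proof -
    have q: "Suc h - i = Suc (h - i)" using i by simp
    have "eps ^ (Suc h - i) * sigma_op i ?M \<le> eps ^ (Suc h - i) * ((1 + d / K) * f i)"
      by (rule mult_left_mono[OF sM_le[OF i]]) (use eps in simp)
    also have "\<dots> = eps * (1 + d / K) * (eps ^ (h - i) * f i)" by (simp add: q)
    also have "\<dots> \<le> eps * (1 + d / K) * (K ^ (h - i) * f i)"
      using eps K d fnn[of i] i j by (intro mult_left_mono mult_right_mono power_mono) auto
    also have "\<dots> \<le> eps * (1 + d / K) * f h"
      using fpow[of i "h - i"] i j eps K d by (intro mult_left_mono) auto
    finally show ?thesis .
  qed
  have hk: "h < k" using j by simp
  have shift: "sigma_op (Suc h) (?M + mat (- eps))
     = (\<Sum>i\<le>Suc h. sigma_op i ?M * (real ((?n - i) choose (Suc h - i)) * (- eps) ^ (Suc h - i)))"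
    by (rule sigma_op_shift[OF symM]) (use j k in simp)
  have "\<bar>\<Sum>i\<le>h. sigma_op i ?M * (real ((?n - i) choose (Suc h - i)) * (- eps) ^ (Suc h - i))\<bar>
     \<le> (\<Sum>i\<le>h. 2 ^ ?n * (eps * (1 + d / K) * f h))"
  proof (rule order_trans[OF sum_abs sum_mono])
    fix i assume "i \<in> {..h}"
    then have i: "i \<le> h" by simp
    have nnM: "0 \<le> sigma_op i ?M" using coneM i j by (simp add: in_cone_def)
    have "\<bar>sigma_op i ?M * (real ((?n - i) choose (Suc h - i)) * (- eps) ^ (Suc h - i))\<bar>
      = real ((?n - i) choose (Suc h - i)) * (eps ^ (Suc h - i) * sigma_op i ?M)"
      using nnM eps by (simp add: abs_mult power_abs)
    also have "\<dots> \<le> 2 ^ ?n * (eps * (1 + d / K) * f h)"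
    proof (rule mult_mono)
      have "(?n - i) choose (Suc h - i) \<le> 2 ^ (?n - i)" by (rule binomial_le_pow2)
      also have "\<dots> \<le> (2::nat) ^ ?n" by (rule power_increasing) auto
      finally have "real ((?n - i) choose (Suc h - i)) \<le> real (2 ^ ?n)" by (simp only: of_nat_le_iff)
      then show "real ((?n - i) choose (Suc h - i)) \<le> 2 ^ ?n" by simp
      show "eps ^ (Suc h - i) * sigma_op i ?M \<le> eps * (1 + d / K) * f h" by (rule err[OF i])
    qed (use nnM eps in auto)
    finally show "\<bar>sigma_op i ?M * (real ((?n - i) choose (Suc h - i)) * (- eps) ^ (Suc h - i))\<bar>
       \<le> 2 ^ ?n * (eps * (1 + d / K) * f h)" .
  qed
  also have "(\<Sum>i\<le>h. 2 ^ ?n * (eps * (1 + d / K) * f h)) = real (Suc h) * 2 ^ ?n * eps * (1 + d / K) * f h"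
    by simp
  also have "\<dots> \<le> real ?n * 2 ^ ?n * eps * (1 + d / K) * f h"
    using j k eps d K fnn[OF hk] by (intro mult_right_mono) auto
  also have "\<dots> \<le> d / 2 * f h"
    by (rule mult_right_mono[OF eps(3) fnn[OF hk]])
  finally have "\<bar>\<Sum>i\<le>h. sigma_op i ?M * (real ((?n - i) choose (Suc h - i)) * (- eps) ^ (Suc h - i))\<bar>
     \<le> d / 2 * f h" .
  then have "sigma_op (Suc h) ?M - d / 2 * f h \<le> sigma_op (Suc h) (?M + mat (- eps))"
    unfolding shift by (simp add: abs_le_iff)
  moreover have "d / 2 * K ^ h \<le> d / 2 * f h"
    using fpow[of 0 h] f0 hk d by (intro mult_left_mono) auto
  ultimately show ?thesis using sM[OF j] by simp
qed

section \<open>The shape operator in an orthonormal frame\<close>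

text \<open>
  The inequalities \<open>esym j l \<ge> 0\<close> define a closed set containing the open cone.
\<close>

lemma garding_closure_esym_nonneg:
  assumes "l \<in> closure (garding_cone k)" "j \<le> k"
  shows "0 \<le> esym j l"
proof (cases "j = 0")
  case False
  have "closed {l :: real^'n. 0 \<le> esym j l}"
    unfolding esym_def by (intro closed_Collect_le continuous_intros)
  moreover have "garding_cone k \<subseteq> {l :: real^'n. 0 \<le> esym j l}"
    using False assms(2) by (auto simp: garding_cone_def intro: less_imp_le)
  ultimately show ?thesis using closure_minimal assms(1) by blast
qed (simp add: esym_eq_elem_sym)

lemma outer_mult_outer: "outer v ** outer v = (norm v)^2 *\<^sub>R outer v"
  unfolding power2_norm_eq_inner
  by (simp add: vec_eq_iff outer_def matrix_matrix_mult_def inner_vec_def sum_distrib_left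
      sum_distrib_right algebra_simps)

text \<open>
  The image of \<open>z\<close> under the positive square root of \<open>g\<^sup>-\<^sup>1 = 1 + W\<^sup>2 D D\<^sup>T\<close>. The coefficient
  \<open>W\<^sup>2/(W + 1)\<close> of \<open>D D\<^sup>T\<close> is written in terms of \<open>|D|\<close> alone.
\<close>

definition frame :: "real^'n \<Rightarrow> real^'n \<Rightarrow> real^'n" where
  "frame D z = z + (1 / (1 - (norm D)\<^sup>2 + sqrt (1 - (norm D)\<^sup>2)) * (D \<bullet> z)) *\<^sub>R D"

definition frame_matrix :: "real^'n \<Rightarrow> real^'n^'n" where
  "frame_matrix D = mat 1 + (1 / (1 - (norm D)\<^sup>2 + sqrt (1 - (norm D)\<^sup>2))) *\<^sub>R outer D"

lemma frame_matrix_mult: "frame_matrix D *v z = frame D z"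
  by (simp add: frame_matrix_def frame_def matrix_vector_mult_add_rdistrib outer_mult_vec
      scaleR_matrix_vector_assoc[symmetric])

lemma transpose_frame_matrix [simp]: "transpose (frame_matrix D) = frame_matrix D"
  by (simp add: frame_matrix_def vec_eq_iff transpose_def outer_def mat_def algebra_simps)

lemma frame_coefficient:
  fixes s :: real
  assumes "0 \<le> s" "s < 1"
  defines "b \<equiv> 1 / (1 - s + sqrt (1 - s))"
  shows "b > 0" "1 + b * s = 1 / sqrt (1 - s)" "2 * b + b^2 * s = 1 / (1 - s)"
proof -
  define r where "r = sqrt (1 - s)"
  have r: "r > 0" "s = 1 - r\<^sup>2" using assms by (auto simp: r_def)
  have b: "b = 1 / (r * (r + 1))" using r unfolding b_def by (simp add: r_def[symmetric] power2_eq_square algebra_simps)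
  show "b > 0" using r b by simp
  have rb: "r * b * (r + 1) = 1" using r(1) by (simp add: b)
  have "r * (1 + b * s) = r + (r * b * (r + 1)) * (1 - r)"
    unfolding r(2) by (simp add: power2_eq_square algebra_simps)
  then have "r * (1 + b * s) = 1" unfolding rb by simp
  then have "1 + b * s = 1 / r" using r(1) by (simp add: field_simps)
  then show "1 + b * s = 1 / sqrt (1 - s)" by (simp add: r_def)
  have m: "2 * r + (r * b * (r + 1)) * (1 - r) = r + 1" unfolding rb by simp
  have "(1 - s) * (2 * b + b^2 * s) = (r * b) * (2 * r + (r * b * (r + 1)) * (1 - r))"
    unfolding r(2) by (simp add: power2_eq_square algebra_simps)
  also have "\<dots> = r * b * (r + 1)" by (simp only: m)
  also have "\<dots> = 1" by (rule rb)
  finally show "2 * b + b^2 * s = 1 / (1 - s)" using assms by (simp add: field_simps)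
qed

lemma inner_frame:
  assumes "norm D < 1"
  shows "D \<bullet> frame D z = (D \<bullet> z) / sqrt (1 - (norm D)\<^sup>2)"
proof -
  have "(norm D)^2 < 1" using assms by (simp add: abs_square_less_1)
  then have "1 + 1 / (1 - (norm D)\<^sup>2 + sqrt (1 - (norm D)\<^sup>2)) * (norm D)^2 = 1 / sqrt (1 - (norm D)\<^sup>2)"
    by (intro frame_coefficient(2)) auto
  moreover have "D \<bullet> frame D z
      = (1 + 1 / (1 - (norm D)\<^sup>2 + sqrt (1 - (norm D)\<^sup>2)) * (norm D)^2) * (D \<bullet> z)"
    by (simp add: frame_def inner_add_right power2_norm_eq_inner algebra_simps)
  ultimately show ?thesis by simp
qed

lemma norm_frame:
  assumes "norm D < 1"
  shows "(norm (frame D z))^2 = (norm z)^2 + (D \<bullet> z)^2 / (1 - (norm D)\<^sup>2)"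
proof -
  let ?b = "1 / (1 - (norm D)\<^sup>2 + sqrt (1 - (norm D)\<^sup>2))"
  have "(norm D)^2 < 1" using assms by (simp add: abs_square_less_1)
  then have "2 * ?b + ?b^2 * (norm D)^2 = 1 / (1 - (norm D)\<^sup>2)"
    by (intro frame_coefficient(3)) auto
  moreover have "(norm (z + (b * (D \<bullet> z)) *\<^sub>R D))^2
      = (norm z)^2 + (2 * b + b^2 * (norm D)^2) * (D \<bullet> z)^2" for b
    unfolding power2_norm_eq_inner
    by (simp add: inner_add_left inner_add_right inner_commute power2_eq_square algebra_simps)
  ultimately show ?thesis unfolding frame_def by (metis (no_types) mult_1 times_divide_eq_left)
qed

text \<open>
  The frame is orthonormal for the induced metric \<open>g\<close>.
\<close>

lemma norm_frame_spacelike: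
  assumes "norm D < 1"
  shows "(norm (frame D z))^2 - (D \<bullet> frame D z)\<^sup>2 = (norm z)^2"
proof -
  have s: "(norm D)^2 < 1" using assms by (simp add: abs_square_less_1)
  then have "(sqrt (1 - (norm D)\<^sup>2))^2 = 1 - (norm D)\<^sup>2" by simp
  then show ?thesis
    unfolding norm_frame[OF assms] inner_frame[OF assms] using s by (simp add: power_divide)
qed

lemma frame_matrix_square:
  assumes "norm D < 1"
  shows "frame_matrix D ** frame_matrix D = mat 1 + (1 / (1 - (norm D)\<^sup>2)) *\<^sub>R outer D"
proof -
  let ?b = "1 / (1 - (norm D)\<^sup>2 + sqrt (1 - (norm D)\<^sup>2))"
  have "(norm D)^2 < 1" using assms by (simp add: abs_square_less_1)
  then have b: "2 * ?b + ?b^2 * (norm D)^2 = 1 / (1 - (norm D)\<^sup>2)"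
    by (intro frame_coefficient(3)) auto
  have "(mat 1 + b *\<^sub>R outer D) ** (mat 1 + b *\<^sub>R outer D)
      = mat 1 + (2 * b + b^2 * (norm D)^2) *\<^sub>R outer D" for b
  proof -
    have "(mat 1 + b *\<^sub>R outer D) ** (mat 1 + b *\<^sub>R outer D)
      = mat 1 + b *\<^sub>R outer D + (b *\<^sub>R outer D + b *\<^sub>R b *\<^sub>R (norm D)\<^sup>2 *\<^sub>R outer D)"
      by (simp only: matrix_mult_add_left matrix_add_ldistrib matrix_mult_scaleR outer_mult_outer
        matrix_mul_lid matrix_mul_rid scaleR_right_distrib)
    also have "\<dots> = mat 1 + (2 * b + b^2 * (norm D)^2) *\<^sub>R outer D"
      by (simp add: vec_eq_iff power2_eq_square algebra_simps)
    finally show ?thesis .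
  qed
  then show ?thesis unfolding frame_matrix_def b[symmetric] by blast
qed

lemma gmat_eq: "gmat u x = mat 1 - outer (grad u x)"
  by (simp add: gmat_def vec_eq_iff mat_def outer_def)

lemma gmat_inverse:
  assumes "norm (grad u x) < 1"
  defines "G \<equiv> mat 1 + (1 / (1 - (norm (grad u x))\<^sup>2)) *\<^sub>R outer (grad u x)"
  shows "gmat u x ** G = mat 1" "G ** gmat u x = mat 1"
proof -
  let ?D = "grad u x"
  have s: "(norm ?D)^2 < 1" using assms by (simp add: abs_square_less_1)
  define c where "c = 1 / (1 - (norm ?D)\<^sup>2)"
  have c: "c - 1 - c * (norm ?D)^2 = 0" using s by (simp add: c_def field_simps)
  have e: "gmat u x = mat 1 + (-1) *\<^sub>R outer ?D" by (simp add: gmat_eq)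
  have "gmat u x ** G = mat 1 + (c - 1 - c * (norm ?D)^2) *\<^sub>R outer ?D"
   and "G ** gmat u x = mat 1 + (c - 1 - c * (norm ?D)^2) *\<^sub>R outer ?D"
    unfolding e G_def c_def[symmetric]
    by (simp_all only: matrix_mult_add_left matrix_add_ldistrib matrix_mult_scaleR outer_mult_outer
        matrix_mul_lid matrix_mul_rid) (simp_all add: algebra_simps)
  then show "gmat u x ** G = mat 1" "G ** gmat u x = mat 1"
    unfolding c by simp_all
qed

lemma matrix_inv_gmat:
  assumes "norm (grad u x) < 1"
  shows "matrix_inv (gmat u x) = frame_matrix (grad u x) ** frame_matrix (grad u x)"
proof -
  let ?G = "mat 1 + (1 / (1 - (norm (grad u x))\<^sup>2)) *\<^sub>R outer (grad u x)"
  note G = gmat_inverse[OF assms]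
  have inv: "gmat u x ** matrix_inv (gmat u x) = mat 1 \<and> matrix_inv (gmat u x) ** gmat u x = mat 1"
    unfolding matrix_inv_def by (rule someI[where x = ?G]) (use G in blast)
  have "matrix_inv (gmat u x) = (?G ** gmat u x) ** matrix_inv (gmat u x)"
    unfolding G(2) by simp
  also have "\<dots> = ?G" using inv by (simp only: matrix_mul_assoc[symmetric] matrix_mul_rid)
  finally show ?thesis by (simp add: frame_matrix_square[OF assms])
qed

text \<open>
  The symmetric matrix similar to the shape operator.
\<close>

definition sym_shape :: "(real^'n \<Rightarrow> real) \<Rightarrow> real^'n \<Rightarrow> real^'n^'n" where
  "sym_shape u x = frame_matrix (grad u x) ** hmat u x ** frame_matrix (grad u x)"

text \<open>
  The shape operator is \<open>L L h\<close>, and \<open>(L L h) L = L (L h L)\<close> with \<open>L\<close> invertible.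
\<close>

lemma eigenvalues_shape_operator:
  assumes "norm (grad u x) < 1"
  shows "eigenvalues (shape_operator u x) = eigenvalues (sym_shape u x)"
proof -
  let ?L = "frame_matrix (grad u x)" and ?h = "hmat u x" and ?g = "gmat u x"
  have "det ?g * det (?L ** ?L) = 1"
    using gmat_inverse(1)[OF assms] unfolding frame_matrix_square[OF assms] by (metis det_I det_mul)
  then have L0: "det ?L \<noteq> 0" unfolding det_mul by auto
  have "det (mat t - shape_operator u x) = det (mat t - sym_shape u x)" for t
  proof -
    have comm: "mat t ** ?L = ?L ** mat t"
      by (simp add: vec_eq_iff matrix_matrix_mult_def mat_def if_distrib if_distribR mult.commute cong: if_cong)
    have sub: "(A - B) ** C = A ** C - B ** C" "C ** (A - B) = C ** A - C ** B" for A B C :: "real^'n^'n"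
      by (simp_all add: vec_eq_iff matrix_matrix_mult_def sum_subtractf algebra_simps)
    have "(mat t - shape_operator u x) ** ?L = ?L ** (mat t - sym_shape u x)"
      by (simp add: sub comm shape_operator_def sym_shape_def matrix_inv_gmat[OF assms] matrix_mul_assoc)
    then have "det (mat t - shape_operator u x) * det ?L = det ?L * det (mat t - sym_shape u x)"
      by (metis det_mul)
    then show ?thesis using L0 by simp
  qed
  then have "charpoly (shape_operator u x) = charpoly (sym_shape u x)"
    by (simp add: poly_eq_poly_eq_iff[symmetric] fun_eq_iff poly_charpoly)
  then show ?thesis by (simp add: eigenvalues_def)
qed

lemma sigma_op_shape_operator:
  assumes "norm (grad u x) < 1"
  shows "sigma_op j (shape_operator u x) = sigma_op j (sym_shape u x)"
  by (simp add: sigma_op_def eigenvalues_shape_operator[OF assms])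

lemma sym_shape_quadratic_form:
  "z \<bullet> (sym_shape u x *v z)
    = - Wfun u x * (frame (grad u x) z \<bullet> (hess u x *v frame (grad u x) z))"
proof -
  let ?L = "frame_matrix (grad u x)"
  have h: "hmat u x = (- Wfun u x) *\<^sub>R hess u x"
    by (simp add: hmat_def vec_eq_iff)
  have "z \<bullet> (sym_shape u x *v z) = z \<bullet> (?L *v (hmat u x *v (?L *v z)))"
    by (simp only: sym_shape_def matrix_vector_mul_assoc matrix_mul_assoc)
  also have "\<dots> = (?L *v z) \<bullet> (hmat u x *v (?L *v z))"
    by (rule symmetric_dot) simp
  also have "hmat u x *v y = (- Wfun u x) *\<^sub>R (hess u x *v y)" for y
    unfolding h by (rule scaleR_matrix_vector_assoc[symmetric])
  finally show ?thesis
    by (simp add: frame_matrix_mult)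
qed

lemma Wfun_eq: 
  assumes "norm (grad u x) < 1" shows "Wfun u x = 1 / sqrt (1 - (norm (grad u x))\<^sup>2)"
proof -
  have s: "(norm (grad u x))^2 < 1" using assms by (simp add: abs_square_less_1)
  then show ?thesis unfolding Wfun_def
    by (simp add: powr_minus powr_half_sqrt inverse_eq_divide)
qed


section \<open>Second-order calculus for twice differentiable functions\<close>

lemma C2_has_derivative:
  assumes "C2 u"
  shows "(u has_derivative (\<lambda>v. grad u x \<bullet> v)) (at x)"
proof -
  let ?f = "frechet_derivative u (at x)"
  have d: "(u has_derivative ?f) (at x)"
    using assms by (simp add: C2_def frechet_derivative_works)
  then have lin: "linear ?f" by (rule has_derivative_linear)
  have "?f v = grad u x \<bullet> v" for v
  proof -
    have "?f v = ?f (\<Sum>i\<in>UNIV. (v $ i) *\<^sub>R axis i 1)"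
      using basis_expansion[of v] by (simp add: scalar_mult_eq_scaleR)
    also have "\<dots> = (\<Sum>i\<in>UNIV. v $ i * ?f (axis i 1))"
      by (simp add: linear_sum[OF lin] linear_cmul[OF lin])
    finally show ?thesis by (simp add: grad_def inner_vec_def mult.commute)
  qed
  then have "?f = (\<lambda>v. grad u x \<bullet> v)" by (simp add: fun_eq_iff)
  then show ?thesis using d by simp
qed

lemma C2_grad_has_derivative:
  assumes "C2 u"
  shows "(grad u has_derivative (\<lambda>v. hess u x *v v)) (at x)"
  using assms jacobian_works[of "grad u" "at x"] by (simp add: C2_def hess_def)

lemma line_has_derivative: "((\<lambda>t. x + t *\<^sub>R v) has_derivative (\<lambda>h. h *\<^sub>R v)) (at t)"
  by (auto intro!: derivative_eq_intros)

lemma C2_line_derivative: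
  assumes "C2 u"
  shows "((\<lambda>t. u (x + t *\<^sub>R v)) has_real_derivative grad u (x + t *\<^sub>R v) \<bullet> v) (at t)"
proof -
  have "((\<lambda>t. u (x + t *\<^sub>R v)) has_derivative (\<lambda>h. grad u (x + t *\<^sub>R v) \<bullet> (h *\<^sub>R v))) (at t)"
    using has_derivative_compose[OF line_has_derivative C2_has_derivative[OF assms]] .
  then show ?thesis by (simp add: has_field_derivative_def mult.commute[of _ "grad u (x + t *\<^sub>R v) \<bullet> v"])
qed

lemma C2_line_second_derivative:
  assumes "C2 u"
  shows "((\<lambda>t. grad u (x + t *\<^sub>R v) \<bullet> w) has_real_derivative (hess u (x + t *\<^sub>R v) *v v) \<bullet> w) (at t)"
proof -
  have "((\<lambda>t. grad u (x + t *\<^sub>R v)) has_derivative (\<lambda>h. hess u (x + t *\<^sub>R v) *v (h *\<^sub>R v))) (at t)"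
    using has_derivative_compose[OF line_has_derivative C2_grad_has_derivative[OF assms]] .
  then have "((\<lambda>t. grad u (x + t *\<^sub>R v) \<bullet> w) has_derivative (\<lambda>h. (hess u (x + t *\<^sub>R v) *v (h *\<^sub>R v)) \<bullet> w)) (at t)"
    by (rule has_derivative_inner_left)
  then show ?thesis
    by (simp add: has_field_derivative_def matrix_vector_mult_scaleR mult.commute[of _ "(hess u (x + t *\<^sub>R v) *v v) \<bullet> w"])
qed

text \<open>
  The mixed second difference, by the mean value theorem applied once in each direction.
\<close>

lemma C2_mixed_mean_value:
  assumes u: "C2 u" and s: "s > 0"
  shows "\<exists>p. norm (p - x) \<le> s * (norm a + norm b)
     \<and> u (x + s *\<^sub>R a + s *\<^sub>R b) - u (x + s *\<^sub>R a) - u (x + s *\<^sub>R b) + u x = s * s * ((hess u p *v b) \<bullet> a)"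
proof -
  let ?F = "\<lambda>r. u ((x + s *\<^sub>R b) + r *\<^sub>R a) - u (x + r *\<^sub>R a)"
  let ?F' = "\<lambda>r. grad u ((x + s *\<^sub>R b) + r *\<^sub>R a) \<bullet> a - grad u (x + r *\<^sub>R a) \<bullet> a"
  have "(?F has_real_derivative ?F' r) (at r)" for r
    by (intro DERIV_diff C2_line_derivative[OF u])
  then obtain r where r: "0 < r" "r < s" "?F s - ?F 0 = (s - 0) * ?F' r"
    using MVT2[OF s, of ?F ?F'] by blast
  let ?G = "\<lambda>t. grad u ((x + r *\<^sub>R a) + t *\<^sub>R b) \<bullet> a"
  have "(?G has_real_derivative (hess u ((x + r *\<^sub>R a) + t *\<^sub>R b) *v b) \<bullet> a) (at t)" for t
    by (rule C2_line_second_derivative[OF u])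
  then obtain t where t: "0 < t" "t < s"
      "?G s - ?G 0 = (s - 0) * ((hess u ((x + r *\<^sub>R a) + t *\<^sub>R b) *v b) \<bullet> a)"
    using MVT2[OF s, of ?G "\<lambda>t. (hess u ((x + r *\<^sub>R a) + t *\<^sub>R b) *v b) \<bullet> a"] by blast
  let ?p = "(x + r *\<^sub>R a) + t *\<^sub>R b"
  have "norm (?p - x) \<le> norm (r *\<^sub>R a) + norm (t *\<^sub>R b)"
    using norm_triangle_ineq[of "r *\<^sub>R a" "t *\<^sub>R b"] by (simp add: add.assoc del: norm_scaleR)
  also have "\<dots> \<le> s * norm a + s * norm b"
    using r t s by (auto intro!: add_mono mult_right_mono)
  finally have "norm (?p - x) \<le> s * (norm a + norm b)" by (simp add: algebra_simps)
  moreover have "?F' r = ?G s - ?G 0" by (simp add: add.commute add.left_commute)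
  ultimately show ?thesis using r(3) t(3)
    by (intro exI[of _ ?p]) (simp add: algebra_simps)
qed

text \<open>
  Schwarz's theorem: exchanging \<open>a\<close> and \<open>b\<close> does not change the mixed difference, so the two mixed second
  derivatives agree at points converging to \<open>x\<close>, and the Hessian is continuous.
\<close>

theorem C2_hess_symmetric:
  assumes u: "C2 u"
  shows "transpose (hess u x) = hess u x"
proof -
  have "(hess u x *v b) \<bullet> a = (hess u x *v a) \<bullet> b" for a b
  proof -
    define s where "s = (\<lambda>n. inverse (real (Suc n)))"
    have s0: "s n > 0" for n by (simp add: s_def)
    have slim: "s \<longlonglongrightarrow> 0" unfolding s_def by (rule LIMSEQ_inverse_real_of_nat)
    obtain p where p: "\<And>n. norm (p n - x) \<le> s n * (norm a + norm b)"
      "\<And>n. u (x + s n *\<^sub>R a + s n *\<^sub>R b) - u (x + s n *\<^sub>R a) - u (x + s n *\<^sub>R b) + u x = s n * s n * ((hess u (p n) *v b) \<bullet> a)"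
      using C2_mixed_mean_value[OF u s0, where x = x and a = a and b = b] by metis
    obtain q where q: "\<And>n. norm (q n - x) \<le> s n * (norm b + norm a)"
      "\<And>n. u (x + s n *\<^sub>R b + s n *\<^sub>R a) - u (x + s n *\<^sub>R b) - u (x + s n *\<^sub>R a) + u x = s n * s n * ((hess u (q n) *v a) \<bullet> b)"
      using C2_mixed_mean_value[OF u s0, where x = x and a = b and b = a] by metis
    have eq: "(hess u (p n) *v b) \<bullet> a = (hess u (q n) *v a) \<bullet> b" for n
    proof -
      have "s n * s n * ((hess u (p n) *v b) \<bullet> a) = s n * s n * ((hess u (q n) *v a) \<bullet> b)"
      proof -
        have e: "x + s n *\<^sub>R b + s n *\<^sub>R a = x + s n *\<^sub>R a + s n *\<^sub>R b" by simp
        show ?thesis using p(2)[of n] q(2)[of n] unfolding e by linarith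
      qed
      then show ?thesis using s0[of n] by simp
    qed
    have lim: "z \<longlonglongrightarrow> x" if "\<And>n. norm (z n - x) \<le> s n * c" for z c
    proof -
      have "(\<lambda>n. s n * c) \<longlonglongrightarrow> 0" using tendsto_mult_left_zero[OF slim] .
      then have "(\<lambda>n. z n - x) \<longlonglongrightarrow> 0"
        by (rule Lim_null_comparison[rotated]) (use that in simp)
      then show ?thesis by (simp add: LIM_zero_iff)
    qed
    have cont: "isCont (hess u) x" using u by (simp add: C2_def continuous_on_eq_continuous_at)
    have hl: "(\<lambda>n. (hess u (z n) *v c) \<bullet> d) \<longlonglongrightarrow> (hess u x *v c) \<bullet> d" if "z \<longlonglongrightarrow> x" for z c d
    proof -
      have "(\<lambda>n. hess u (z n)) \<longlonglongrightarrow> hess u x" using isCont_tendsto_compose[OF cont that] .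
      then have "(\<lambda>n. hess u (z n) $ i $ j) \<longlonglongrightarrow> hess u x $ i $ j" for i j
        by (intro tendsto_vec_nth)
      then show ?thesis
        unfolding matrix_vector_mult_def inner_vec_def by (auto intro!: tendsto_sum tendsto_mult)
    qed
    show ?thesis
      using LIMSEQ_unique[OF hl[OF lim[OF p(1)], of b a]] hl[OF lim[OF q(1)], of a b] eq by simp
  qed
  note * = this
  have "hess u x $ i $ j = (hess u x *v axis j 1) \<bullet> axis i 1" for i j
    by (simp add: inner_axis matrix_vector_mult_basis column_def)
  then show ?thesis using * by (simp add: vec_eq_iff transpose_def)
qed

lemma sym_shape_symmetric:
  assumes "C2 u"
  shows "transpose (sym_shape u x) = sym_shape u x"
proof -
  have "transpose (hmat u x) = hmat u x"
    using C2_hess_symmetric[OF assms, of x] by (simp add: hmat_def vec_eq_iff transpose_def)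
  then show ?thesis
    by (simp add: sym_shape_def matrix_transpose_mul matrix_mul_assoc)
qed

lemma second_derivative_test:
  fixes f :: "real \<Rightarrow> real"
  assumes r: "r > 0" and d: "\<And>t. \<bar>t\<bar> < r \<Longrightarrow> (f has_real_derivative f' t) (at t)"
    and d2: "(f' has_real_derivative c) (at 0)" and min: "\<And>t. \<bar>t\<bar> < r \<Longrightarrow> f 0 \<le> f t"
  shows "f' 0 = 0" "0 \<le> c"
proof -
  show f0: "f' 0 = 0"
    using DERIV_local_min[OF d[of 0] r] r min by simp
  show "0 \<le> c"
  proof (rule ccontr)
    assume "\<not> 0 \<le> c"
    then obtain e where e: "e > 0" "\<And>h. 0 < h \<Longrightarrow> h < e \<Longrightarrow> f' (0 + h) < f' 0"
      using DERIV_neg_dec_right[OF d2] by auto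
    define t where "t = min e r / 2"
    have t: "0 < t" "t < e" "t < r" using e r by (auto simp: t_def)
    obtain z where z: "0 < z" "z < t" "f t - f 0 = (t - 0) * f' z"
      using MVT2[OF t(1), of f f'] d t by auto
    have "f' z < 0" using e(2)[of z] z t f0 by simp
    then have "f t < f 0" using z(3) t mult_pos_neg[of t "f' z"] by simp
    then show False using min[of t] t by simp
  qed
qed

text \<open>
  One computation for both comparison functions of the proof: \<open>a = 0\<close> gives the distance, \<open>a = r\<^sup>2\<close> the
  hyperboloid of radius \<open>r\<close>.
\<close>

lemma sqrt_line:
  fixes p v :: "real^'n"
  assumes "a + (norm p)^2 > 0"
  defines "R \<equiv> \<lambda>t. sqrt (a + (norm (p + t *\<^sub>R v))^2)"
  shows "\<exists>r>0. \<forall>t. \<bar>t\<bar> < r \<longrightarrow> R t > 0 \<and> (R has_real_derivative ((p + t *\<^sub>R v) \<bullet> v) / R t) (at t)"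
    and "((\<lambda>t. ((p + t *\<^sub>R v) \<bullet> v) / R t) has_real_derivative ((norm v)^2 - ((p \<bullet> v) / R 0)\<^sup>2) / R 0) (at 0)"
proof -
  define Q where "Q = (\<lambda>t. a + (norm (p + t *\<^sub>R v))^2)"
  have Q: "Q = (\<lambda>t. a + p \<bullet> p + 2 * t * (p \<bullet> v) + t^2 * (v \<bullet> v))"
    unfolding Q_def power2_norm_eq_inner
    by (simp add: fun_eq_iff inner_add_left inner_add_right inner_commute power2_eq_square algebra_simps)
  have dQ: "(Q has_real_derivative 2 * ((p + t *\<^sub>R v) \<bullet> v)) (at t)" for t
    unfolding Q by (auto intro!: derivative_eq_intros simp: inner_add_left)
  have R: "R = (\<lambda>t. sqrt (Q t))" by (simp add: R_def Q_def)
  have Q0: "Q 0 > 0" using assms(1) by (simp add: Q_def)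
  have dR: "(R has_real_derivative ((p + t *\<^sub>R v) \<bullet> v) / R t) (at t)" if "Q t > 0" for t
    unfolding R using that dQ by (auto intro!: derivative_eq_intros simp: field_simps)
  have "isCont Q 0" using dQ DERIV_isCont by blast
  then obtain r where r: "r > 0" "\<forall>t. dist t 0 < r \<longrightarrow> dist (Q t) (Q 0) < Q 0"
    using Q0 unfolding continuous_at_eps_delta by metis
  have Qpos: "Q t > 0" if "\<bar>t\<bar> < r" for t
  proof -
    have "\<bar>Q t - Q 0\<bar> < Q 0" using r(2) that by (simp add: dist_real_def)
    then show ?thesis by linarith
  qed
  show "\<exists>r>0. \<forall>t. \<bar>t\<bar> < r \<longrightarrow> R t > 0 \<and> (R has_real_derivative ((p + t *\<^sub>R v) \<bullet> v) / R t) (at t)"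
    using r(1) Qpos dR by (auto simp: R)
  have R0: "R 0 > 0" using Q0 by (simp add: R)
  have dN: "((\<lambda>t. (p + t *\<^sub>R v) \<bullet> v) has_real_derivative v \<bullet> v) (at 0)"
    by (auto intro!: derivative_eq_intros simp: inner_add_left)
  have "((\<lambda>t. ((p + t *\<^sub>R v) \<bullet> v) / R t) has_real_derivative
     (v \<bullet> v * R 0 - ((p + 0 *\<^sub>R v) \<bullet> v) * (((p + 0 *\<^sub>R v) \<bullet> v) / R 0)) / (R 0 * R 0)) (at 0)"
    by (rule DERIV_divide[OF dN dR[OF Q0]]) (use R0 in simp)
  moreover have "(v \<bullet> v * R 0 - ((p + 0 *\<^sub>R v) \<bullet> v) * (((p + 0 *\<^sub>R v) \<bullet> v) / R 0)) / (R 0 * R 0)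
     = ((norm v)^2 - ((p \<bullet> v) / R 0)\<^sup>2) / R 0"
    using R0 unfolding power2_norm_eq_inner by (simp add: field_simps power2_eq_square)
  ultimately show "((\<lambda>t. ((p + t *\<^sub>R v) \<bullet> v) / R t) has_real_derivative ((norm v)^2 - ((p \<bullet> v) / R 0)\<^sup>2) / R 0) (at 0)"
    by simp
qed

section \<open>Steep cones under a graph of nonnegative mean curvature\<close>

lemma spacelike_lipschitz:
  assumes u: "C2 u" and sp: "\<And>x. norm (grad u x) < 1"
  shows "u x - u y \<le> norm (x - y)"
proof -
  obtain t where t: "u (y + 1 *\<^sub>R (x - y)) - u (y + 0 *\<^sub>R (x - y))
      = (1 - 0) * (grad u (y + t *\<^sub>R (x - y)) \<bullet> (x - y))"
    using MVT2[of 0 1 "\<lambda>t. u (y + t *\<^sub>R (x - y))" "\<lambda>t. grad u (y + t *\<^sub>R (x - y)) \<bullet> (x - y)"]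
      C2_line_derivative[OF u] by auto
  have "grad u (y + t *\<^sub>R (x - y)) \<bullet> (x - y) \<le> norm (grad u (y + t *\<^sub>R (x - y))) * norm (x - y)"
    by (rule norm_cauchy_schwarz)
  also have "\<dots> \<le> 1 * norm (x - y)"
    by (rule mult_right_mono) (use sp in \<open>auto intro: less_imp_le\<close>)
  finally show ?thesis using t by simp
qed

lemma C2_continuous_on:
  assumes "C2 u" shows "continuous_on S u"
  by (intro continuous_at_imp_continuous_on ballI has_derivative_continuous[OF C2_has_derivative[OF assms]])

text \<open>
  The trace of \<open>S\<close> when the Hessian is bounded below by that of a radial function with gradient
  \<open>- s e\<close>: the frame stretches the direction \<open>e\<close> by \<open>W\<close> and leaves the others unchanged.
\<close>

lemma trace_radial_bound:
  fixes u :: "real^'n \<Rightarrow> real"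
  assumes u: "C2 u" and e: "norm e = 1" and D: "grad u y = (- s) *\<^sub>R e" and s: "0 < s" "s < 1"
    and H: "\<And>v. a * (e \<bullet> v)^2 - b * ((norm v)^2 - (e \<bullet> v)\<^sup>2) \<le> v \<bullet> (hess u y *v v)"
  shows "sigma_op (Suc 0) (sym_shape u y) \<le> - Wfun u y * (a / (1 - s\<^sup>2) - b * (real CARD('n) - 1))"
proof -
  let ?D = "grad u y"
  have nD: "norm ?D = s" using e s by (simp add: D)
  have nD1: "norm ?D < 1" using nD s by simp
  have s2: "s^2 < 1" using s by (simp add: abs_square_less_1)
  have De: "(?D \<bullet> z)^2 = s^2 * (e \<bullet> z)^2" for z by (simp add: D power_mult_distrib)
  have eL: "(e \<bullet> frame ?D z)^2 = (e \<bullet> z)^2 / (1 - s\<^sup>2)" for z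
  proof -
    have "s^2 * (e \<bullet> frame ?D z)^2 = s^2 * ((e \<bullet> z)^2 / (1 - s\<^sup>2))"
      using inner_frame[OF nD1, of z] De[of z] De[of "frame ?D z"] s2 nD
      by (simp add: power_divide)
    then have "s^2 = 0 \<or> (e \<bullet> frame ?D z)\<^sup>2 = (e \<bullet> z)^2 / (1 - s\<^sup>2)"
      by (simp only: mult_cancel_left)
    then show ?thesis using s by simp
  qed
  have nL: "(norm (frame ?D z))^2 - (e \<bullet> frame ?D z)\<^sup>2 = (norm z)^2 - (e \<bullet> z)\<^sup>2" for z
  proof -
    have "s^2 * (e \<bullet> z)^2 / (1 - s\<^sup>2) = (e \<bullet> z)^2 / (1 - s\<^sup>2) - (e \<bullet> z)\<^sup>2"
      using s2 by (simp add: field_simps)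
    then show ?thesis unfolding eL norm_frame[OF nD1] De nD by simp
  qed
  have W: "Wfun u y \<ge> 0" by (simp add: Wfun_def)
  have "sigma_op (Suc 0) (sym_shape u y)
      = (\<Sum>i\<in>UNIV. - Wfun u y * (frame ?D (axis i 1) \<bullet> (hess u y *v frame ?D (axis i 1))))"
    unfolding sigma_op_1_eq_trace[OF sym_shape_symmetric[OF u]] sym_shape_quadratic_form ..
  also have "\<dots> \<le> (\<Sum>i\<in>UNIV. - Wfun u y * (a * ((e \<bullet> axis i 1)^2 / (1 - s\<^sup>2))
       - b * ((norm (axis i 1 :: real^'n))^2 - (e \<bullet> axis i 1)\<^sup>2)))"
  proof (rule sum_mono)
    fix i :: 'n
    let ?z = "axis i 1 :: real^'n"
    have "a * ((e \<bullet> ?z)^2 / (1 - s\<^sup>2)) - b * ((norm ?z)^2 - (e \<bullet> ?z)\<^sup>2)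
        \<le> frame ?D ?z \<bullet> (hess u y *v frame ?D ?z)"
      using H[of "frame ?D ?z"] unfolding nL unfolding eL .
    then show "- Wfun u y * (frame ?D ?z \<bullet> (hess u y *v frame ?D ?z))
      \<le> - Wfun u y * (a * ((e \<bullet> ?z)^2 / (1 - s\<^sup>2)) - b * ((norm ?z)^2 - (e \<bullet> ?z)\<^sup>2))"
      by (rule mult_left_mono_neg) (use W in simp)
  qed
  also have "\<dots> = - Wfun u y * (a * (\<Sum>i\<in>UNIV. (e $ i)\<^sup>2) / (1 - s\<^sup>2)
       - b * (real CARD('n) - (\<Sum>i\<in>UNIV. (e $ i)\<^sup>2)))"
  proof -
    let ?al = "- Wfun u y * (a / (1 - s\<^sup>2) + b)" and ?be = "Wfun u y * b"
    have "(\<Sum>i\<in>UNIV. - Wfun u y * (a * ((e \<bullet> axis i 1)^2 / (1 - s\<^sup>2))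
       - b * ((norm (axis i 1 :: real^'n))^2 - (e \<bullet> axis i 1)\<^sup>2))) = (\<Sum>i\<in>UNIV. ?al * (e $ i)^2 + ?be)"
      by (rule sum.cong) (simp_all add: inner_axis algebra_simps)
    also have "\<dots> = ?al * (\<Sum>i\<in>UNIV. (e $ i)\<^sup>2) + real CARD('n) * ?be"
      by (simp only: sum.distrib sum_distrib_left sum_constant)
    finally show ?thesis by (simp add: algebra_simps)
  qed
  also have "(\<Sum>i\<in>UNIV. (e $ i)\<^sup>2) = 1" using e by (simp add: sum_squares_eq_norm)
  finally show ?thesis by simp
qed

text \<open>
  The barrier \<open>\<phi>(\<rho>) = u x - \<rho> + c \<rho>\<^sup>q\<close> with \<open>q = 2n\<close> has slope \<open>-(1 - w)\<close> where \<open>w = c q \<rho>\<^sup>q\<^sup>-\<^sup>1\<close>. Divided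
  by \<open>W\<close>, its radial curvature is \<open>-W\<^sup>2 \<phi>'' = -(q-1)/(\<rho>(2 - w))\<close> and its other \<open>n - 1\<close> curvatures are
  \<open>(1 - w)/\<rho>\<close>; as \<open>(q - 1)/2 > n - 1\<close>, the mean curvature is negative, so the barrier
  cannot touch \<open>u\<close> from below away from \<open>x\<close>. On the sphere of radius \<open>4\<close> the barrier is at most \<open>0 \<le> u\<close>.
\<close>

theorem steep_cone_lower_bound:
  fixes u :: "real^'n \<Rightarrow> real"
  assumes u: "C2 u" and sp: "\<And>x. norm (grad u x) < 1" and nonneg: "\<And>x. 0 \<le> u x"
    and mean: "\<And>x. 0 \<le> sigma_op (Suc 0) (sym_shape u x)"
    and ux: "u x \<le> 2" and y: "norm (y - x) \<le> 4"
    and m: "m = 2 * CARD('n) - 2"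
  defines "c \<equiv> 1 / (real (Suc (Suc m)) * 4 ^ Suc m)"
  shows "u x - norm (y - x) + c * norm (y - x) ^ Suc (Suc m) \<le> u y"
proof (rule ccontr)
  let ?q = "real (Suc (Suc m))"
  have n1: "CARD('n) \<ge> 1" by (simp add: Suc_leI)
  define F where "F = (\<lambda>z. u z - u x + norm (z - x) - c * norm (z - x) ^ Suc (Suc m))"
  assume "\<not> ?thesis"
  then have Fy: "F y < 0" by (simp add: F_def)
  have "continuous_on (cball x 4) F"
    unfolding F_def by (intro continuous_intros C2_continuous_on[OF u])
  then obtain y0 where y0: "y0 \<in> cball x 4" "\<And>z. z \<in> cball x 4 \<Longrightarrow> F y0 \<le> F z"
    using continuous_attains_inf[of "cball x 4" F] by auto
  have "F y0 < 0" using y0(2)[of y] Fy y by (simp add: dist_norm norm_minus_commute)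
  define p where "p = y0 - x"
  define d where "d = norm p"
  have c0: "c > 0" by (simp add: c_def)
  have "y0 \<noteq> x" using \<open>F y0 < 0\<close> by (auto simp: F_def)
  then have d0: "d > 0" by (simp add: d_def p_def)
  have "d \<le> 4" using y0(1) by (simp add: d_def p_def dist_norm norm_minus_commute)
  have "d \<noteq> 4"
  proof
    assume "d = 4"
    define P where "P = (4::real) ^ Suc m"
    have P: "P > 0" "(4::real) ^ Suc (Suc m) = 4 * P" by (simp_all add: P_def)
    have "c * 4 ^ Suc (Suc m) = 4 / ?q" unfolding P(2) c_def P_def[symmetric] using P(1) by simp
    also have "\<dots> \<le> 2" by (simp add: field_simps)
    finally have "c * 4 ^ Suc (Suc m) \<le> 2" .
    then have "F y0 \<ge> 0" using \<open>d = 4\<close> nonneg[of y0] ux by (simp add: F_def d_def p_def)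
    then show False using \<open>F y0 < 0\<close> by simp
  qed
  then have d4: "d < 4" using \<open>d \<le> 4\<close> by simp
  define e where "e = (1 / d) *\<^sub>R p"
  have e: "norm e = 1" using d0 by (simp add: e_def d_def)
  have ep: "p \<bullet> v = d * (e \<bullet> v)" for v using d0 by (simp add: e_def)
  define w where "w = c * ?q * d ^ Suc m"
  have w: "w = (d / 4) ^ Suc m" by (simp add: w_def c_def power_divide)
  have w0: "0 < w" "w < 1"
    unfolding w using d0 d4 by (auto simp: power_less_one_iff simp del: power_Suc)
  have key: "grad u y0 \<bullet> v = - (1 - w) * (e \<bullet> v)
      \<and> - (1 - w) * ((norm v)^2 - (e \<bullet> v)\<^sup>2) / d + (real (Suc m) * w / d) * (e \<bullet> v)^2 \<le> v \<bullet> (hess u y0 *v v)" for v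
  proof -
    define R where "R = (\<lambda>t. sqrt (0 + (norm (p + t *\<^sub>R v))^2))"
    have R: "R t = norm (p + t *\<^sub>R v)" for t by (simp add: R_def)
    have Rf: "sqrt (0 + (norm (p + t *\<^sub>R v))^2) = R t" for t by (simp add: R_def)
    have pos: "0 + (norm p)^2 > 0" using d0 by (simp add: d_def)
    define K where "K = (\<lambda>t. ((p + t *\<^sub>R v) \<bullet> v) / R t)"
    obtain r where r: "r > 0" "\<And>t. \<bar>t\<bar> < r \<Longrightarrow> R t > 0 \<and> (R has_real_derivative K t) (at t)"
      using sqrt_line(1)[OF pos, of v] unfolding Rf K_def by blast
    have dK: "(K has_real_derivative ((norm v)^2 - ((p \<bullet> v) / R 0)\<^sup>2) / R 0) (at 0)"
      using sqrt_line(2)[OF pos, of v] unfolding Rf K_def by blast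
    have R0: "R 0 = d" by (simp add: R d_def)
    have K0: "K 0 = e \<bullet> v" using d0 by (simp add: K_def R0 ep)
    \<comment> \<open>Small enough for the line to stay inside the ball of radius \<open>4\<close>, where \<open>y0\<close> is a minimum.\<close>
    define r' where "r' = min r ((4 - d) / (norm v + 1))"
    have r': "r' > 0" using r d4 by (auto simp: r'_def intro!: divide_pos_pos add_nonneg_pos)
    define f where "f = (\<lambda>t. u (y0 + t *\<^sub>R v) - u x + R t - c * R t ^ Suc (Suc m))"
    define f' where "f' = (\<lambda>t. grad u (y0 + t *\<^sub>R v) \<bullet> v + K t - c * (?q * R t ^ Suc m * K t))"
    have fF: "f t = F (y0 + t *\<^sub>R v)" for t
      by (simp add: f_def F_def R p_def algebra_simps)
    have "(f has_real_derivative f' t) (at t)" if "\<bar>t\<bar> < r'" for t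
    proof -
      have dR: "(R has_real_derivative K t) (at t)" using r(2) that by (simp add: r'_def)
      show ?thesis unfolding f_def f'_def
        by (rule derivative_eq_intros C2_line_derivative[OF u] dR refl)+ (simp add: algebra_simps)
    qed
    moreover have "(f' has_real_derivative
       (hess u y0 *v v) \<bullet> v + ((norm v)^2 - (e \<bullet> v)\<^sup>2) / d
         - c * (?q * (real (Suc m) * d ^ m * (e \<bullet> v)^2 + d ^ Suc m * (((norm v)^2 - (e \<bullet> v)\<^sup>2) / d)))) (at 0)"
    proof -
      have dR: "(R has_real_derivative e \<bullet> v) (at 0)" using r(2)[of 0] r(1) K0 by simp
      have dK': "(K has_real_derivative ((norm v)^2 - (e \<bullet> v)\<^sup>2) / d) (at 0)"
        using dK d0 by (simp add: R0 ep)
      have dH: "((\<lambda>t. grad u (y0 + t *\<^sub>R v) \<bullet> v) has_real_derivative (hess u y0 *v v) \<bullet> v) (at 0)"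
        using C2_line_second_derivative[OF u, of y0 v v 0] by simp
      have "((\<lambda>t. grad u (y0 + t *\<^sub>R v) \<bullet> v + K t - c * (?q * (R t ^ Suc m * K t))) has_real_derivative
        (hess u y0 *v v) \<bullet> v + ((norm v)^2 - (e \<bullet> v)\<^sup>2) / d
         - c * (?q * (real (Suc m) * (e \<bullet> v) * R 0 ^ m * K 0 + (((norm v)^2 - (e \<bullet> v)\<^sup>2) / d) * R 0 ^ Suc m))) (at 0)"
        using DERIV_mult[OF DERIV_power_Suc[OF dR, of m] dK']
        by (intro DERIV_diff DERIV_add dH dK' DERIV_cmult) (simp add: algebra_simps)
      then show ?thesis unfolding f'_def
        by (simp add: R0 K0 power2_eq_square algebra_simps)
    qed
    moreover have "f 0 \<le> f t" if "\<bar>t\<bar> < r'" for t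
    proof -
      have "norm (y0 + t *\<^sub>R v - x) \<le> d + \<bar>t\<bar> * norm v"
        using norm_triangle_ineq[of p "t *\<^sub>R v"] by (simp add: p_def d_def algebra_simps)
      also have "\<bar>t\<bar> * norm v \<le> \<bar>t\<bar> * (norm v + 1)" by (simp add: mult_left_mono)
      also have "\<dots> \<le> r' * (norm v + 1)" by (rule mult_right_mono) (use that in auto)
      also have "\<dots> \<le> (4 - d) / (norm v + 1) * (norm v + 1)"
        by (rule mult_right_mono) (auto simp: r'_def)
      also have "\<dots> = 4 - d" using norm_ge_zero[of v] by (simp add: add_nonneg_eq_0_iff)
      finally have "y0 + t *\<^sub>R v \<in> cball x 4" by (simp add: dist_norm norm_minus_commute)
      then show ?thesis using y0(2) by (simp add: fF)
    qed
    ultimately have t: "f' 0 = 0"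
       "0 \<le> (hess u y0 *v v) \<bullet> v + ((norm v)^2 - (e \<bullet> v)\<^sup>2) / d
         - c * (?q * (real (Suc m) * d ^ m * (e \<bullet> v)^2 + d ^ Suc m * (((norm v)^2 - (e \<bullet> v)\<^sup>2) / d)))"
      using second_derivative_test[OF r', of f f'] by blast+
    have "f' 0 = grad u y0 \<bullet> v + (1 - w) * (e \<bullet> v)"
      unfolding f'_def K0 by (simp add: R0 w_def algebra_simps)
    then have 1: "grad u y0 \<bullet> v = - (1 - w) * (e \<bullet> v)" using t(1) by (simp add: algebra_simps)
    have cd: "c * ?q * d ^ m = w / d" using d0 by (simp add: w_def)
    have "c * (q * (M * D * E + D' * X)) = M * (c * q * D) * E + (c * q * D') * X" for q M D E D' X :: real
      by (simp add: algebra_simps)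
    then have "c * (?q * (real (Suc m) * d ^ m * (e \<bullet> v)^2 + d ^ Suc m * (((norm v)^2 - (e \<bullet> v)\<^sup>2) / d)))
       = real (Suc m) * (w / d) * (e \<bullet> v)^2 + w * (((norm v)^2 - (e \<bullet> v)\<^sup>2) / d)"
      unfolding cd[symmetric] unfolding w_def .
    note t2 = t(2)[unfolded this]
    have a: "- (1 - w) * X / d = w * (X / d) - X / d" for X
      by (simp add: algebra_simps diff_divide_distrib)
    have b: "(real (Suc m) * w / d) * E = real (Suc m) * (w / d) * E" for E by simp
    have "- (1 - w) * ((norm v)^2 - (e \<bullet> v)\<^sup>2) / d + (real (Suc m) * w / d) * (e \<bullet> v)^2 \<le> v \<bullet> (hess u y0 *v v)"
      using t2 unfolding inner_commute[of "hess u y0 *v v"] a b by linarith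
    with 1 show ?thesis by blast
  qed
  have "grad u y0 \<bullet> v = ((- (1 - w)) *\<^sub>R e) \<bullet> v" for v
    using conjunct1[OF key[of v]] by (simp only: inner_scaleR_left)
  then have "grad u y0 = (- (1 - w)) *\<^sub>R e"
    using vector_eq_rdot by blast
  moreover have "(real (Suc m) * w / d) * (e \<bullet> v)^2 - (1 - w) / d * ((norm v)^2 - (e \<bullet> v)\<^sup>2) \<le> v \<bullet> (hess u y0 *v v)" for v
  proof -
    have "(1 - w) / d * X = - (- (1 - w) * X / d)" for X
      by (simp add: algebra_simps diff_divide_distrib)
    then show ?thesis using key[of v] by (simp only:) linarith
  qed
  ultimately have tr: "sigma_op (Suc 0) (sym_shape u y0) \<le>
     - Wfun u y0 * ((real (Suc m) * w / d) / (1 - (1 - w)\<^sup>2) - (1 - w) / d * (real CARD('n) - 1))"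
    using w0 by (intro trace_radial_bound[OF u e]) simp_all
  have W: "Wfun u y0 > 0"
    using sp[of y0] by (simp add: Wfun_eq abs_square_less_1)
  have "(1 - w) / d * (real CARD('n) - 1) < (real (Suc m) * w / d) / (1 - (1 - w)\<^sup>2)"
  proof -
    have sq: "1 - (1 - w)\<^sup>2 = w * (2 - w)" by (simp add: power2_eq_square algebra_simps)
    have sm: "real (Suc m) = 2 * real CARD('n) - 1" using n1 by (simp add: m of_nat_diff)
    have "(1 - w) * (real CARD('n) - 1) \<le> real CARD('n) - 1"
      using w0 n1 by (simp add: mult_left_le_one_le)
    also have "\<dots> < real (Suc m) / 2" unfolding sm by simp
    also have "\<dots> \<le> real (Suc m) / (2 - w)"
      by (rule divide_left_mono) (use w0 in auto)
    finally have "(1 - w) * (real CARD('n) - 1) < real (Suc m) / (2 - w)" .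
    then have "(1 - w) * (real CARD('n) - 1) / d < real (Suc m) / (2 - w) / d"
      using d0 by (rule divide_strict_right_mono)
    moreover have "(M * w / d) / (w * (2 - w)) = M / (2 - w) / d" for M
      using w0 by (simp add: divide_divide_eq_left mult.commute mult.left_commute)
    moreover have "(1 - w) / d * X = (1 - w) * X / d" for X by simp
    ultimately show ?thesis unfolding sq by (simp only:)
  qed
  then have "0 < Wfun u y0 * ((real (Suc m) * w / d) / (1 - (1 - w)\<^sup>2) - (1 - w) / d * (real CARD('n) - 1))"
    by (intro mult_pos_pos W) linarith
  then have "sigma_op (Suc 0) (sym_shape u y0) < 0" using tr by linarith
  then show False using mean[of y0] by simp
qed

section \<open>The height bound\<close>

text \<open>
  A minimum of \<open>u + sqrt (r\<^sup>2 + |\<cdot> - x|\<^sup>2)\<close> exists because \<open>u \<ge> 0\<close>. There the Hessian of \<open>u\<close> is bounded below by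
  that of the hyperboloid, all of whose principal curvatures are \<open>1/r\<close>.
\<close>

lemma hyperboloid_touching_from_below:
  fixes u :: "real^'n \<Rightarrow> real"
  assumes u: "C2 u" and sp: "\<And>x. norm (grad u x) < 1" and nonneg: "\<And>x. 0 \<le> u x" and r: "r > 0"
  shows "\<exists>y. (\<forall>z. u y + sqrt (r^2 + (norm (y - x))^2) \<le> u z + sqrt (r^2 + (norm (z - x))^2))
     \<and> (\<forall>z. z \<bullet> (sym_shape u y *v z) \<le> 1 / r * (norm z)^2)"
proof -
  let ?F = "\<lambda>z. u z + sqrt (r^2 + (norm (z - x))^2)"
  let ?B = "cball x (?F x)"
  have "?F x \<ge> 0" using nonneg[of x] r by simp
  then have ne: "?B \<noteq> {}" by simp
  have cont: "continuous_on ?B ?F" by (intro continuous_intros C2_continuous_on[OF u])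
  obtain y where y: "y \<in> ?B" "\<And>z. z \<in> ?B \<Longrightarrow> ?F y \<le> ?F z"
    using continuous_attains_inf[OF compact_cball ne cont] by blast
  have min: "?F y \<le> ?F z" for z
  proof (cases "z \<in> ?B")
    case False
    have "?F y \<le> ?F x" using y(2)[of x] \<open>?F x \<ge> 0\<close> by simp
    also have "\<dots> \<le> norm (z - x)" using False by (simp add: dist_norm norm_minus_commute)
    also have "\<dots> \<le> sqrt (r^2 + (norm (z - x))^2)" by (rule real_le_rsqrt) simp
    also have "\<dots> \<le> ?F z" using nonneg by simp
    finally show ?thesis .
  qed (rule y)
  define p where "p = y - x"
  define s where "s = sqrt (r^2 + (norm p)^2)"
  have pos: "r^2 + (norm p)^2 > 0" using r by (intro add_pos_nonneg) auto
  have s0: "s > 0" using pos by (simp add: s_def)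
  have s2: "s^2 = r^2 + (norm p)^2" by (simp add: s_def)
  have key: "grad u y \<bullet> v = - (p \<bullet> v) / s
     \<and> - ((norm v)^2 - ((p \<bullet> v) / s)\<^sup>2) / s \<le> v \<bullet> (hess u y *v v)" for v
  proof -
    define R where "R = (\<lambda>t. sqrt (r^2 + (norm (p + t *\<^sub>R v))^2))"
    have Rf: "sqrt (r^2 + (norm (p + t *\<^sub>R v))^2) = R t" for t by (simp add: R_def)
    let ?K = "\<lambda>t. ((p + t *\<^sub>R v) \<bullet> v) / R t"
    obtain r' where r': "r' > 0" "\<And>t. \<bar>t\<bar> < r' \<Longrightarrow> R t > 0 \<and> (R has_real_derivative ?K t) (at t)"
      using sqrt_line(1)[OF pos, of v] unfolding Rf by blast
    have R0: "R 0 = s" by (simp add: R_def s_def)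
    have dK: "(?K has_real_derivative ((norm v)^2 - ((p \<bullet> v) / s)\<^sup>2) / s) (at 0)"
      using sqrt_line(2)[OF pos, of v] unfolding Rf R0 by blast
    let ?f = "\<lambda>t. u (y + t *\<^sub>R v) + R t" and ?f' = "\<lambda>t. grad u (y + t *\<^sub>R v) \<bullet> v + ?K t"
    have "(?f has_real_derivative ?f' t) (at t)" if "\<bar>t\<bar> < r'" for t
      using r'(2)[OF that] by (intro DERIV_add C2_line_derivative[OF u]) auto
    moreover have "(?f' has_real_derivative (hess u y *v v) \<bullet> v + ((norm v)^2 - ((p \<bullet> v) / s)\<^sup>2) / s) (at 0)"
      using C2_line_second_derivative[OF u, of y v v 0] by (intro DERIV_add dK) simp
    moreover have "?f 0 \<le> ?f t" for t
      using min[of "y + t *\<^sub>R v"] by (simp add: R_def p_def algebra_simps)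
    ultimately have f1: "?f' 0 = 0" and f2: "0 \<le> (hess u y *v v) \<bullet> v + ((norm v)^2 - ((p \<bullet> v) / s)\<^sup>2) / s"
      using second_derivative_test[OF r'(1), of ?f ?f'] by blast+
    have neg: "- X / s = - (X / s)" for X by simp
    have "grad u y \<bullet> v + (p \<bullet> v) / s = 0" using f1 by (simp add: R0)
    then show ?thesis
      using f2 unfolding neg inner_commute[of "hess u y *v v"] by linarith
  qed
  have "grad u y \<bullet> v = ((- 1 / s) *\<^sub>R p) \<bullet> v" for v
    using conjunct1[OF key[of v]] by simp
  then have D: "grad u y = (- 1 / s) *\<^sub>R p"
    using vector_eq_rdot by blast
  have "1 - (norm (grad u y))\<^sup>2 = (r / s)^2"
  proof -
    have "(norm (grad u y))^2 = (norm p)^2 / s^2" using s0 by (simp add: D power_divide)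
    moreover have "1 = (r^2 + (norm p)^2) / s^2" using s0 by (simp add: s2[symmetric])
    ultimately show ?thesis by (simp add: power_divide add_divide_distrib)
  qed
  then have W: "Wfun u y = s / r"
    using r s0 by (simp add: Wfun_eq[OF sp] real_sqrt_unique)
  have "z \<bullet> (sym_shape u y *v z) \<le> 1 / r * (norm z)^2" for z
  proof -
    let ?z = "frame (grad u y) z"
    have "((p \<bullet> ?z) / s)^2 = (grad u y \<bullet> ?z)^2" by (simp add: D power2_eq_square)
    have "- ((norm z)^2) / s \<le> ?z \<bullet> (hess u y *v ?z)"
    proof -
      have "(norm z)^2 = (norm ?z)^2 - ((p \<bullet> ?z) / s)\<^sup>2"
        unfolding \<open>((p \<bullet> ?z) / s)\<^sup>2 = (grad u y \<bullet> ?z)^2\<close> by (rule norm_frame_spacelike[OF sp, symmetric])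
      then show ?thesis using conjunct2[OF key[of ?z]] by (simp only:)
    qed
    then have "- (s / r) * (?z \<bullet> (hess u y *v ?z)) \<le> - (s / r) * (- ((norm z)^2) / s)"
      by (rule mult_left_mono_neg) (use r s0 in simp)
    then show ?thesis unfolding sym_shape_quadratic_form W using s0 by simp
  qed
  with min show ?thesis by blast
qed

definition entire_solution :: "nat \<Rightarrow> real \<Rightarrow> (real^'n \<Rightarrow> real) \<Rightarrow> bool" where
  "entire_solution k p u \<longleftrightarrow> C2 u \<and>
       (\<forall>x. sigma_op k (shape_operator u x) = u x powr p) \<and>
       (\<forall>x. u x \<ge> 0) \<and>
       (\<forall>x. norm (grad u x) < 1) \<and>
       (\<forall>x. eigenvalues (shape_operator u x) \<in> closure (garding_cone k))"

lemma entire_solutionD: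
  assumes "entire_solution k p u"
  shows "C2 u" "norm (grad u x) < 1" "0 \<le> u x"
    "in_cone k (sym_shape u x)" "sigma_op k (sym_shape u x) = u x powr p"
proof -
  show C: "C2 u" and n: "norm (grad u x) < 1" and "0 \<le> u x"
    using assms by (auto simp: entire_solution_def)
  have "eigenvalues (shape_operator u x) \<in> closure (garding_cone k)"
    using assms by (simp add: entire_solution_def)
  then show "in_cone k (sym_shape u x)"
    using garding_closure_esym_nonneg sym_shape_symmetric[OF C]
    unfolding in_cone_def sigma_op_shape_operator[OF n, symmetric] by (auto simp: sigma_op_def)
  show "sigma_op k (sym_shape u x) = u x powr p"
    using assms unfolding sigma_op_shape_operator[OF n, symmetric] by (simp add: entire_solution_def)
qed

text \<open>
  The radius \<open>r\<close> makes the contact value \<open>u y\<close> at most \<open>1\<close>. At the point \<open>z\<close> at distance \<open>1\<close> from \<open>y\<close> towards \<open>x\<close>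
  the hyperboloid lies above \<open>u y\<close> by at least \<open>1 - r\<^sup>2/(2(d - 1))\<close>, where \<open>d = |x - y|\<close>, while the steep cone
  estimate permits a rise of at most \<open>1 - c\<close>. This bounds \<open>d\<close>, and \<open>u x \<le> u y + d\<close>.
\<close>

theorem entire_solution_bounded:
  fixes k :: nat and p :: real
  assumes k: "1 \<le> k" and p: "p > 0"
  shows "\<exists>U>0. \<forall>u :: real^'n \<Rightarrow> real. entire_solution k p u \<longrightarrow> (\<forall>x. u x \<le> U)"
proof -
  let ?n = "real CARD('n)" and ?C = "real (CARD('n) choose k)"
  \<comment> \<open>With this radius the bound \<open>C (n/r)\<^sup>k\<close> for \<open>u y powr p\<close> is at most \<open>C/(C + 1)\<close>.\<close>
  define r where "r = ?n * (?C + 1)"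
  define m where "m = 2 * CARD('n) - 2"
  define c where "c = 1 / (real (Suc (Suc m)) * 4 ^ Suc m)"
  have n0: "?n > 0" by simp
  have r0: "r > 0" by (simp add: r_def)
  have c0: "c > 0" by (simp add: c_def)
  define U where "U = 2 + r^2 / (2 * c)"
  have "u x \<le> U" if S: "entire_solution k p u" for u :: "real^'n \<Rightarrow> real" and x
  proof -
    note E = entire_solutionD[OF S]
    obtain y where ymin: "\<And>z. u y + sqrt (r^2 + (norm (y - x))^2) \<le> u z + sqrt (r^2 + (norm (z - x))^2)"
      and yS: "\<And>z. z \<bullet> (sym_shape u y *v z) \<le> 1 / r * (norm z)^2"
      using hyperboloid_touching_from_below[OF E(1,2,3) r0, of x] by blast
    have mean: "0 \<le> sigma_op (Suc 0) (sym_shape u z)" for z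
      using E(4) k by (auto simp: in_cone_def)
    have "u y powr p \<le> ?C * (?n * (1 / r)) ^ k"
      unfolding E(5)[symmetric]
      by (rule sigma_op_le_of_quadratic_form_le[OF sym_shape_symmetric[OF E(1)] mean _ yS]) (use r0 in simp)
    also have "?n * (1 / r) = 1 / (?C + 1)" using n0 by (simp add: r_def)
    also have "(1 / (?C + 1)) ^ k \<le> (1 / (?C + 1)) ^ 1"
      by (rule power_decreasing) (use k in auto)
    then have "?C * (1 / (?C + 1)) ^ k \<le> ?C * (1 / (?C + 1))"
      by (intro mult_left_mono) auto
    also have "\<dots> \<le> 1" by (simp add: field_simps)
    finally have "u y powr p \<le> 1" .
    have uy: "u y \<le> 1"
    proof (rule ccontr)
      assume "\<not> u y \<le> 1"
      then have "1 powr p < u y powr p" using p by (intro powr_less_mono2) auto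
      then show False using \<open>u y powr p \<le> 1\<close> by simp
    qed
    define d where "d = norm (y - x)"
    have lip: "u x \<le> 1 + d"
      using spacelike_lipschitz[OF E(1,2), of x y] uy by (simp add: d_def norm_minus_commute)
    have "d \<le> 1 + r^2 / (2 * c)"
    proof (rule ccontr)
      assume "\<not> ?thesis"
      then have d: "d > 1 + r^2 / (2 * c)" by simp
      have d1: "d > 1" using d c0 r0 by (smt (verit) divide_pos_pos zero_less_power)
      define z where "z = y + (1 / d) *\<^sub>R (x - y)"
      have "norm (z - y) = (1 / d) * d" using d1 by (simp add: z_def d_def norm_minus_commute)
      then have zy: "norm (z - y) = 1" using d1 by simp
      have "z - x = (1 - 1 / d) *\<^sub>R (y - x)" by (simp add: z_def algebra_simps)
      then have "norm (z - x) = \<bar>1 - 1 / d\<bar> * d" by (simp only: norm_scaleR d_def)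
      then have zx: "norm (z - x) = d - 1"
        using d1 by (simp add: algebra_simps)
      have "u z \<le> 2" using spacelike_lipschitz[OF E(1,2), of z y] zy uy by simp
      from steep_cone_lower_bound[OF E(1,2,3) mean this _ m_def, of y]
      have "u z - 1 + c \<le> u y" using zy by (simp add: norm_minus_commute c_def)
      moreover have "u y + sqrt (r^2 + d^2) \<le> u z + sqrt (r^2 + (d - 1)^2)"
        using ymin[of z] by (simp add: zx d_def)
      moreover have "d \<le> sqrt (r^2 + d^2)" by (rule real_le_rsqrt) simp
      moreover have "sqrt (r^2 + (d - 1)^2) \<le> (d - 1) + r^2 / (2 * (d - 1))"
      proof (rule real_le_lsqrt)
        have "((d - 1) + r^2 / (2 * (d - 1)))^2 = (d - 1)^2 + r^2 + (r^2 / (2 * (d - 1)))^2"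
          using d1 by (simp add: power2_sum)
        then show "r^2 + (d - 1)^2 \<le> ((d - 1) + r^2 / (2 * (d - 1)))^2" by simp
      qed (use d1 in simp)
      ultimately have "c \<le> r^2 / (2 * (d - 1))" by linarith
      then have "c * (2 * (d - 1)) \<le> r^2" using d1 by (simp add: field_simps)
      moreover have "r^2 < c * (2 * (d - 1))" using d c0 by (simp add: field_simps)
      ultimately show False by linarith
    qed
    then show ?thesis using lip by (simp add: U_def)
  qed
  moreover have "U > 0" using c0 by (simp add: U_def add_pos_nonneg)
  ultimately show ?thesis by blast
qed

section \<open>Second-order conditions at a doubled maximum\<close>

text \<open>
  First and second order conditions along a line with independent velocities \<open>v\<close> at \<open>x\<close> and \<open>w\<close> at \<open>y\<close>. Only the
  part of \<open>v - w\<close> orthogonal to \<open>e\<close> costs anything in the second derivative of the distance.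
\<close>

lemma doubling_conditions:
  fixes u :: "real^'n \<Rightarrow> real" and G g g2 :: "real \<Rightarrow> real"
  assumes u: "C2 u" and nonneg: "\<And>x. 0 \<le> u x"
    and dG: "\<And>t. t \<ge> 0 \<Longrightarrow> (G has_real_derivative g t) (at t)"
    and dg: "\<And>t. t \<ge> 0 \<Longrightarrow> (g has_real_derivative g2 t) (at t)"
    and xy: "x \<noteq> y"
    and max: "\<And>x' y'. G (u x') - G (u y') - norm (x' - y') - eps * (norm x')^2
        \<le> G (u x) - G (u y) - norm (x - y) - eps * (norm x)^2"
  defines "d \<equiv> norm (x - y)" and "e \<equiv> (1 / norm (x - y)) *\<^sub>R (x - y)"
  shows "g (u x) *\<^sub>R grad u x = e + (2 * eps) *\<^sub>R x"
    and "g (u y) *\<^sub>R grad u y = e"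
    and "g (u x) * (v \<bullet> (hess u x *v v)) + g2 (u x) * (grad u x \<bullet> v)^2 - 2 * eps * (norm v)^2
       - g (u y) * (w \<bullet> (hess u y *v w)) - g2 (u y) * (grad u y \<bullet> w)^2
       \<le> ((norm (v - w))^2 - (e \<bullet> (v - w))\<^sup>2) / d"
proof -
  have d0: "d > 0" using xy by (simp add: d_def)
  have key: "g (u x) * (grad u x \<bullet> v) - g (u y) * (grad u y \<bullet> w) - e \<bullet> (v - w) - 2 * eps * (x \<bullet> v) = 0
    \<and> g (u x) * (v \<bullet> (hess u x *v v)) + g2 (u x) * (grad u x \<bullet> v)^2 - 2 * eps * (norm v)^2
       - g (u y) * (w \<bullet> (hess u y *v w)) - g2 (u y) * (grad u y \<bullet> w)^2
       \<le> ((norm (v - w))^2 - (e \<bullet> (v - w))\<^sup>2) / d" for v w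
  proof -
    define z where "z = v - w"
    define R where "R = (\<lambda>t. sqrt (0 + (norm ((x - y) + t *\<^sub>R z))^2))"
    have R: "R t = norm ((x - y) + t *\<^sub>R z)" for t by (simp add: R_def)
    have Rf: "sqrt (0 + (norm ((x - y) + t *\<^sub>R z))^2) = R t" for t by (simp add: R_def)
    have pos: "0 + (norm (x - y))^2 > 0" using xy by simp
    define K where "K = (\<lambda>t. (((x - y) + t *\<^sub>R z) \<bullet> z) / R t)"
    obtain r where r: "r > 0" "\<And>t. \<bar>t\<bar> < r \<Longrightarrow> R t > 0 \<and> (R has_real_derivative K t) (at t)"
      using sqrt_line(1)[OF pos, of z] unfolding Rf K_def by blast
    have R0: "R 0 = d" by (simp add: R d_def)
    have ez: "((x - y) \<bullet> z) / d = e \<bullet> z" by (simp add: e_def d_def)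
    have dK: "(K has_real_derivative ((norm z)^2 - (e \<bullet> z)\<^sup>2) / d) (at 0)"
      using sqrt_line(2)[OF pos, of z] unfolding Rf K_def R0 ez .
    have K0: "K 0 = e \<bullet> z" using ez by (simp add: K_def R0)
    define N where "N = (\<lambda>t. (norm (x + t *\<^sub>R v))\<^sup>2)"
    define N' where "N' = (\<lambda>t. 2 * (x \<bullet> v) + 2 * t * (v \<bullet> v))"
    have N: "N = (\<lambda>t. x \<bullet> x + 2 * t * (x \<bullet> v) + t^2 * (v \<bullet> v))"
      unfolding N_def power2_norm_eq_inner
      by (simp add: fun_eq_iff inner_add_left inner_add_right inner_commute power2_eq_square algebra_simps)
    have dN: "(N has_real_derivative N' t) (at t)" for t
      unfolding N N'_def by (auto intro!: derivative_eq_intros)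
    have dN': "(N' has_real_derivative 2 * (v \<bullet> v)) (at 0)"
      unfolding N'_def by (auto intro!: derivative_eq_intros)
    define a where "a = (\<lambda>t. u (x + t *\<^sub>R v))"
    define b where "b = (\<lambda>t. u (y + t *\<^sub>R w))"
    define a' where "a' = (\<lambda>t. grad u (x + t *\<^sub>R v) \<bullet> v)"
    define b' where "b' = (\<lambda>t. grad u (y + t *\<^sub>R w) \<bullet> w)"
    have da: "(a has_real_derivative a' t) (at t)" and db: "(b has_real_derivative b' t) (at t)" for t
      unfolding a_def a'_def b_def b'_def by (rule C2_line_derivative[OF u])+
    have da': "(a' has_real_derivative (hess u x *v v) \<bullet> v) (at 0)"
      and db': "(b' has_real_derivative (hess u y *v w) \<bullet> w) (at 0)"
      using C2_line_second_derivative[OF u, of x v v 0] C2_line_second_derivative[OF u, of y w w 0]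
      by (simp_all add: a'_def b'_def)
    have ab0: "a t \<ge> 0" "b t \<ge> 0" for t using nonneg by (simp_all add: a_def b_def)
    define f where "f = (\<lambda>t. R t + eps * N t - (G (a t) - G (b t)))"
    define f' where "f' = (\<lambda>t. K t + eps * N' t - (g (a t) * a' t - g (b t) * b' t))"
    have "(f has_real_derivative f' t) (at t)" if "\<bar>t\<bar> < r" for t
      unfolding f_def f'_def
      using DERIV_chain2[OF dG[OF ab0(1)] da] DERIV_chain2[OF dG[OF ab0(2)] db] r(2)[OF that]
      by (intro DERIV_diff DERIV_add DERIV_cmult dN) auto
    moreover have "(f' has_real_derivative ((norm z)^2 - (e \<bullet> z)\<^sup>2) / d + eps * (2 * (v \<bullet> v))
        - ((g2 (a 0) * a' 0 * a' 0 + (hess u x *v v) \<bullet> v * g (a 0))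
           - (g2 (b 0) * b' 0 * b' 0 + (hess u y *v w) \<bullet> w * g (b 0)))) (at 0)"
      unfolding f'_def
      using DERIV_mult[OF DERIV_chain2[OF dg[OF ab0(1)] da] da'] DERIV_mult[OF DERIV_chain2[OF dg[OF ab0(2)] db] db']
      by (intro DERIV_diff DERIV_add DERIV_cmult dN' dK) auto
    moreover have "f 0 \<le> f t" for t
    proof -
      have xyz: "(x + t *\<^sub>R v) - (y + t *\<^sub>R w) = (x - y) + t *\<^sub>R z"
        by (simp add: z_def algebra_simps)
      show ?thesis using max[of "x + t *\<^sub>R v" "y + t *\<^sub>R w"]
        unfolding xyz f_def R N_def a_def b_def by simp
    qed
    ultimately have f1: "f' 0 = 0" and f2: "0 \<le> ((norm z)^2 - (e \<bullet> z)\<^sup>2) / d + eps * (2 * (v \<bullet> v))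
        - ((g2 (a 0) * a' 0 * a' 0 + (hess u x *v v) \<bullet> v * g (a 0))
           - (g2 (b 0) * b' 0 * b' 0 + (hess u y *v w) \<bullet> w * g (b 0)))"
      using second_derivative_test[OF r(1), of f f'] by blast+
    have v0: "a 0 = u x" "b 0 = u y" "a' 0 = grad u x \<bullet> v" "b' 0 = grad u y \<bullet> w"
      by (simp_all add: a_def b_def a'_def b'_def)
    have 1: "g (u x) * (grad u x \<bullet> v) - g (u y) * (grad u y \<bullet> w) - e \<bullet> z - 2 * eps * (x \<bullet> v) = 0"
      using f1 unfolding f'_def K0 v0 N'_def by (simp add: algebra_simps)
    have 2: "g (u x) * (v \<bullet> (hess u x *v v)) + g2 (u x) * (grad u x \<bullet> v)^2 - 2 * eps * (norm v)^2
       - g (u y) * (w \<bullet> (hess u y *v w)) - g2 (u y) * (grad u y \<bullet> w)^2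
       \<le> ((norm z)^2 - (e \<bullet> z)\<^sup>2) / d"
      using f2 unfolding v0 power2_norm_eq_inner[of v] inner_commute[of "hess u x *v v"] inner_commute[of "hess u y *v w"]
      by (simp add: power2_eq_square algebra_simps)
    show ?thesis using 1 2 unfolding z_def by blast
  qed
  show "g (u x) * (v \<bullet> (hess u x *v v)) + g2 (u x) * (grad u x \<bullet> v)^2 - 2 * eps * (norm v)^2
       - g (u y) * (w \<bullet> (hess u y *v w)) - g2 (u y) * (grad u y \<bullet> w)^2
       \<le> ((norm (v - w))^2 - (e \<bullet> (v - w))\<^sup>2) / d"
    using key by blast
  have "(g (u x) *\<^sub>R grad u x) \<bullet> v = (e + (2 * eps) *\<^sub>R x) \<bullet> v" for v
    using conjunct1[OF key[of v 0]] by (simp add: inner_add_left)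
  then show "g (u x) *\<^sub>R grad u x = e + (2 * eps) *\<^sub>R x" using vector_eq_rdot by blast
  have "(g (u y) *\<^sub>R grad u y) \<bullet> w = e \<bullet> w" for w
    using conjunct1[OF key[of 0 w]] by (simp add: inner_diff_right)
  then show "g (u y) *\<^sub>R grad u y = e" using vector_eq_rdot by blast
qed

text \<open>
  The second order condition with \<open>v\<close> and \<open>w\<close> the images of the same \<open>z\<close> in the two frames. Both frames
  stretch a single direction, \<open>e + p\<close> and \<open>e\<close> respectively, so \<open>v - w\<close> is parallel to \<open>e\<close> up to a multiple of
  \<open>p\<close> and costs only \<open>O(|p|\<^sup>2)\<close>. The remaining terms compare the two matrices up to the factor
  \<open>sqrt Ny / sqrt Nx\<close>, which is the ratio of \<open>W/g\<close> at the two points. The bound on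
  \<open>e \<bullet> S\<^sub>y e\<close> is the case \<open>v = 0\<close> with \<open>w\<close> parallel to \<open>e\<close>.
\<close>

lemma shape_comparison:
  fixes u :: "real^'n \<Rightarrow> real" and gx gy ax ay :: real
  assumes sp: "norm (grad u x) < 1" "norm (grad u y) < 1"
    and e: "norm e = 1" and d: "d > 0" and eps: "eps \<ge> 0"
    and g: "1 \<le> gx" "gx \<le> 2" "1 \<le> gy" and a: "0 \<le> ax" "0 \<le> ay"
    and p: "norm p \<le> 1"
    and Dx: "gx *\<^sub>R grad u x = e + p" and Dy: "gy *\<^sub>R grad u y = e"
    and H: "\<And>v w. gx * (v \<bullet> (hess u x *v v)) - ax * (grad u x \<bullet> v)^2 - 2 * eps * (norm v)^2
       - gy * (w \<bullet> (hess u y *v w)) + ay * (grad u y \<bullet> w)^2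
       \<le> ((norm (v - w))^2 - (e \<bullet> (v - w))\<^sup>2) / d"
  defines "Nx \<equiv> gx\<^sup>2 - (norm (e + p))\<^sup>2" and "Ny \<equiv> gy\<^sup>2 - 1"
  shows "Nx > 0" "Ny > 0"
    and "e \<bullet> (sym_shape u y *v e) \<le> - (1 / sqrt Ny * (ay / Ny))"
    and "sqrt Ny / sqrt Nx * (z \<bullet> (sym_shape u y *v z) + 1 / sqrt Ny * (ay / Ny - ax / Nx) * (e \<bullet> z)^2
         - 1 / sqrt Ny * (2 * eps * (1 + 4 / Nx) + 4 * (norm p)^2 / (Nx^2 * d) + 3 * ax * norm p / Nx) * (norm z)^2)
       \<le> z \<bullet> (sym_shape u x *v z)"
proof -
  let ?Dx = "grad u x" and ?Dy = "grad u y"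
  have gx0: "gx > 0" and gy0: "gy > 0" using g by auto
  have nDx: "(norm ?Dx)^2 = (norm (e + p))^2 / gx^2"
    using arg_cong[OF Dx, of norm] gx0 by (simp add: field_simps power2_eq_square[symmetric] power_mult_distrib[symmetric] abs_of_pos)
  have nDy: "(norm ?Dy)^2 = 1 / gy^2"
  proof -
    have "gy * norm ?Dy = 1" using arg_cong[OF Dy, of norm] gy0 e by simp
    then have "norm ?Dy = 1 / gy" using gy0 by (simp add: field_simps)
    then show ?thesis by (simp add: power_divide)
  qed
  have sx: "1 - (norm ?Dx)\<^sup>2 = Nx / gx^2" using gx0 by (simp add: nDx Nx_def field_simps)
  have sy: "1 - (norm ?Dy)\<^sup>2 = Ny / gy^2" using gy0 by (simp add: nDy Ny_def field_simps)
  have "(norm ?Dx)^2 < 1" "(norm ?Dy)^2 < 1" using sp by (simp_all add: abs_square_less_1)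
  then have "0 < Nx / gx^2" "0 < Ny / gy^2" using sx sy by linarith+
  then show Nx: "Nx > 0" and Ny: "Ny > 0" using gx0 gy0 by (simp_all add: zero_less_divide_iff)
  have Wx: "Wfun u x = gx / sqrt Nx" unfolding Wfun_eq[OF sp(1)] sx using gx0 by (simp add: real_sqrt_divide)
  have Wy: "Wfun u y = gy / sqrt Ny" unfolding Wfun_eq[OF sp(2)] sy using gy0 by (simp add: real_sqrt_divide)
  have ex: "?Dx \<bullet> z = ((e + p) \<bullet> z) / gx" for z
  proof -
    have "gx * (?Dx \<bullet> z) = (e + p) \<bullet> z" unfolding Dx[symmetric] by simp
    then show ?thesis using gx0 by (simp add: field_simps)
  qed
  have ey: "?Dy \<bullet> z = (e \<bullet> z) / gy" for z
  proof -
    have "gy * (?Dy \<bullet> z) = e \<bullet> z" unfolding Dy[symmetric] by simp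
    then show ?thesis using gy0 by (simp add: field_simps)
  qed
  have DLx: "(?Dx \<bullet> frame ?Dx z)^2 = ((e + p) \<bullet> z)^2 / Nx" for z
  proof -
    have "?Dx \<bullet> frame ?Dx z = ((e + p) \<bullet> z) / sqrt Nx"
      using inner_frame[OF sp(1), of z] gx0 unfolding sx ex[of z] by (simp add: real_sqrt_divide)
    then show ?thesis using Nx by (simp add: power_divide)
  qed
  have DLy: "(?Dy \<bullet> frame ?Dy z)^2 = (e \<bullet> z)^2 / Ny" for z
  proof -
    have "?Dy \<bullet> frame ?Dy z = (e \<bullet> z) / sqrt Ny"
      using inner_frame[OF sp(2), of z] gy0 unfolding sy ey[of z] by (simp add: real_sqrt_divide)
    then show ?thesis using Ny by (simp add: power_divide)
  qed
  have "e \<bullet> (sym_shape u y *v e) = - (gy / sqrt Ny) * (frame ?Dy e \<bullet> (hess u y *v frame ?Dy e))"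
    unfolding sym_shape_quadratic_form Wy ..
  moreover have "ay * (1 / Ny) \<le> gy * (frame ?Dy e \<bullet> (hess u y *v frame ?Dy e))"
  proof -
    obtain c where "frame ?Dy e = c *\<^sub>R e"
    proof -
      have "?Dy = (1 / gy) *\<^sub>R e" unfolding Dy[symmetric] using gy0 by simp
      then have "frame ?Dy e = (1 + (1 / (1 - (norm ?Dy)\<^sup>2 + sqrt (1 - (norm ?Dy)\<^sup>2)) * (?Dy \<bullet> e)) * (1 / gy)) *\<^sub>R e"
        unfolding frame_def by (simp add: scaleR_left_distrib)
      then show ?thesis using that by blast
    qed
    then have "(norm (0 - frame ?Dy e))^2 - (e \<bullet> (0 - frame ?Dy e))\<^sup>2 = 0"
      using e by (simp add: power_mult_distrib power2_norm_eq_inner norm_eq_1)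
    then show ?thesis using H[of 0 "frame ?Dy e"] DLy[of e] e by (simp add: norm_eq_1)
  qed
  then have "1 / sqrt Ny * (ay * (1 / Ny)) \<le> 1 / sqrt Ny * (gy * (frame ?Dy e \<bullet> (hess u y *v frame ?Dy e)))"
    by (rule mult_left_mono) (use Ny in simp)
  ultimately show "e \<bullet> (sym_shape u y *v e) \<le> - (1 / sqrt Ny * (ay / Ny))" by simp
  let ?v = "frame ?Dx z" and ?w = "frame ?Dy z"
  have np2: "(norm p)^2 \<le> norm p" using p by (simp add: power2_eq_square mult_left_le)
  have epz: "((e + p) \<bullet> z)^2 \<le> (e \<bullet> z)^2 + 3 * norm p * (norm z)^2"
  proof -
    have ez: "\<bar>e \<bullet> z\<bar> \<le> norm z" using Cauchy_Schwarz_ineq2[of e z] e by simp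
    have pz: "\<bar>p \<bullet> z\<bar> \<le> norm p * norm z" by (rule Cauchy_Schwarz_ineq2)
    have "(e \<bullet> z) * (p \<bullet> z) \<le> \<bar>e \<bullet> z\<bar> * \<bar>p \<bullet> z\<bar>" by (simp add: abs_mult[symmetric])
    also have "\<dots> \<le> norm z * (norm p * norm z)" by (rule mult_mono[OF ez pz]) auto
    finally have 1: "(e \<bullet> z) * (p \<bullet> z) \<le> norm p * (norm z)^2" by (simp add: power2_eq_square algebra_simps)
    have "(p \<bullet> z)^2 \<le> (norm p * norm z)^2" using pz by (metis abs_ge_zero power2_abs power_mono)
    also have "\<dots> \<le> norm p * (norm z)^2" unfolding power_mult_distrib by (rule mult_right_mono[OF np2]) simp
    finally have 2: "(p \<bullet> z)^2 \<le> norm p * (norm z)^2" .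
    have "((e + p) \<bullet> z)^2 = (e \<bullet> z)^2 + 2 * ((e \<bullet> z) * (p \<bullet> z)) + (p \<bullet> z)^2"
      by (simp add: inner_add_left power2_eq_square algebra_simps)
    then show ?thesis using 1 2 by linarith
  qed
  have nv: "(norm ?v)^2 \<le> (1 + 4 / Nx) * (norm z)^2"
  proof -
    have "(norm ?v)^2 = (norm z)^2 + ((e + p) \<bullet> z)^2 / Nx"
      using norm_frame_spacelike[OF sp(1), of z] DLx[of z] by simp
    also have "((e + p) \<bullet> z)^2 \<le> 4 * (norm z)^2"
    proof -
      have "(e \<bullet> z)^2 \<le> (norm z)^2"
        using Cauchy_Schwarz_ineq2[of e z] e by (metis abs_ge_zero mult_1 power2_abs power_mono)
      moreover have "norm p * (norm z)^2 \<le> 1 * (norm z)^2" by (rule mult_right_mono[OF p]) simp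
      ultimately show ?thesis using epz by linarith
    qed
    finally show ?thesis using Nx by (simp add: algebra_simps divide_right_mono)
  qed
  have cost: "(norm (?v - ?w))^2 - (e \<bullet> (?v - ?w))\<^sup>2 \<le> 4 * (norm p)^2 / Nx^2 * (norm z)^2"
  proof -
    define bx where "bx = 1 / (1 - (norm ?Dx)\<^sup>2 + sqrt (1 - (norm ?Dx)\<^sup>2))"
    define q where "q = bx * (?Dx \<bullet> z) / gx"
    define qy where "qy = 1 / (1 - (norm ?Dy)\<^sup>2 + sqrt (1 - (norm ?Dy)\<^sup>2)) * (?Dy \<bullet> z) / gy"
    define q' where "q' = q - qy"
    have "(bx * (?Dx \<bullet> z)) *\<^sub>R ?Dx = q *\<^sub>R (gx *\<^sub>R ?Dx)" using gx0 by (simp add: q_def)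
    then have v: "?v = z + q *\<^sub>R (e + p)" unfolding frame_def bx_def[symmetric] Dx by simp
    have "(1 / (1 - (norm ?Dy)\<^sup>2 + sqrt (1 - (norm ?Dy)\<^sup>2)) * (?Dy \<bullet> z)) *\<^sub>R ?Dy = qy *\<^sub>R (gy *\<^sub>R ?Dy)"
      using gy0 by (simp add: qy_def)
    then have w: "?w = z + qy *\<^sub>R e" unfolding frame_def Dy by simp
    have vw: "?v - ?w = q *\<^sub>R p + q' *\<^sub>R e"
      unfolding v w q'_def by (simp add: algebra_simps)
    have "(norm (q *\<^sub>R p + q' *\<^sub>R e))^2 - (e \<bullet> (q *\<^sub>R p + q' *\<^sub>R e))\<^sup>2 = q^2 * ((norm p)^2 - (e \<bullet> p)\<^sup>2)"
      using e unfolding power2_norm_eq_inner norm_eq_1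
      by (simp add: inner_add_left inner_add_right inner_commute power2_eq_square algebra_simps)
    then have c1: "(norm (?v - ?w))^2 - (e \<bullet> (?v - ?w))\<^sup>2 \<le> q^2 * (norm p)^2"
      unfolding vw by (simp add: mult_left_mono)
    have "q^2 \<le> 4 / Nx^2 * (norm z)^2"
    proof -
      have A: "0 < Nx / gx^2" using Nx gx0 by simp
      have A': "0 < Nx / gx^2 + sqrt (Nx / gx^2)" by (rule add_pos_pos) (use A in simp_all)
      then have bx0: "0 < bx" unfolding bx_def sx by simp
      have "bx \<le> 1 / (Nx / gx^2)"
        unfolding bx_def sx by (rule divide_left_mono) (use A A' mult_pos_pos[OF A' A] in auto)
      then have bx: "0 < bx" "bx \<le> gx^2 / Nx" using bx0 by simp_all
      have "\<bar>?Dx \<bullet> z\<bar> \<le> norm ?Dx * norm z" by (rule Cauchy_Schwarz_ineq2)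
      also have "\<dots> \<le> 1 * norm z" by (rule mult_right_mono) (use sp in auto)
      finally have "bx * \<bar>?Dx \<bullet> z\<bar> \<le> gx^2 / Nx * norm z" using bx by (intro mult_mono) auto
      then have "\<bar>q\<bar> \<le> gx / Nx * norm z"
        using gx0 bx by (simp add: q_def abs_mult field_simps power2_eq_square)
      also have "\<dots> \<le> 2 / Nx * norm z" using g Nx by (intro mult_right_mono divide_right_mono) auto
      finally have "q^2 \<le> (2 / Nx * norm z)^2" by (metis abs_ge_zero power2_abs power_mono)
      then show ?thesis by (simp add: power_mult_distrib power_divide)
    qed
    then have "q^2 * (norm p)^2 \<le> 4 / Nx^2 * (norm z)^2 * (norm p)^2" by (rule mult_right_mono) simp
    with c1 show ?thesis by (simp add: algebra_simps)
  qed
  have Sx: "z \<bullet> (sym_shape u x *v z) = - (1 / sqrt Nx) * (gx * (?v \<bullet> (hess u x *v ?v)))"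
    unfolding sym_shape_quadratic_form Wx by simp
  have Sy: "gy * (?w \<bullet> (hess u y *v ?w)) = - (sqrt Ny * (z \<bullet> (sym_shape u y *v z)))"
    unfolding sym_shape_quadratic_form Wy using Ny by simp
  let ?E = "2 * eps * (1 + 4 / Nx) + 4 * (norm p)^2 / (Nx^2 * d) + 3 * ax * norm p / Nx"
  have "gx * (?v \<bullet> (hess u x *v ?v)) \<le> - (sqrt Ny * (z \<bullet> (sym_shape u y *v z)))
      - (ay / Ny - ax / Nx) * (e \<bullet> z)^2 + ?E * (norm z)^2"
  proof -
    have "gx * (?v \<bullet> (hess u x *v ?v)) \<le> ax * (((e + p) \<bullet> z)^2 / Nx) + 2 * eps * (norm ?v)^2
       + - (sqrt Ny * (z \<bullet> (sym_shape u y *v z))) - ay * ((e \<bullet> z)^2 / Ny)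
       + ((norm (?v - ?w))^2 - (e \<bullet> (?v - ?w))\<^sup>2) / d"
      using H[of ?v ?w] unfolding DLx DLy Sy by linarith
    moreover have "ax * (((e + p) \<bullet> z)^2 / Nx) \<le> ax * (((e \<bullet> z)^2 + 3 * norm p * (norm z)^2) / Nx)"
      using epz a Nx by (intro mult_left_mono divide_right_mono) auto
    moreover have "2 * eps * (norm ?v)^2 \<le> 2 * eps * ((1 + 4 / Nx) * (norm z)^2)"
      using nv eps by (intro mult_left_mono) auto
    moreover have "((norm (?v - ?w))^2 - (e \<bullet> (?v - ?w))\<^sup>2) / d \<le> (4 * (norm p)^2 / Nx^2 * (norm z)^2) / d"
      using cost d by (intro divide_right_mono) auto
    ultimately have "gx * (?v \<bullet> (hess u x *v ?v)) \<le> ax * (((e \<bullet> z)^2 + 3 * norm p * (norm z)^2) / Nx)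
       + 2 * eps * ((1 + 4 / Nx) * (norm z)^2)
       + - (sqrt Ny * (z \<bullet> (sym_shape u y *v z))) - ay * ((e \<bullet> z)^2 / Ny)
       + (4 * (norm p)^2 / Nx^2 * (norm z)^2) / d" by linarith
    also have "\<dots> = - (sqrt Ny * (z \<bullet> (sym_shape u y *v z)))
      - (ay / Ny - ax / Nx) * (e \<bullet> z)^2 + ?E * (norm z)^2"
      by (simp add: algebra_simps add_divide_distrib diff_divide_distrib)
    finally show ?thesis .
  qed
  then have "- (1 / sqrt Nx) * (- (sqrt Ny * (z \<bullet> (sym_shape u y *v z)))
      - (ay / Ny - ax / Nx) * (e \<bullet> z)^2 + ?E * (norm z)^2) \<le> z \<bullet> (sym_shape u x *v z)"
    unfolding Sx by (rule mult_left_mono_neg) (use Nx in simp)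
  moreover have "- (1 / sqrt Nx) * (- (sqrt Ny * A) - B + C)
     = sqrt Ny / sqrt Nx * (A + 1 / sqrt Ny * B - 1 / sqrt Ny * C)" for A B C
    using Ny Nx by (simp add: field_simps)
  ultimately show "sqrt Ny / sqrt Nx * (z \<bullet> (sym_shape u y *v z) + 1 / sqrt Ny * (ay / Ny - ax / Nx) * (e \<bullet> z)^2
         - 1 / sqrt Ny * ?E * (norm z)^2) \<le> z \<bullet> (sym_shape u x *v z)"
    by (simp only: mult.assoc)
qed

section \<open>The height potential\<close>

text \<open>
  The doubled function is negative outside a compact set: the oscillation of \<open>G\<close> bounds \<open>|x - y|\<close>, and
  the penalty bounds \<open>|x|\<close>.
\<close>

lemma doubling_max_exists:
  fixes u :: "real^'n \<Rightarrow> real" and G :: "real \<Rightarrow> real"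
  assumes u: "continuous_on UNIV u" and G: "continuous_on {0..U} G" and uU: "\<And>x. 0 \<le> u x \<and> u x \<le> U"
    and osc: "\<And>s t. 0 \<le> s \<Longrightarrow> s \<le> U \<Longrightarrow> 0 \<le> t \<Longrightarrow> t \<le> U \<Longrightarrow> G s - G t \<le> C" and eps: "eps > 0"
    and pos: "0 < G (u x0) - G (u y0) - norm (x0 - y0) - eps * (norm x0)^2"
  shows "\<exists>x y. \<forall>x' y'. G (u x') - G (u y') - norm (x' - y') - eps * (norm x')^2
        \<le> G (u x) - G (u y) - norm (x - y) - eps * (norm x)^2"
proof -
  define Z where "Z = (\<lambda>(x, y). G (u x) - G (u y) - norm (x - y) - eps * (norm x)^2)"
  have "C \<ge> 0" using osc[of 0 0] uU[of 0] by simp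
  \<comment> \<open>The summand \<open>1\<close> gives \<open>norm x \<le> (norm x)\<^sup>2\<close> for \<open>norm x > R\<close>.\<close>
  define R where "R = 1 + C / eps"
  have R1: "R \<ge> 1" using \<open>C \<ge> 0\<close> eps by (simp add: R_def)
  define K where "K = cball (0 :: real^'n) R \<times> cball (0 :: real^'n) (R + C)"
  have outside: "Z (x, y) \<le> 0" if "(x, y) \<notin> K" for x y
  proof (rule ccontr)
    assume "\<not> Z (x, y) \<le> 0"
    then have Zp: "norm (x - y) + eps * (norm x)^2 < C"
      using osc[of "u x" "u y"] uU by (fastforce simp: Z_def)
    have e2: "0 \<le> eps * (norm x)^2" using eps by simp
    have "norm x \<le> R"
    proof (rule ccontr)
      assume "\<not> norm x \<le> R"
      then have x: "norm x > R" by simp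
      have "norm x \<le> (norm x)^2" using mult_left_mono[of 1 "norm x" "norm x"] x R1 by (simp add: power2_eq_square)
      then have "eps * R \<le> eps * (norm x)^2" using x eps by (intro mult_left_mono) auto
      moreover have "eps * R = eps + C" using eps by (simp add: R_def algebra_simps)
      ultimately show False using Zp eps norm_ge_zero[of "x - y"] by linarith
    qed
    moreover have "norm y \<le> R + C"
    proof -
      have "norm y \<le> norm x + norm (x - y)"
        using norm_triangle_ineq4[of x "x - y"] by simp
      then show ?thesis using \<open>norm x \<le> R\<close> Zp e2 by linarith
    qed
    ultimately show False using that by (simp add: K_def)
  qed
  have "continuous_on UNIV (\<lambda>x. G (u x))"
    by (rule continuous_on_compose2[OF G u]) (use uU in auto)
  then have Gu: "continuous_on S (\<lambda>x. G (u x))" for S using continuous_on_subset by blast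
  have "continuous_on K Z"
    unfolding Z_def case_prod_unfold
    by (intro continuous_intros continuous_on_compose2[OF Gu[of UNIV]]) auto
  moreover have "compact K" unfolding K_def by (intro compact_Times compact_cball)
  moreover have x0K: "(x0, y0) \<in> K" using outside[of x0 y0] pos by (auto simp: Z_def)
  ultimately obtain w where w: "w \<in> K" "\<And>z. z \<in> K \<Longrightarrow> Z z \<le> Z w"
    using continuous_attains_sup[of K Z] by blast
  have "Z (x', y') \<le> Z w" for x' y'
  proof (cases "(x', y') \<in> K")
    case False
    then have "Z (x', y') \<le> 0" by (rule outside)
    also have "0 \<le> Z (x0, y0)" using pos by (simp add: Z_def)
    also have "\<dots> \<le> Z w" by (rule w(2)[OF x0K])
    finally show ?thesis .
  qed (rule w(2))
  then show ?thesis by (intro exI[of _ "fst w"] exI[of _ "snd w"]) (simp add: Z_def case_prod_unfold)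
qed

text \<open>
  The condition that \<open>potential mu \<circ> u\<close> be \<open>1\<close>-Lipschitz prescribes \<open>|Du| \<le> 1/potential'\<close>. Any concave function
  slightly steeper than the identity would bound the slope away from one; this one has the further
  property, expressed by \<open>potential_ratio_bounds\<close>, that \<open>G''/(G'\<^sup>2 - 1)\<close> is strictly increasing.
\<close>

definition potential :: "real \<Rightarrow> real \<Rightarrow> real" where "potential mu t = t - mu / (1 + t)"
definition potential' :: "real \<Rightarrow> real \<Rightarrow> real" where "potential' mu t = 1 + mu / (1 + t)^2"
definition potential'' :: "real \<Rightarrow> real \<Rightarrow> real" where "potential'' mu t = - (2 * mu / (1 + t) ^ 3)"

lemma potential_derivs:
  assumes "t \<ge> 0"
  shows "(potential mu has_real_derivative potential' mu t) (at t)"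
    and "(potential' mu has_real_derivative potential'' mu t) (at t)"
proof -
  have t: "1 + t \<noteq> 0" using assms by simp
  show "(potential mu has_real_derivative potential' mu t) (at t)"
    unfolding potential_def potential'_def
    using t by (auto intro!: derivative_eq_intros simp: power2_eq_square)
  show "(potential' mu has_real_derivative potential'' mu t) (at t)"
  proof -
    have "(potential' mu has_real_derivative - (mu * (2 * (1 + t))) / ((1 + t)^2 * (1 + t)^2)) (at t)"
      unfolding potential'_def using t by (auto intro!: derivative_eq_intros)
    moreover have "- (mu * (2 * (1 + t))) / ((1 + t)^2 * (1 + t)^2) = potential'' mu t"
    proof -
      have "- (mu * (2 * s)) / (s^2 * s^2) = - (2 * mu / s ^ 3)" if "s \<noteq> 0" for s
        using that by (simp add: power2_eq_square power3_eq_cube ac_simps)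
      from this[OF t] show ?thesis by (simp only: potential''_def)
    qed
    ultimately show ?thesis by simp
  qed
qed

lemma potential_diff:
  assumes "0 \<le> a" "0 \<le> b"
  shows "potential mu a - potential mu b = (a - b) * (1 + mu / ((1 + a) * (1 + b)))"
proof -
  define s where "s = 1 + a"
  define r where "r = 1 + b"
  have "s > 0" "r > 0" using assms by (auto simp: s_def r_def)
  then have "(s - mu / s) - (r - mu / r) = (s - r) * (1 + mu / (s * r))"
    by (simp add: field_simps)
  then show ?thesis by (simp add: potential_def s_def r_def)
qed

context
  fixes mu U :: real
  assumes mu: "0 < mu" "mu \<le> 1" and U: "0 \<le> U"
begin

lemma potential'_bounds:
  assumes "0 \<le> t" shows "1 \<le> potential' mu t" "potential' mu t \<le> 2"
proof -
  have "1 \<le> (1 + t)^2" using assms by (simp add: one_le_power)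
  then have "mu / (1 + t)^2 \<le> mu / 1" using mu by (intro divide_left_mono) auto
  then show "potential' mu t \<le> 2" using mu by (simp add: potential'_def)
  show "1 \<le> potential' mu t" using mu by (simp add: potential'_def)
qed

lemma potential_N_bounds:
  assumes "0 \<le> t" "t \<le> U"
  shows "2 * mu / (1 + U)^2 \<le> (potential' mu t)^2 - 1" "(potential' mu t)^2 - 1 \<le> 3 * mu"
proof -
  let ?h = "mu / (1 + t)^2"
  have N: "(potential' mu t)^2 - 1 = ?h * (2 + ?h)" by (simp add: potential'_def power2_eq_square algebra_simps)
  have "(1 + t)^2 \<le> (1 + U)^2" using assms by (intro power_mono) auto
  then have "mu / (1 + U)^2 \<le> ?h" using mu assms by (intro divide_left_mono) auto
  moreover have h0: "?h \<ge> 0" using mu by simp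
  then have "2 * ?h \<le> ?h * (2 + ?h)" by (simp add: algebra_simps)
  ultimately show "2 * mu / (1 + U)^2 \<le> (potential' mu t)^2 - 1" unfolding N by simp
  have "1 \<le> (1 + t)^2" using assms by (simp add: one_le_power)
  then have "?h \<le> mu / 1" using mu by (intro divide_left_mono) auto
  then have "?h * (2 + ?h) \<le> mu * 3" using h0 mu by (intro mult_mono) auto
  then show "(potential' mu t)^2 - 1 \<le> 3 * mu" unfolding N by simp
qed

lemma potential_N_gap:
  assumes "0 \<le> b" "b \<le> a" "a \<le> U"
  shows "4 * mu * (a - b) / (1 + U) ^ 4 \<le> (potential' mu b)^2 - (potential' mu a)\<^sup>2"
proof -
  let ?ha = "mu / (1 + a)^2" and ?hb = "mu / (1 + b)^2"
  have a0: "0 \<le> a" using assms by simp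
  have ab: "1 + a \<noteq> 0" "1 + b \<noteq> 0" using assms by auto
  have "?hb - ?ha = mu * (a - b) * (2 + a + b) / ((1 + a)^2 * (1 + b)^2)"
  proof -
    have "mu / r^2 - mu / s^2 = mu * (s - r) * (s + r) / (s^2 * r^2)" if "s \<noteq> 0" "r \<noteq> 0" for s r
      using that by (simp add: field_simps power2_eq_square)
    from this[OF ab] show ?thesis by simp
  qed
  moreover have "2 * mu * (a - b) / (1 + U) ^ 4 \<le> mu * (a - b) * (2 + a + b) / ((1 + a)^2 * (1 + b)^2)"
  proof (rule frac_le)
    show "2 * mu * (a - b) \<le> mu * (a - b) * (2 + a + b)"
      using mult_left_mono[of 2 "2 + a + b" "mu * (a - b)"] mu assms by (simp add: algebra_simps)
    have "(1 + a)^2 * (1 + b)^2 \<le> (1 + U)^2 * (1 + U)^2" using assms by (intro mult_mono power_mono) auto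
    then show "(1 + a)^2 * (1 + b)^2 \<le> (1 + U) ^ 4" by (simp add: power_add[symmetric])
  qed (use mu assms in auto)
  ultimately have h: "2 * mu * (a - b) / (1 + U) ^ 4 \<le> ?hb - ?ha" by simp
  have h0: "0 \<le> ?ha" "0 \<le> ?hb" using mu by auto
  have "0 \<le> 2 * mu * (a - b) / (1 + U) ^ 4" using mu assms by simp
  with h have d0: "0 \<le> ?hb - ?ha" by linarith
  have "(potential' mu b)^2 - (potential' mu a)\<^sup>2 = (?hb - ?ha) * 2 + (?hb - ?ha) * (?ha + ?hb)"
    by (simp add: potential'_def power2_eq_square algebra_simps)
  moreover have "0 \<le> (?hb - ?ha) * (?ha + ?hb)" using d0 h0 by (intro mult_nonneg_nonneg) auto
  moreover have "4 * mu * (a - b) / (1 + U) ^ 4 = 2 * (2 * mu * (a - b) / (1 + U) ^ 4)" by simp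
  moreover have "c4 \<le> y" if "y = P * 2 + R" "0 \<le> R" "c4 = 2 * c" "c \<le> P" for y P R c c4 :: real
    using that by linarith
  ultimately show ?thesis using h by blast
qed

lemma potential_ratio:
  assumes "0 \<le> t"
  shows "- potential'' mu t / ((potential' mu t)^2 - 1) = 2 / (2 * (1 + t) + mu / (1 + t))"
proof -
  define s where "s = 1 + t"
  have s: "s > 0" using assms by (simp add: s_def)
  have "(potential' mu t)^2 - 1 = (mu / s ^ 3) * (2 * s + mu / s)"
    unfolding potential'_def s_def[symmetric] using s by (simp add: field_simps power2_eq_square power3_eq_cube)
  moreover have "- potential'' mu t = (mu / s ^ 3) * 2" unfolding potential''_def s_def[symmetric] by simp
  ultimately show ?thesis using s mu unfolding s_def[symmetric] by simp
qed

text \<open>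
  With respect to \<open>G\<close>, the logarithmic derivative of \<open>(G'\<^sup>2 - 1) powr (-1/2)\<close> is \<open>r\<close>, so the second bound is a
  strict log-concavity. It is uniform in \<open>mu\<close>, so letting \<open>mu \<rightarrow> 0\<close> makes the curvatures large at no loss.
\<close>

lemma potential_ratio_bounds:
  assumes "0 \<le> b" "b \<le> a" "a \<le> U"
  defines "r \<equiv> \<lambda>t. - potential'' mu t / ((potential' mu t)^2 - 1)"
  shows "2 / (2 * U + 3) \<le> r b" and "2 * (a - b) / (2 * U + 3)^2 \<le> r b - r a"
proof -
  define E where "E = (\<lambda>t. 2 * (1 + t) + mu / (1 + t))"
  have E: "0 < E t" "E t \<le> 2 * U + 3" if "0 \<le> t" "t \<le> U" for t
  proof -
    have "mu / (1 + t) \<le> 1" using that mu by (simp add: field_simps)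
    moreover have "2 * (1 + t) + q \<le> 2 * U + 3" if "q \<le> 1" for q
      using that \<open>t \<le> U\<close> by simp
    ultimately show "E t \<le> 2 * U + 3" unfolding E_def by blast
    show "0 < E t" using that mu by (auto simp: E_def intro!: add_pos_nonneg)
  qed
  have r: "r t = 2 / E t" if "0 \<le> t" for t using potential_ratio[OF that] by (simp add: r_def E_def)
  have a: "0 \<le> a" and b: "b \<le> U" using assms by auto
  note Ea = E[OF a assms(3)] and Eb = E[OF assms(1) b]
  show "2 / (2 * U + 3) \<le> r b" unfolding r[OF assms(1)] using Eb by (intro divide_left_mono) auto
  have "E a - E b = (a - b) * (2 - mu / ((1 + a) * (1 + b)))"
  proof -
    have "(2 * s + mu / s) - (2 * r + mu / r) = (s - r) * (2 - mu / (s * r))" if "s > 0" "r > 0" for s r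
      using that by (simp add: field_simps)
    from this[of "1 + a" "1 + b"] show ?thesis using a assms(1) by (simp add: E_def)
  qed
  moreover have "mu / ((1 + a) * (1 + b)) \<le> 1"
  proof -
    have "1 \<le> (1 + a) * (1 + b)" using a assms(1) by (simp add: algebra_simps)
    then show ?thesis using mu by (simp add: divide_le_eq)
  qed
  then have "(a - b) * 1 \<le> (a - b) * (2 - mu / ((1 + a) * (1 + b)))"
    using assms(2) by (intro mult_left_mono) auto
  ultimately have dE: "a - b \<le> E a - E b" by simp
  have "r b - r a = 2 * (E a - E b) / (E b * E a)"
    unfolding r[OF a] r[OF assms(1)] using Ea Eb by (simp add: field_simps)
  moreover have "2 * (a - b) / (2 * U + 3)^2 \<le> 2 * (E a - E b) / (E b * E a)"
  proof (rule frac_le)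
    show "E b * E a \<le> (2 * U + 3)^2"
      unfolding power2_eq_square using Ea Eb U by (intro mult_mono) auto
  qed (use dE assms(2) Ea Eb in auto)
  ultimately show "2 * (a - b) / (2 * U + 3)^2 \<le> r b - r a" by simp
qed

end

lemma powr_diff_le:
  fixes a b p U :: real
  assumes "0 \<le> b" "b < a" "a \<le> U" "1 \<le> p"
  shows "a powr p - b powr p \<le> p * U powr (p - 1) * (a - b)"
proof (cases "b = 0")
  case True
  have a0: "a > 0" using assms by simp
  have "a powr p = a powr (p - 1) * a" using a0 powr_add[of a "p - 1" 1] by simp
  also have "\<dots> \<le> U powr (p - 1) * a" using assms a0 by (intro mult_right_mono powr_mono2) auto
  also have "\<dots> \<le> p * U powr (p - 1) * a" using assms a0 by (intro mult_right_mono) (auto simp: mult_le_cancel_right1)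
  finally show ?thesis using True by simp
next
  case False
  then have b0: "b > 0" using assms by simp
  have "((\<lambda>x. x powr p) has_real_derivative p * x powr (p - 1)) (at x)" if "b \<le> x" "x \<le> a" for x
    using b0 that by (intro has_real_derivative_powr) auto
  from MVT2[OF assms(2) this]
  obtain z where z: "b < z" "z < a" "a powr p - b powr p = (a - b) * (p * z powr (p - 1))"
    by blast
  have "z powr (p - 1) \<le> U powr (p - 1)" using z b0 assms by (intro powr_mono2) auto
  then have "(a - b) * (p * z powr (p - 1)) \<le> (a - b) * (p * U powr (p - 1))"
    using assms by (intro mult_left_mono) auto
  then show ?thesis using z(3) by (simp add: algebra_simps)
qed

section \<open>Curvature at a doubled maximum\<close>

text \<open>
  The two points of a doubled maximum carry matrices \<open>S\<^sub>x\<close> and \<open>S\<^sub>y\<close> with \<open>S\<^sub>x \<ge> \<rho> M\<close>, where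
  \<open>M = S\<^sub>y + al D e e\<^sup>T - al Er\<close> and \<open>\<rho> \<ge> 1\<close>. Monotonicity, homogeneity and \<open>sigma_op_increase\<close> turn this into
  a lower bound for \<open>u x powr p - u y powr p\<close>. Under the smallness conditions the
  penalty costs at most half of the gain that log-concavity gives for a height difference \<open>om\<close>.
\<close>

lemma doubling_maximum_inequality:
  fixes u :: "real^'n \<Rightarrow> real" and mu U om eps p :: real
  assumes S: "entire_solution k p u" and uU: "\<And>x. u x \<le> U"
    and k: "1 \<le> k" "k \<le> CARD('n)" and U: "0 \<le> U" and mu: "0 < mu" "mu \<le> 1"
    and xy: "x \<noteq> y"
    and max: "\<And>x' y'. potential mu (u x') - potential mu (u y') - norm (x' - y') - eps * (norm x')^2
        \<le> potential mu (u x) - potential mu (u y) - norm (x - y) - eps * (norm x)^2"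
    and om: "om > 0" "om \<le> u x - u y" "om \<le> norm (x - y)" and eps: "eps \<ge> 0"
  defines "q \<equiv> norm ((2 * eps) *\<^sub>R x)" and "Nm \<equiv> 2 * mu / (1 + U)^2"
  defines "Eb \<equiv> 2 * eps * (1 + 8 / Nm) + 16 * q^2 / (Nm^2 * om) + 12 * q / Nm"
  assumes small: "q \<le> 1" "3 * q \<le> 4 * mu * om / (1 + U) ^ 4" "6 * q \<le> Nm"
      "12 * q / Nm^2 \<le> om / (2 * U + 3)^2" "Eb \<le> 2 / (2 * U + 3)"
      "Eb \<le> om / ((2 * U + 3)^2 * (4 * (real CARD('n) * 2 ^ CARD('n))))"
  shows "u y powr p + (u x - u y) / (2 * (2 * U + 3)^2) * (2 / (2 * U + 3)) ^ (k - 1) * (1 / sqrt (3 * mu)) ^ k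
     \<le> u x powr p"
proof -
  note E = entire_solutionD[OF S]
  define a where "a = u x"
  define b where "b = u y"
  have ab: "0 \<le> b" "b < a" "a \<le> U" "om \<le> a - b" "0 \<le> a" "b \<le> U"
    using E(3)[of x] E(3)[of y] uU[of x] uU[of y] om by (auto simp: a_def b_def)
  define d where "d = norm (x - y)"
  have d0: "d > 0" using xy by (simp add: d_def)
  define e where "e = (1 / norm (x - y)) *\<^sub>R (x - y)"
  have e: "norm e = 1" using xy by (simp add: e_def)
  define pv where "pv = (2 * eps) *\<^sub>R x"
  have q: "q = norm pv" by (simp add: q_def pv_def)
  have q0: "0 \<le> q" by (simp add: q)
  note dc = doubling_conditions[OF E(1) E(3) potential_derivs(1) potential_derivs(2) xy max]
  define gx where "gx = potential' mu a"
  define gy where "gy = potential' mu b"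
  define ax where "ax = - potential'' mu a"
  define ay where "ay = - potential'' mu b"
  have g: "1 \<le> gx" "gx \<le> 2" "1 \<le> gy"
    using potential'_bounds[OF mu U ab(5)] potential'_bounds[OF mu U ab(1)] by (auto simp: gx_def gy_def)
  have ax0: "0 \<le> ax" "0 \<le> ay" using mu ab by (auto simp: ax_def ay_def potential''_def)
  have ax2: "ax \<le> 2"
  proof -
    have "1 \<le> (1 + a) ^ 3" using ab by (simp add: one_le_power)
    then have "2 * mu / (1 + a) ^ 3 \<le> 2 * mu / 1" using mu ab(5) by (intro divide_left_mono) auto
    then show ?thesis using mu by (simp add: ax_def potential''_def)
  qed
  have Dx: "gx *\<^sub>R grad u x = e + pv" and Dy: "gy *\<^sub>R grad u y = e"
    using dc(1,2) by (simp_all add: gx_def gy_def a_def b_def e_def pv_def)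
  have H: "gx * (v \<bullet> (hess u x *v v)) - ax * (grad u x \<bullet> v)^2 - 2 * eps * (norm v)^2
       - gy * (w \<bullet> (hess u y *v w)) + ay * (grad u y \<bullet> w)^2
       \<le> ((norm (v - w))^2 - (e \<bullet> (v - w))\<^sup>2) / d" for v w
    using dc(3)[of v w] by (simp add: gx_def gy_def ax_def ay_def a_def b_def e_def d_def)
  have np: "norm pv \<le> 1" using small(1) q by simp
  note sc = shape_comparison[OF E(2) E(2) e d0 eps g ax0 np Dx Dy H]
  define Nx where "Nx = gx^2 - (norm (e + pv))\<^sup>2"
  define Ny where "Ny = gy^2 - 1"
  define Na where "Na = gx^2 - 1"
  have Nx0: "Nx > 0" and Ny0: "Ny > 0" using sc(1,2) by (simp_all add: Nx_def Ny_def)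
  have Nm0: "Nm > 0" using mu U by (simp add: Nm_def)
  have Na: "Nm \<le> Na" and Nyb: "Nm \<le> Ny" "Ny \<le> 3 * mu"
    using potential_N_bounds[OF mu U ab(5,3)] potential_N_bounds[OF mu U ab(1,6)]
    by (simp_all add: Nm_def Na_def Ny_def gx_def gy_def)
  have gap: "3 * q \<le> Ny - Na"
  proof -
    have "4 * mu * om / (1 + U) ^ 4 \<le> 4 * mu * (a - b) / (1 + U) ^ 4"
      using ab mu U by (intro divide_right_mono mult_left_mono) auto
    also have "\<dots> \<le> gy^2 - gx\<^sup>2"
      using potential_N_gap[OF mu U ab(1) _ ab(3)] ab by (simp add: gx_def gy_def)
    finally show ?thesis using small(2) by (simp add: Ny_def Na_def)
  qed
  have nep: "\<bar>(norm (e + pv))\<^sup>2 - 1\<bar> \<le> 3 * q"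
  proof -
    have "\<bar>e \<bullet> pv\<bar> \<le> q" using Cauchy_Schwarz_ineq2[of e pv] e by (simp add: q)
    moreover have "q^2 \<le> q" using small(1) q0 by (simp add: power2_eq_square mult_left_le)
    moreover have "(norm (e + pv))^2 = 1 + 2 * (e \<bullet> pv) + q^2"
      using e unfolding q power2_norm_eq_inner norm_eq_1
      by (simp add: inner_add_left inner_add_right inner_commute)
    moreover have "0 \<le> q^2" by simp
    ultimately show ?thesis by linarith
  qed
  have Nxa: "\<bar>Nx - Na\<bar> \<le> 3 * q" using nep by (simp add: Nx_def Na_def)
  have NxNy: "Nx \<le> Ny" using gap Nxa by linarith
  have Nxm: "Nm / 2 \<le> Nx" using Nxa Na small(3) by linarith
  define al where "al = 1 / sqrt Ny"
  have al0: "al > 0" using Ny0 by (simp add: al_def)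
  have al: "1 / sqrt (3 * mu) \<le> al"
    unfolding al_def using Ny0 Nyb mu by (intro divide_left_mono) auto
  define ry where "ry = ay / Ny"
  define D where "D = ay / Ny - ax / Nx"
  have rat: "2 / (2 * U + 3) \<le> ry" "2 * (a - b) / (2 * U + 3)^2 \<le> ry - ax / Na"
    using potential_ratio_bounds[OF mu U ab(1) _ ab(3)] ab
    by (simp_all add: ry_def ax_def ay_def Na_def Ny_def gx_def gy_def)
  have r0: "0 < 2 / (2 * U + 3)" using U by simp
  then have ry0: "ry > 0" using rat(1) by linarith
  have D: "(a - b) / (2 * U + 3)^2 \<le> D"
  proof -
    have Na0: "Na > 0" using Na Nm0 by linarith
    have "ax / Nx - ax / Na = ax * (Na - Nx) / (Nx * Na)"
      using Nx0 Na0 by (simp add: field_simps)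
    also have "\<dots> \<le> (2 * (3 * q)) / (Nm / 2 * Nm)"
    proof (rule frac_le)
      show "ax * (Na - Nx) \<le> 2 * (3 * q)"
      proof -
        have "ax * (Na - Nx) \<le> ax * (3 * q)" using Nxa ax0 by (intro mult_left_mono) auto
        also have "\<dots> \<le> 2 * (3 * q)" using ax2 q0 by (intro mult_right_mono) auto
        finally show ?thesis .
      qed
      show "Nm / 2 * Nm \<le> Nx * Na" using Nxm Na Nm0 by (intro mult_mono) auto
    qed (use q0 Nm0 in auto)
    also have "\<dots> = 12 * q / Nm^2" by (simp add: power2_eq_square)
    also have "\<dots> \<le> om / (2 * U + 3)^2" by (rule small(4))
    also have "\<dots> \<le> (a - b) / (2 * U + 3)^2" using ab(4) by (intro divide_right_mono) auto
    finally have "ax / Nx - ax / Na \<le> (a - b) / (2 * U + 3)^2" .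
    moreover have "2 * (a - b) / (2 * U + 3)^2 = (a - b) / (2 * U + 3)^2 + (a - b) / (2 * U + 3)^2" by simp
    ultimately show ?thesis using rat(2) unfolding D_def ry_def by linarith
  qed
  have omD: "om / (2 * U + 3)^2 \<le> D"
    by (rule order_trans[OF divide_right_mono[OF ab(4)] D]) simp
  have D0: "D > 0"
  proof -
    have "0 < om / (2 * U + 3)^2" using om U by simp
    then show ?thesis using omD by linarith
  qed
  have Dry: "D \<le> ry" using ax0 Nx0 by (simp add: D_def ry_def)
  define Er where "Er = 2 * eps * (1 + 4 / Nx) + 4 * (norm pv)^2 / (Nx^2 * d) + 3 * ax * norm pv / Nx"
  have Er0: "0 \<le> Er" using eps Nx0 d0 ax0 by (simp add: Er_def)
  have ErEb: "Er \<le> Eb"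
  proof -
    have i: "1 / Nx \<le> 2 / Nm" using Nxm Nm0 Nx0 by (simp add: field_simps)
    have "2 * eps * (1 + 4 * (1 / Nx)) \<le> 2 * eps * (1 + 4 * (2 / Nm))"
      using i eps by (intro mult_left_mono add_left_mono) auto
    moreover have "4 * q^2 / (Nx^2 * d) \<le> 4 * q^2 / ((Nm / 2)^2 * om)"
      using Nxm Nm0 om d0 Nx0 by (intro divide_left_mono mult_mono power_mono mult_pos_pos) (auto simp: d_def)
    moreover have "3 * ax * q * (1 / Nx) \<le> 3 * 2 * q * (2 / Nm)"
      using i ax2 ax0 q0 Nx0 by (intro mult_mono) auto
    ultimately show ?thesis by (simp add: Er_def Eb_def q[symmetric] power_divide)
  qed
  define K where "K = al * ry"
  have K0: "K > 0" using al0 ry0 by (simp add: K_def)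
  have See: "e \<bullet> (sym_shape u y *v e) \<le> - K"
    using sc(3) by (simp add: K_def al_def ry_def Ny_def)
  have dd: "al * D > 0" using al0 D0 by simp
  have e1: "0 \<le> al * Er" using al0 Er0 by simp
  have e2: "al * Er \<le> K"
    unfolding K_def using ErEb small(5) rat(1) al0 by (intro mult_left_mono) auto
  have e3: "real CARD('n) * 2 ^ CARD('n) * (al * Er) * (1 + al * D / K) \<le> al * D / 2"
  proof -
    let ?c = "real CARD('n) * 2 ^ CARD('n)"
    have "al * D / K = D / ry" using al0 by (simp add: K_def)
    also have "\<dots> \<le> 1" using Dry ry0 by simp
    finally have "1 + al * D / K \<le> 2" by simp
    then have "?c * (al * Er) * (1 + al * D / K) \<le> ?c * (al * Er) * 2"
      using e1 by (intro mult_left_mono) auto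
    also have "\<dots> = (2 * ?c * al) * Er" by simp
    also have "\<dots> \<le> (2 * ?c * al) * (om / ((2 * U + 3)^2 * (4 * ?c)))"
      using ErEb small(6) al0 by (intro mult_left_mono) auto
    also have "\<dots> = al * (om / (2 * U + 3)^2) / 2" by simp
    also have "\<dots> \<le> al * D / 2" using omD al0 by (intro divide_right_mono mult_left_mono) auto
    finally show ?thesis .
  qed
  note incr = sigma_op_increase[OF E(4)[of y] k(2) e K0 See dd e1 e2 e3]
  define M where "M = sym_shape u y + (al * D) *\<^sub>R outer e + mat (- (al * Er))"
  have symM: "transpose M = M"
    using sym_shape_symmetric[OF E(1), of y]
    by (simp add: M_def vec_eq_iff transpose_def outer_def mat_def algebra_simps)
  have Mj: "0 \<le> sigma_op j M" if "j \<le> k" for j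
  proof (cases j)
    case (Suc h)
    have "0 \<le> sigma_op (Suc h) (sym_shape u y)" using E(4)[of y] that Suc by (simp add: in_cone_def)
    moreover have "0 \<le> al * D / 2 * K ^ h" using dd K0 by simp
    ultimately show ?thesis using incr[of h] that Suc by (simp add: M_def)
  qed (simp add: symM)
  define rho where "rho = sqrt Ny / sqrt Nx"
  have rho1: "1 \<le> rho" using NxNy Nx0 by (simp add: rho_def)
  have cone: "in_cone k (rho *\<^sub>R M)"
    using symM Mj rho1 by (auto simp: in_cone_def sigma_op_scaleR[OF symM] vec_eq_iff transpose_def)
  have le: "z \<bullet> ((rho *\<^sub>R M) *v z) \<le> z \<bullet> (sym_shape u x *v z)" for z
  proof -
    have "mat c *v z = c *\<^sub>R z" for c
      by (simp add: vec_eq_iff matrix_vector_mult_def mat_def if_distrib if_distribR cong: if_cong)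
    then have "z \<bullet> ((rho *\<^sub>R M) *v z)
      = rho * (z \<bullet> (sym_shape u y *v z) + al * D * (e \<bullet> z)^2 - al * Er * (norm z)^2)"
      unfolding M_def power2_norm_eq_inner
      by (simp add: scaleR_matrix_vector_assoc[symmetric] matrix_vector_mult_add_rdistrib outer_mult_vec
          inner_add_right inner_diff_right power2_eq_square inner_commute[of z e])
    also have "\<dots> \<le> z \<bullet> (sym_shape u x *v z)"
      using sc(4)[of z] unfolding rho_def al_def D_def Er_def Nx_def Ny_def .
    finally show ?thesis .
  qed
  have "al * D / 2 * K ^ (k - 1) + b powr p \<le> sigma_op k M"
    using incr[of "k - 1"] k(1) E(5)[of y] by (simp add: M_def b_def)
  also have "\<dots> \<le> rho ^ k * sigma_op k M"
    using Mj[of k] one_le_power[OF rho1, of k] by (simp add: mult_le_cancel_right1)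
  also have "\<dots> = sigma_op k (rho *\<^sub>R M)" by (simp add: sigma_op_scaleR[OF symM])
  also have "\<dots> \<le> sigma_op k (sym_shape u x)"
    by (rule in_cone_mono(2)[OF cone k(2) sym_shape_symmetric[OF E(1)] le]) simp
  also have "\<dots> = a powr p" using E(5)[of x] by (simp add: a_def)
  finally have main: "al * D / 2 * K ^ (k - 1) + b powr p \<le> a powr p" .
  have "(a - b) / (2 * (2 * U + 3)^2) * (2 / (2 * U + 3)) ^ (k - 1) * (1 / sqrt (3 * mu)) ^ k
     \<le> (D / 2) * ry ^ (k - 1) * al ^ k"
    using D rat(1) al al0 r0 D0 ry0 ab mu
    by (intro mult_mono power_mono) (auto simp: field_simps)
  also have "\<dots> = al * D / 2 * K ^ (k - 1)"
  proof -
    have "al ^ k = al * al ^ (k - 1)" using k(1) by (metis Suc_diff_1 less_eq_Suc_le One_nat_def power_Suc)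
    then show ?thesis by (simp add: K_def power_mult_distrib)
  qed
  finally show ?thesis using main by (simp add: a_def b_def)
qed

section \<open>The gradient bound and the theorem\<close>

text \<open>
  If the Lipschitz bound fails, the maximum of the penalized doubled function inherits a gap \<open>om\<close>
  that is fixed while the penalty tends to zero. So all error terms become small, and
  \<open>doubling_maximum_inequality\<close> contradicts \<open>powr_diff_le\<close> for the chosen \<open>mu\<close>.
\<close>

theorem entire_solution_potential_lipschitz:
  fixes k :: nat and p U :: real
  assumes k: "1 \<le> k" "k \<le> CARD('n)" and p: "1 \<le> p" and U: "0 < U"
  shows "\<exists>mu. 0 < mu \<and> mu \<le> 1 \<and> (\<forall>u :: real^'n \<Rightarrow> real. entire_solution k p u \<and> (\<forall>x. u x \<le> U) \<longrightarrow>
     (\<forall>x y. potential mu (u x) - potential mu (u y) \<le> norm (x - y)))"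
proof -
  define L where "L = p * U powr (p - 1)"
  define c where "c = 2 * U + 3"
  define R where "R = (2 / c) ^ (k - 1)"
  define Q where "Q = 2 * c^2 * L / R"
  \<comment> \<open>Chosen so that \<open>1 / sqrt (3 * mu) = Q + 1\<close>, the lower bound for \<open>W/G'\<close>, exceeds the ratio \<open>Q\<close> between
  the Lipschitz constant \<open>L\<close> of \<open>t powr p\<close> and the gain at the maximum.\<close>
  define mu where "mu = 1 / (3 * (Q + 1)^2)"
  have c0: "c > 0" using U by (simp add: c_def)
  have L0: "L \<ge> 0" using p by (simp add: L_def)
  have R0: "R > 0" using c0 by (simp add: R_def)
  have Q0: "Q \<ge> 0" using L0 R0 by (simp add: Q_def)
  have "1 \<le> (Q + 1)^2" using Q0 by (simp add: one_le_power)
  then have "1 \<le> 3 * (Q + 1)^2" by linarith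
  then have mu: "0 < mu" "mu \<le> 1" by (auto simp: mu_def divide_le_eq)
  have "3 * mu = (1 / (Q + 1))^2" using Q0 by (simp add: mu_def power_divide)
  then have sm: "1 / sqrt (3 * mu) = Q + 1" using Q0 by simp
  define Nm where "Nm = 2 * mu / (1 + U)^2"
  have Nm0: "Nm > 0" using mu U by (simp add: Nm_def)
  have "potential mu (u x0) - potential mu (u y0) \<le> norm (x0 - y0)"
    if S: "entire_solution k p u" and uU: "\<And>x. u x \<le> U" for u :: "real^'n \<Rightarrow> real" and x0 y0
  proof (rule ccontr)
    note E = entire_solutionD[OF S]
    assume "\<not> potential mu (u x0) - potential mu (u y0) \<le> norm (x0 - y0)"
    then have m0: "potential mu (u x0) - potential mu (u y0) - norm (x0 - y0) > 0" by simp
    define m where "m = potential mu (u x0) - potential mu (u y0) - norm (x0 - y0)"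
    define om where "om = m / 4"
    have om: "om > 0" using m0 by (simp add: om_def m_def)
    let ?q = "\<lambda>eps. sqrt (8 * eps * U)"
    define B where "B = (\<lambda>eps q. 2 * eps * (1 + 8 / Nm) + 16 * q^2 / (Nm^2 * om) + 12 * q / Nm)"
    \<comment> \<open>The four thresholds for the first-order error \<open>q\<close> in \<open>doubling_maximum_inequality\<close>.\<close>
    define dl where "dl = Min {1, 4 * mu * om / (1 + U) ^ 4 / 3, Nm / 6, om / c^2 * Nm^2 / 12}"
    define El where "El = min (2 / c) (om / (c^2 * (4 * (real CARD('n) * 2 ^ CARD('n)))))"
    have dl: "dl > 0" using mu om U Nm0 c0 by (simp add: dl_def)
    have El: "El > 0" using om c0 by (simp add: El_def)
    have ql: "(?q \<longlongrightarrow> 0) (at_right 0)" by (auto intro!: tendsto_eq_intros)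
    have "((\<lambda>eps. 2 * eps * (1 + 8 / Nm) + 16 * (?q eps)^2 / (Nm^2 * om) + 12 * ?q eps / Nm)
        \<longlongrightarrow> 2 * 0 * (1 + 8 / Nm) + 16 * 0^2 / (Nm^2 * om) + 12 * 0 / Nm) (at_right 0)"
      using Nm0 om by (intro tendsto_intros ql) auto
    then have Bl: "((\<lambda>eps. B eps (?q eps)) \<longlongrightarrow> 0) (at_right 0)" by (simp add: B_def)
    have el: "((\<lambda>eps. eps * (norm x0)^2) \<longlongrightarrow> 0) (at_right 0)" by (auto intro!: tendsto_eq_intros)
    have "\<forall>\<^sub>F eps in at_right 0. ?q eps < dl \<and> B eps (?q eps) < El \<and> eps * (norm x0)^2 < m / 2 \<and> eps > 0"
      using order_tendstoD(2)[OF ql dl] order_tendstoD(2)[OF Bl El] order_tendstoD(2)[OF el, of "m / 2"]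
        eventually_at_right_less[of 0] m0
      by (intro eventually_conj) (auto simp: m_def)
    then obtain eps where eps: "?q eps < dl" "B eps (?q eps) < El" "eps * (norm x0)^2 < m / 2" "eps > 0"
      using eventually_happens' trivial_limit_at_right_real by blast
    have fac: "1 \<le> 1 + mu / ((1 + u x) * (1 + u y))" "1 + mu / ((1 + u x) * (1 + u y)) \<le> 2" for x y
    proof -
      have "1 \<le> (1 + u x) * (1 + u y)" using E(3)[of x] E(3)[of y] by (simp add: algebra_simps)
      then show "1 \<le> 1 + mu / ((1 + u x) * (1 + u y))" "1 + mu / ((1 + u x) * (1 + u y)) \<le> 2"
        using mu by (simp_all add: divide_le_eq)
    qed
    have "continuous_on {0..U} (potential mu)"
      by (rule DERIV_continuous_on[of _ _ "potential' mu"])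
        (auto intro: has_field_derivative_at_within potential_derivs(1))
    moreover have "potential mu s - potential mu t \<le> 2 * U" if "0 \<le> s" "s \<le> U" "0 \<le> t" "t \<le> U" for s t
    proof -
      have "1 \<le> (1 + s) * (1 + t)" using that by (simp add: algebra_simps)
      then have f: "0 \<le> 1 + mu / ((1 + s) * (1 + t))" "1 + mu / ((1 + s) * (1 + t)) \<le> 2"
        using mu by (simp_all add: divide_le_eq)
      have "(s - t) * (1 + mu / ((1 + s) * (1 + t))) \<le> U * (1 + mu / ((1 + s) * (1 + t)))"
        using that f by (intro mult_right_mono) auto
      also have "\<dots> \<le> U * 2" using f U by (intro mult_left_mono) auto
      finally show ?thesis using potential_diff[of s t mu] that by simp
    qed
    moreover have Z0: "m / 2 < potential mu (u x0) - potential mu (u y0) - norm (x0 - y0) - eps * (norm x0)^2"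
      using eps(3) by (simp add: m_def)
    ultimately obtain x y where max: "\<And>x' y'. potential mu (u x') - potential mu (u y') - norm (x' - y') - eps * (norm x')^2
        \<le> potential mu (u x) - potential mu (u y) - norm (x - y) - eps * (norm x)^2"
      using doubling_max_exists[OF C2_continuous_on[OF E(1)], of U "potential mu" "2 * U" eps x0 y0]
        E(3) uU eps(4) om by (auto simp: om_def)
    have Zm: "m / 2 < potential mu (u x) - potential mu (u y) - norm (x - y) - eps * (norm x)^2"
      using max[of x0 y0] Z0 by linarith
    have ex2: "0 \<le> eps * (norm x)^2" using eps by simp
    let ?f = "1 + mu / ((1 + u x) * (1 + u y))"
    have Gd: "potential mu (u x) - potential mu (u y) = (u x - u y) * ?f" by (rule potential_diff[OF E(3) E(3)])
    have Gp: "m / 2 < (u x - u y) * ?f" using Zm ex2 norm_ge_zero[of "x - y"] unfolding Gd by linarith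
    have m2: "0 < m / 2" using om by (simp add: om_def)
    have "0 < (u x - u y) * ?f" by (rule less_trans[OF m2 Gp])
    then have upos: "u x - u y > 0" using fac(1)[of x y] by (simp add: zero_less_mult_iff)
    have up: "(u x - u y) * ?f \<le> (u x - u y) * 2" using fac(2)[of x y] upos by (intro mult_left_mono) auto
    have "m / 2 < (u x - u y) * 2" by (rule less_le_trans[OF Gp up])
    then have om1: "om \<le> u x - u y" by (simp add: om_def)
    have om2: "om \<le> norm (x - y)" using om1 spacelike_lipschitz[OF E(1,2), of x y] by linarith
    then have xy: "x \<noteq> y" using om by auto
    have "eps * (norm x)^2 \<le> 2 * U"
    proof -
      have "eps * (norm x)^2 < (u x - u y) * ?f"
        using Zm m2 norm_ge_zero[of "x - y"] unfolding Gd by linarith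
      also note up
      also have "(u x - u y) * 2 \<le> 2 * U" using uU[of x] E(3)[of y] by simp
      finally show ?thesis by (rule less_imp_le)
    qed
    then have "4 * eps * (eps * (norm x)^2) \<le> 4 * eps * (2 * U)" using eps by (intro mult_left_mono) auto
    then have "(norm ((2 * eps) *\<^sub>R x))^2 \<le> 8 * eps * U"
      using eps by (simp add: power_mult_distrib power2_eq_square algebra_simps)
    then have q: "norm ((2 * eps) *\<^sub>R x) \<le> ?q eps" by (rule real_le_rsqrt)
    define q where "q = norm ((2 * eps) *\<^sub>R x)"
    have q0: "0 \<le> q" and qd: "q < dl" and qq: "q \<le> ?q eps" using q eps(1) by (auto simp: q_def)
    have "B eps q \<le> B eps (?q eps)"
      unfolding B_def using qq q0 Nm0 om eps(4) U
      by (intro add_mono divide_right_mono mult_left_mono power_mono) auto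
    then have Bq: "B eps q < El" using eps(2) by linarith
    have q4: "q < 1" "q < 4 * mu * om / (1 + U) ^ 4 / 3" "q < Nm / 6" "q < om / c^2 * Nm^2 / 12"
      using qd by (simp_all add: dl_def)
    have "u y powr p + (u x - u y) / (2 * (2 * U + 3)^2) * (2 / (2 * U + 3)) ^ (k - 1) * (1 / sqrt (3 * mu)) ^ k
       \<le> u x powr p"
    proof (rule doubling_maximum_inequality[OF S uU k _ mu xy max om om1 om2])
      show "norm ((2 * eps) *\<^sub>R x) \<le> 1" using q4(1) by (simp add: q_def)
      show "3 * norm ((2 * eps) *\<^sub>R x) \<le> 4 * mu * om / (1 + U) ^ 4"
      proof -
        have "3 * q \<le> X" if "q < X / 3" for X using that by simp
        then show ?thesis unfolding q_def[symmetric] using q4(2) by blast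
      qed
      show "6 * norm ((2 * eps) *\<^sub>R x) \<le> 2 * mu / (1 + U)^2"
        unfolding q_def[symmetric] Nm_def[symmetric] using q4(3) by linarith
      show "12 * norm ((2 * eps) *\<^sub>R x) / (2 * mu / (1 + U)^2)^2 \<le> om / (2 * U + 3)^2"
      proof -
        have "12 * q / N \<le> X" if "q < X * N / 12" "N > 0" for X N
          using that by (simp add: divide_le_eq)
        from this[OF q4(4)] show ?thesis
          unfolding q_def[symmetric] Nm_def[symmetric] c_def[symmetric] using Nm0 by simp
      qed
      show "2 * eps * (1 + 8 / (2 * mu / (1 + U)^2)) + 16 * (norm ((2 * eps) *\<^sub>R x))^2 / ((2 * mu / (1 + U)^2)^2 * om)
          + 12 * norm ((2 * eps) *\<^sub>R x) / (2 * mu / (1 + U)^2) \<le> 2 / (2 * U + 3)"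
        unfolding q_def[symmetric] Nm_def[symmetric] c_def[symmetric] using Bq by (simp add: B_def El_def)
      show "2 * eps * (1 + 8 / (2 * mu / (1 + U)^2)) + 16 * (norm ((2 * eps) *\<^sub>R x))^2 / ((2 * mu / (1 + U)^2)^2 * om)
          + 12 * norm ((2 * eps) *\<^sub>R x) / (2 * mu / (1 + U)^2)
          \<le> om / ((2 * U + 3)^2 * (4 * (real CARD('n) * 2 ^ CARD('n))))"
        unfolding q_def[symmetric] Nm_def[symmetric] c_def[symmetric] using Bq by (simp add: B_def El_def)
    qed (use U eps in auto)
    then have 1: "(u x - u y) / (2 * c^2) * R * (Q + 1) ^ k \<le> u x powr p - u y powr p"
      unfolding sm c_def[symmetric] R_def[symmetric] by simp
    have 2: "u x powr p - u y powr p \<le> L * (u x - u y)"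
      unfolding L_def using E(3)[of y] upos uU[of x] p by (intro powr_diff_le) auto
    have "Q + 1 \<le> (Q + 1) ^ k" using Q0 k by (intro self_le_power) auto
    then have "(u x - u y) / (2 * c^2) * R * (Q + 1) \<le> (u x - u y) / (2 * c^2) * R * (Q + 1) ^ k"
      using upos R0 by (intro mult_left_mono) auto
    moreover have "(u x - u y) / (2 * c^2) * R * (Q + 1) = L * (u x - u y) + (u x - u y) / (2 * c^2) * R"
    proof -
      have "R * Q = 2 * c^2 * L" using R0 by (simp add: Q_def)
      then have RQ: "(u x - u y) / (2 * c^2) * (R * Q) = L * (u x - u y)" using c0 by simp
      have "A * R * (Q + 1) = A * (R * Q) + A * R" for A by (simp add: algebra_simps)
      then show ?thesis unfolding RQ[symmetric] .
    qed
    moreover have "(u x - u y) / (2 * c^2) * R > 0" using upos R0 c0 by simp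
    ultimately show False using 1 2 by linarith
  qed
  then show ?thesis using mu by blast
qed

lemma potential_lipschitz_gradient_bound:
  assumes u: "C2 u" and nonneg: "\<And>x. 0 \<le> u x"
    and lip: "\<And>x y. potential mu (u x) - potential mu (u y) \<le> norm (x - y)"
  shows "potential' mu (u x) * norm (grad u x) \<le> 1"
proof -
  define v where "v = grad u x"
  let ?h = "\<lambda>t. potential mu (u (x + t *\<^sub>R v)) - norm v * t"
  have "(?h has_real_derivative potential' mu (u (x + 0 *\<^sub>R v)) * (grad u (x + 0 *\<^sub>R v) \<bullet> v) - norm v * 1) (at 0)"
    by (intro DERIV_diff DERIV_cmult DERIV_ident
        DERIV_chain2[OF potential_derivs(1)[OF nonneg] C2_line_derivative[OF u]])
  then have dh: "(?h has_real_derivative potential' mu (u x) * (norm v)^2 - norm v) (at 0)"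
    by (simp add: v_def[symmetric] power2_norm_eq_inner)
  have "potential' mu (u x) * (norm v)^2 - norm v \<le> 0"
  proof (rule ccontr)
    assume "\<not> ?thesis"
    then obtain r where r: "r > 0" "\<And>t. 0 < t \<Longrightarrow> t < r \<Longrightarrow> ?h 0 < ?h (0 + t)"
      using DERIV_pos_inc_right[OF dh] by auto
    have "?h 0 < ?h (r / 2)" using r(2)[of "r / 2"] r(1) by simp
    moreover have "potential mu (u (x + (r / 2) *\<^sub>R v)) - potential mu (u x) \<le> r / 2 * norm v"
      using lip[of "x + (r / 2) *\<^sub>R v" x] r(1) by simp
    ultimately show False by (simp add: mult.commute)
  qed
  then have "norm v * (potential' mu (u x) * norm v - 1) \<le> 0" by (simp add: power2_eq_square algebra_simps)
  then show ?thesis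
    using norm_ge_zero[of v] unfolding v_def[symmetric]
    by (cases "norm v = 0") (auto simp: mult_le_0_iff)
qed

text \<open>
  With \<open>W\<close> bounded by \<open>Wstar\<close>, the pointwise estimate holds with the same constant, as \<open>1 + u x \<ge> 1\<close>.
\<close>

theorem theorem1p1:
  fixes k :: nat and p :: real
  assumes "2 \<le> k" and "k < CARD('n::finite)" and "real k \<le> p"
  shows "\<exists>Ustar Wstar CG :: real. Ustar > 0 \<and> Wstar > 1 \<and>
    (\<forall>u :: real^'n \<Rightarrow> real.
       C2 u \<and>
       (\<forall>x. sigma_op k (shape_operator u x) = u x powr p) \<and>
       (\<forall>x. u x \<ge> 0) \<and>
       (\<forall>x. norm (grad u x) < 1) \<and>
       (\<forall>x. eigenvalues (shape_operator u x) \<in> closure (garding_cone k)) \<longrightarrow>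
       (\<forall>x. u x \<le> Ustar) \<and>
       (\<forall>x. Wfun u x \<le> Wstar) \<and>
       (\<forall>x. (norm (grad u x))\<^sup>2 \<le> 1 - Wstar powr (-2)) \<and>
       (\<forall>x. Wfun u x \<le> CG * (1 + u x) powr (1 + p / real k)))"
proof -
  have k1: "1 \<le> k" and kn: "k \<le> CARD('n)" and p1: "1 \<le> p" and p0: "p > 0" using assms by auto
  obtain U where U: "U > 0" "\<And>u :: real^'n \<Rightarrow> real. entire_solution k p u \<Longrightarrow> \<forall>x. u x \<le> U"
    using entire_solution_bounded[OF k1 p0] by blast
  obtain mu where mu: "0 < mu" "mu \<le> 1"
    and lip: "\<And>u :: real^'n \<Rightarrow> real. entire_solution k p u \<Longrightarrow> \<forall>x. u x \<le> U \<Longrightarrow>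
       \<forall>x y. potential mu (u x) - potential mu (u y) \<le> norm (x - y)"
    using entire_solution_potential_lipschitz[OF k1 kn p1 U(1)] by metis
  define g0 where "g0 = 1 + mu / (1 + U)^2"
  have g0: "g0 > 1" using mu U(1) by (simp add: g0_def)
  define s0 where "s0 = 1 / g0"
  have s0: "0 < s0" "s0 < 1" using g0 by (auto simp: s0_def)
  have s2: "0 < s0^2" "s0^2 < 1" using s0 by (auto simp: abs_square_less_1)
  define W where "W = 1 / sqrt (1 - s0\<^sup>2)"
  have W2: "W powr (-2) = 1 - s0\<^sup>2"
  proof -
    have "W > 0" using s2 by (simp add: W_def)
    then have "W powr (-2) = 1 / W^2" by (simp add: powr_minus_divide powr_numeral)
    then show ?thesis using s2 by (simp add: W_def power_divide)
  qed
  have W1: "W > 1"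
  proof -
    have "sqrt (1 - s0\<^sup>2) < 1" using s2 by simp
    then show ?thesis using s2 by (simp add: W_def)
  qed
  have main: "u x \<le> U \<and> Wfun u x \<le> W \<and> (norm (grad u x))\<^sup>2 \<le> 1 - W powr (-2)
      \<and> Wfun u x \<le> W * (1 + u x) powr (1 + p / real k)"
    if S: "entire_solution k p u" for u :: "real^'n \<Rightarrow> real" and x
  proof -
    note E = entire_solutionD[OF S]
    have uU: "u z \<le> U" for z using U(2)[OF S] by blast
    have "potential' mu (u x) * norm (grad u x) \<le> 1"
      using potential_lipschitz_gradient_bound[OF E(1,3)] lip[OF S] uU by blast
    moreover have "g0 \<le> potential' mu (u x)"
    proof -
      have "(1 + u x)^2 \<le> (1 + U)^2" using E(3)[of x] uU by (intro power_mono) auto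
      then have "mu / (1 + U)^2 \<le> mu / (1 + u x)^2"
        using mu E(3)[of x] U(1) by (intro divide_left_mono) auto
      then show ?thesis by (simp add: g0_def potential'_def)
    qed
    then have "g0 * norm (grad u x) \<le> potential' mu (u x) * norm (grad u x)"
      by (rule mult_right_mono) simp
    ultimately have "norm (grad u x) \<le> s0" using g0 by (simp add: s0_def field_simps)
    then have n2: "(norm (grad u x))^2 \<le> s0^2" by (intro power_mono) auto
    have WW: "Wfun u x \<le> W"
      unfolding Wfun_eq[OF E(2)] W_def using n2 s2 by (intro divide_left_mono) auto
    have "1 \<le> (1 + u x) powr (1 + p / real k)"
      using E(3)[of x] p0 by (intro ge_one_powr_ge_zero) auto
    then have "W * 1 \<le> W * (1 + u x) powr (1 + p / real k)"
      using W1 by (intro mult_left_mono) auto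
    then show ?thesis using uU WW n2 by (simp add: W2)
  qed
  show ?thesis
    by (rule exI[of _ U], rule exI[of _ W], rule exI[of _ W])
      (use U(1) W1 main in \<open>auto simp: entire_solution_def\<close>)
qed

end
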